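(* Suppose $(F_1,X_1)$ and $(F_2,X_2)$ are fuchsian subgroups of $\mathrm{Isom}^+(\mathbb{H}^n)$ with $X_1$ and $X_2$ disjoint in $\overline{\mathbb{H}}^n$. Let $x_1\in X_1$ and $x_2\in X_2$ be the endpoints of the unique common perpendicular between the hyperplanes $X_1$ and $X_2$. If $$r(\mathrm{inj}(x_1))+r(\mathrm{inj}(x_2))<d(X_1,X_2),$$ where $\mathrm{inj}(x_i)$ is the injectivity radius of $F_i$ at $x_i$, then the group $G=\langle F_1,F_2\rangle$ is a discrete group of the second kind that, abstractly, is the free product of $F_1$ and $F_2$. Furthermore, the hyperbolic $(n-1)$-hypersurfaces $\Sigma_i=X_i/F_i$ (for $i=1,2$) are totally geodesic boundary hypersurfaces for the hyperbolic manifold $N=\mathbb{H}^n/G$ satisfying $d_N(\Sigma_1,\Sigma_2)=d(X_1,X_2)$. The group $G$ is torsion-free if and only if $F_1$ and $F_2$ are torsion-free.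
   Context: $\mathrm{Isom}^+(\mathbb{H}^n)$ is the group of orientation-preserving isometries of real hyperbolic space $\mathbb{H}^n$, and $\overline{\mathbb{H}}^n$ is $\mathbb{H}^n$ together with its sphere at infinity (hyperplanes are disjoint in $\overline{\mathbb{H}}^n$ if their closures there are disjoint). A fuchsian subgroup of $\mathrm{Isom}^+(\mathbb{H}^n)$ is a pair $(F,X)$ where $X$ is a hyperbolic hyperplane and $F$ is a discrete subgroup keeping invariant $X$ and each of the half-spaces that $X$ bounds in $\mathbb{H}^n$. The injectivity radius $\mathrm{inj}(x)$ of $F$ at $x\in X$ is the radius of the largest hyperbolic disc in $X$ centered at $x$ whose $F$-translates are all disjoint; if $x$ is an elliptic fixed (orbifold) point, its injectivity radius is $0$. The function $r$ is $r(x)=\log\coth(x/2)$ for $x>0$, extended by $r(0)=\infty$ and $r(\infty)=0$. A discrete group is of the second kind if its limit set is not the whole sphere at infinity. When $G$ has torsion, $N=\mathbb{H}^n/G$ is understood as a hyperbolic orbifold. That $\Sigma_1,\Sigma_2$ are boundary hypersurfaces for $N$ means that each $\Sigma_i=X_i/F_i$ embeds in $N$ as a totally geodesic hypersurface bounding in $N$ an embedded copy of $H_i/F_i$, where $H_i$ is the open half-space bounded by $X_i$ not containing the other hyperplane, so that removing $H_1/F_1$ and $H_2/F_2$ leaves a space having $\Sigma_1$ and $\Sigma_2$ as totally geodesic boundary components. $d_N$ is the distance in $N$. *)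

theory Defs
  imports "HOL-Analysis.Analysis" "HOL-Algebra.Bij" "HOL-Algebra.Group_Action"
    "HOL-Algebra.Generated_Groups"
begin

section \<open>Hyperbolic space\<close>

text \<open>
  Real hyperbolic space of dimension \<open>n = CARD('n)\<close> in the projective (Klein) model: the open
  Euclidean unit ball, whose closure in \<open>real^'n\<close> is hyperbolic space together with its sphere at
  infinity \<open>sphere 0 1\<close>. In this model the hyperplanes and the geodesics are the intersections of
  affine hyperplanes and of straight lines with the ball.
\<close>

definition hyp :: "(real^'n) set" where
  "hyp = ball 0 1"

definition hdist :: "real^'n \<Rightarrow> real^'n \<Rightarrow> real" where
  "hdist x y = arcosh ((1 - x \<bullet> y) / (sqrt (1 - x \<bullet> x) * sqrt (1 - y \<bullet> y)))"

text \<open>The Riemannian metric of the Klein model on the tangent space at \<open>x\<close>.\<close>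

definition hinner :: "real^'n \<Rightarrow> real^'n \<Rightarrow> real^'n \<Rightarrow> real" where
  "hinner x u v = (u \<bullet> v) / (1 - x \<bullet> x) + (x \<bullet> u) * (x \<bullet> v) / (1 - x \<bullet> x)\<^sup>2"

definition hball :: "real^'n \<Rightarrow> real \<Rightarrow> (real^'n) set" where
  "hball x \<rho> = {y \<in> hyp. hdist x y < \<rho>}"

definition dist_sets :: "('a \<Rightarrow> 'a \<Rightarrow> real) \<Rightarrow> 'a set \<Rightarrow> 'a set \<Rightarrow> real" where
  "dist_sets d A B = Inf {d a b | a b. a \<in> A \<and> b \<in> B}"

text \<open>
  The condition \<open>\<bar>b\<bar> < norm a\<close> says that \<open>a\<close> is not zero and that the affine hyperplane meets the
  open ball. Replacing \<open>(a, b)\<close> by \<open>(- a, - b)\<close> gives the half-space on the other side.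
\<close>

definition half_space_of :: "(real^'n) set \<Rightarrow> (real^'n) set \<Rightarrow> bool" where
  "half_space_of X U \<longleftrightarrow> (\<exists>a b. \<bar>b\<bar> < norm a \<and>
     X = {x \<in> hyp. a \<bullet> x = b} \<and> U = {x \<in> hyp. a \<bullet> x < b})"

definition hyperplane :: "(real^'n) set \<Rightarrow> bool" where
  "hyperplane X \<longleftrightarrow> (\<exists>a b. \<bar>b\<bar> < norm a \<and> X = {x \<in> hyp. a \<bullet> x = b})"

text \<open>
  The geodesic through \<open>x\<^sub>1\<close> and \<open>x\<^sub>2\<close> is a Euclidean segment, hence has direction \<open>x\<^sub>2 - x\<^sub>1\<close>, and the
  vectors \<open>y - x\<^sub>1\<close> with \<open>y \<in> X\<^sub>1\<close> span the tangent space of \<open>X\<^sub>1\<close> at \<open>x\<^sub>1\<close>.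
\<close>

definition common_perpendicular ::
    "(real^'n) set \<Rightarrow> (real^'n) set \<Rightarrow> real^'n \<Rightarrow> real^'n \<Rightarrow> bool" where
  "common_perpendicular X\<^sub>1 X\<^sub>2 x\<^sub>1 x\<^sub>2 \<longleftrightarrow> x\<^sub>1 \<in> X\<^sub>1 \<and> x\<^sub>2 \<in> X\<^sub>2 \<and> x\<^sub>1 \<noteq> x\<^sub>2 \<and>
     (\<forall>y\<in>X\<^sub>1. hinner x\<^sub>1 (x\<^sub>2 - x\<^sub>1) (y - x\<^sub>1) = 0) \<and>
     (\<forall>y\<in>X\<^sub>2. hinner x\<^sub>2 (x\<^sub>1 - x\<^sub>2) (y - x\<^sub>2) = 0)"


section \<open>Groups of isometries\<close>

definition orientation_preserving :: "(real^'n \<Rightarrow> real^'n) \<Rightarrow> bool" where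
  "orientation_preserving f \<longleftrightarrow>
     (\<forall>x\<in>hyp. \<exists>D. (f has_derivative D) (at x) \<and> det (matrix D) > 0)"

text \<open>
  As in \<^const>\<open>BijGroup\<close>, isometries are extensional functions: they are undefined off \<^const>\<open>hyp\<close>.
\<close>

definition hyp_isom :: "(real^'n \<Rightarrow> real^'n) monoid" where
  "hyp_isom = (BijGroup hyp)\<lparr>carrier := {f \<in> Bij hyp.
     (\<forall>x\<in>hyp. \<forall>y\<in>hyp. hdist (f x) (f y) = hdist x y) \<and> orientation_preserving f}\<rparr>"

lemma orientation_preserving_compose:
  fixes f g :: "real^'n \<Rightarrow> real^'n"
  assumes f: "orientation_preserving f" and g: "orientation_preserving g" and m: "f ` hyp \<subseteq> hyp"
  shows "orientation_preserving (compose hyp g f)"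
  unfolding orientation_preserving_def
proof
  fix x :: "real^'n" assume x: "x \<in> hyp"
  obtain D where D: "(f has_derivative D) (at x)" "det (matrix D) > 0"
    using f x by (auto simp: orientation_preserving_def)
  obtain E where E: "(g has_derivative E) (at (f x))" "det (matrix E) > 0"
    using g m x by (auto simp: orientation_preserving_def)
  have "(g \<circ> f has_derivative E \<circ> D) (at x)"
    using D E by (simp add: diff_chain_at)
  moreover have "open (hyp :: (real^'n) set)" by (simp add: hyp_def)
  ultimately have "(compose hyp g f has_derivative E \<circ> D) (at x)"
    using x by (elim has_derivative_transform_within_open) (auto simp: compose_def)
  moreover have "det (matrix (E \<circ> D)) > 0"
    using D E by (simp add: matrix_compose has_derivative_linear det_mul)
  ultimately show "\<exists>D. (compose hyp g f has_derivative D) (at x) \<and> det (matrix D) > 0"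
    by blast
qed

lemma orientation_preserving_inv_into:
  fixes f :: "real^'n \<Rightarrow> real^'n"
  assumes f: "orientation_preserving f" and b: "bij_betw f hyp hyp"
  shows "orientation_preserving (restrict (inv_into hyp f) hyp)"
  unfolding orientation_preserving_def
proof
  fix y :: "real^'n" assume y: "y \<in> hyp"
  define x where "x = inv_into hyp f y"
  have x: "x \<in> hyp" "f x = y"
    using b y by (auto simp: x_def bij_betw_def inv_into_into f_inv_into_f)
  obtain D where D: "(f has_derivative D) (at x)" "det (matrix D) > 0"
    using f x by (auto simp: orientation_preserving_def)
  have linD: "linear D" using D has_derivative_linear by blast
  have invD: "invertible (matrix D)" using D invertible_det_nz by force
  define E where "E = (\<lambda>v. matrix_inv (matrix D) *v v)"
  have DE: "D \<circ> E = id"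
  proof
    fix v
    have "D (E v) = matrix D *v (matrix_inv (matrix D) *v v)"
      by (simp add: E_def matrix_works linD)
    also have "\<dots> = v" using someI_ex[OF invD[unfolded invertible_def]]
      by (simp add: matrix_vector_mul_assoc matrix_inv_def)
    finally show "(D \<circ> E) v = id v" by simp
  qed
  have op: "open (hyp :: (real^'n) set)" by (simp add: hyp_def)
  have cont: "continuous_on hyp f"
    using f op by (auto simp: orientation_preserving_def continuous_on_eq_continuous_at
        intro: has_derivative_continuous)
  have "(inv_into hyp f has_derivative E) (at (f x))"
    by (rule has_derivative_inverse_strong[OF op x(1) cont _ D(1) DE])
      (use b in \<open>simp add: bij_betw_def\<close>)
  then have "(inv_into hyp f has_derivative E) (at y)" by (simp only: x(2))
  then have "(restrict (inv_into hyp f) hyp has_derivative E) (at y)"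
    by (rule has_derivative_transform_within_open[OF _ op y]) simp
  moreover have "det (matrix E) > 0"
  proof -
    have "matrix D ** matrix E = mat 1"
      using matrix_compose[of E D] linD DE by (simp add: E_def matrix_id_mat_1)
    then have "det (matrix D) * det (matrix E) = 1" by (metis det_I det_mul)
    with D(2) show ?thesis by (metis zero_less_mult_pos zero_less_one)
  qed
  ultimately show "\<exists>D. (restrict (inv_into hyp f) hyp has_derivative D) (at y) \<and> det (matrix D) > 0"
    by blast
qed

lemma group_hyp_isom: "group (hyp_isom :: (real^'n \<Rightarrow> real^'n) monoid)"
proof -
  let ?C = "{f \<in> Bij (hyp :: (real^'n) set).
     (\<forall>x\<in>hyp. \<forall>y\<in>hyp. hdist (f x) (f y) = hdist x y) \<and> orientation_preserving f}"
  interpret B: group "BijGroup (hyp :: (real^'n) set)" by (rule group_BijGroup)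
  have id: "orientation_preserving (\<lambda>x\<in>hyp :: (real^'n) set. x)"
    unfolding orientation_preserving_def
  proof
    fix x :: "real^'n" assume x: "x \<in> hyp"
    have "((\<lambda>x. x) has_derivative (\<lambda>v. v)) (at x)" by simp
    moreover have "open (hyp :: (real^'n) set)" by (simp add: hyp_def)
    ultimately have "((\<lambda>x\<in>hyp. x) has_derivative (\<lambda>v. v)) (at x)"
      using x by (rule has_derivative_transform_within_open) simp
    moreover have "det (matrix (\<lambda>v::real^'n. v)) > 0"
      by (simp add: matrix_id_mat_1[unfolded id_def])
    ultimately show "\<exists>D. ((\<lambda>x\<in>hyp. x) has_derivative D) (at x) \<and> det (matrix D) > 0" by blast
  qed
  have "subgroup ?C (BijGroup hyp)"
  proof (rule B.subgroupI)
    show "?C \<subseteq> carrier (BijGroup hyp)" by (auto simp: BijGroup_def)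
    show "?C \<noteq> {}" using id id_Bij[of hyp] by (auto intro!: exI[of _ "\<lambda>x\<in>hyp. x"])
  next
    fix f assume f: "f \<in> ?C"
    then have b: "bij_betw f hyp hyp" by (auto simp: Bij_def)
    have "hdist (inv_into hyp f x) (inv_into hyp f y) = hdist x y" if "x \<in> hyp" "y \<in> hyp" for x y
    proof -
      have "hdist (f (inv_into hyp f x)) (f (inv_into hyp f y)) =
          hdist (inv_into hyp f x) (inv_into hyp f y)"
        using f that b by (auto simp: bij_betw_def inv_into_into)
      then show ?thesis using that b by (simp add: bij_betw_def f_inv_into_f)
    qed
    then show "inv\<^bsub>BijGroup hyp\<^esub> f \<in> ?C"
      using f orientation_preserving_inv_into[OF _ b]
      by (auto simp: inv_BijGroup restrict_inv_into_Bij)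
  next
    fix f g assume fg: "f \<in> ?C" "g \<in> ?C"
    then have "f ` hyp \<subseteq> hyp" "g ` hyp \<subseteq> hyp" by (auto simp: Bij_def bij_betw_def)
    with fg show "f \<otimes>\<^bsub>BijGroup hyp\<^esub> g \<in> ?C"
      by (auto simp: BijGroup_def compose_Bij orientation_preserving_compose compose_eq image_subset_iff)
  qed
  then show ?thesis
    unfolding hyp_isom_def by (rule B.subgroup_imp_group)
qed

abbreviation isom_subgroup ::
    "(real^'n \<Rightarrow> real^'n) set \<Rightarrow> (real^'n \<Rightarrow> real^'n) monoid" where
  "isom_subgroup F \<equiv> hyp_isom\<lparr>carrier := F\<rparr>"

text \<open>
  Discreteness refers to the topology of pointwise convergence, which on a group of isometries is
  the same as the compact-open topology.
\<close>

definition discrete_subgroup :: "(real^'n \<Rightarrow> real^'n) set \<Rightarrow> bool" where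
  "discrete_subgroup F \<longleftrightarrow> subgroup F hyp_isom \<and>
     subtopology (product_topology (\<lambda>_. euclidean) hyp) F = discrete_topology F"

definition fuchsian :: "(real^'n \<Rightarrow> real^'n) set \<Rightarrow> (real^'n) set \<Rightarrow> bool" where
  "fuchsian F X \<longleftrightarrow> hyperplane X \<and> discrete_subgroup F \<and>
     (\<forall>f\<in>F. f ` X = X \<and> (\<forall>U. half_space_of X U \<longrightarrow> f ` U = U))"

definition limit_set :: "(real^'n \<Rightarrow> real^'n) set \<Rightarrow> (real^'n) set" where
  "limit_set G = {\<xi> \<in> sphere 0 1. \<exists>x\<in>hyp. \<xi> islimpt {g x | g. g \<in> G}}"

definition second_kind :: "(real^'n \<Rightarrow> real^'n) set \<Rightarrow> bool" where
  "second_kind G \<longleftrightarrow> limit_set G \<noteq> sphere 0 1"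

definition torsion_free :: "('a, 'b) monoid_scheme \<Rightarrow> bool" where
  "torsion_free G \<longleftrightarrow>
     (\<forall>g\<in>carrier G. \<forall>k::nat. k > 0 \<and> g [^]\<^bsub>G\<^esub> k = \<one>\<^bsub>G\<^esub> \<longrightarrow> g = \<one>\<^bsub>G\<^esub>)"

text \<open>
  The translates are indexed by the group elements. So if a nontrivial element of \<open>F\<close> fixes \<open>x\<close>,
  then only \<open>\<rho> = 0\<close> (the empty open disc) qualifies and the radius is \<open>0\<close>; if \<open>F\<close> is trivial,
  the radius is \<open>\<infinity>\<close>.
\<close>

definition inj_radius ::
    "(real^'n \<Rightarrow> real^'n) set \<Rightarrow> (real^'n) set \<Rightarrow> real^'n \<Rightarrow> ereal" where
  "inj_radius F X x =
     Sup (ereal ` {\<rho>. 0 \<le> \<rho> \<and> disjoint_family_on (\<lambda>f. f ` (X \<inter> hball x \<rho>)) F})"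

definition r_fun :: "ereal \<Rightarrow> ereal" where
  "r_fun x = (if x = 0 then \<infinity> else if x = \<infinity> then 0
     else let t = real_of_ereal x / 2 in ereal (ln (cosh t / sinh t)))"


section \<open>The free product of two groups\<close>

definition fp_words ::
    "('a, 'c) monoid_scheme \<Rightarrow> ('b, 'd) monoid_scheme \<Rightarrow> ('a + 'b) list set" where
  "fp_words A B = lists (carrier A <+> carrier B)"

inductive_set fp_rel ::
    "('a, 'c) monoid_scheme \<Rightarrow> ('b, 'd) monoid_scheme \<Rightarrow> (('a + 'b) list \<times> ('a + 'b) list) set"
  for A :: "('a, 'c) monoid_scheme" and B :: "('b, 'd) monoid_scheme" where
  refl: "w \<in> fp_words A B \<Longrightarrow> (w, w) \<in> fp_rel A B"
| sym: "(v, w) \<in> fp_rel A B \<Longrightarrow> (w, v) \<in> fp_rel A B"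
| trans: "\<lbrakk>(u, v) \<in> fp_rel A B; (v, w) \<in> fp_rel A B\<rbrakk> \<Longrightarrow> (u, w) \<in> fp_rel A B"
| one_left: "\<lbrakk>u \<in> fp_words A B; v \<in> fp_words A B\<rbrakk>
    \<Longrightarrow> (u @ [Inl \<one>\<^bsub>A\<^esub>] @ v, u @ v) \<in> fp_rel A B"
| one_right: "\<lbrakk>u \<in> fp_words A B; v \<in> fp_words A B\<rbrakk>
    \<Longrightarrow> (u @ [Inr \<one>\<^bsub>B\<^esub>] @ v, u @ v) \<in> fp_rel A B"
| mult_left: "\<lbrakk>u \<in> fp_words A B; v \<in> fp_words A B; x \<in> carrier A; y \<in> carrier A\<rbrakk>
    \<Longrightarrow> (u @ [Inl x, Inl y] @ v, u @ [Inl (x \<otimes>\<^bsub>A\<^esub> y)] @ v) \<in> fp_rel A B"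
| mult_right: "\<lbrakk>u \<in> fp_words A B; v \<in> fp_words A B; x \<in> carrier B; y \<in> carrier B\<rbrakk>
    \<Longrightarrow> (u @ [Inr x, Inr y] @ v, u @ [Inr (x \<otimes>\<^bsub>B\<^esub> y)] @ v) \<in> fp_rel A B"

definition free_product ::
    "('a, 'c) monoid_scheme \<Rightarrow> ('b, 'd) monoid_scheme \<Rightarrow> ('a + 'b) list set monoid" where
  "free_product A B = \<lparr>carrier = fp_words A B // fp_rel A B,
     mult = (\<lambda>U V. \<Union>u\<in>U. \<Union>v\<in>V. fp_rel A B `` {u @ v}),
     one = fp_rel A B `` {[]}\<rparr>"

lemma fp_rel_append:
  assumes "(u, v) \<in> fp_rel A B" "w \<in> fp_words A B"
  shows "(u @ w, v @ w) \<in> fp_rel A B \<and> (w @ u, w @ v) \<in> fp_rel A B"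
  using assms(1)
proof induction
  case (refl x)
  then show ?case using assms(2) by (auto simp: fp_words_def intro!: fp_rel.refl)
next
  case sym then show ?case by (auto intro: fp_rel.sym)
next
  case trans then show ?case by (auto intro: fp_rel.trans)
next
  case (one_left x y)
  then show ?case using assms(2) fp_rel.one_left[of x A B "y @ w"] fp_rel.one_left[of "w @ x" A B y]
    by (auto simp: fp_words_def)
next
  case (one_right x y)
  then show ?case using assms(2) fp_rel.one_right[of x A B "y @ w"] fp_rel.one_right[of "w @ x" A B y]
    by (auto simp: fp_words_def)
next
  case (mult_left x y a b)
  then show ?case using assms(2) fp_rel.mult_left[of x A B "y @ w" a b] fp_rel.mult_left[of "w @ x" A B y a b]
    by (auto simp: fp_words_def)
next
  case (mult_right x y a b)
  then show ?case using assms(2) fp_rel.mult_right[of x A B "y @ w" a b] fp_rel.mult_right[of "w @ x" A B y a b]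
    by (auto simp: fp_words_def)
qed

lemma equiv_fp_rel:
  assumes "group A" "group B"
  shows "equiv (fp_words A B) (fp_rel A B)"
proof -
  interpret A: group A by fact
  interpret B: group B by fact
  have "u \<in> fp_words A B \<and> v \<in> fp_words A B" if "(u, v) \<in> fp_rel A B" for u v
    using that by induction (auto simp: fp_words_def)
  then show ?thesis
    by (intro equivI) (auto simp: refl_on_def sym_def trans_def
        intro: fp_rel.refl fp_rel.sym fp_rel.trans)
qed

lemma fp_mult:
  assumes "group A" "group B" "u \<in> fp_words A B" "v \<in> fp_words A B"
  shows "fp_rel A B `` {u} \<otimes>\<^bsub>free_product A B\<^esub> fp_rel A B `` {v} = fp_rel A B `` {u @ v}"
proof -
  let ?r = "fp_rel A B"
  have E: "equiv (fp_words A B) ?r" using assms by (simp add: equiv_fp_rel)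
  have "congruent2 ?r ?r (\<lambda>u v. ?r `` {u @ v})"
  proof (rule congruent2I[OF E E])
    fix y z w assume "(y, z) \<in> ?r" "w \<in> fp_words A B"
    then show "?r `` {y @ w} = ?r `` {z @ w}" "?r `` {w @ y} = ?r `` {w @ z}"
      using fp_rel_append[of y z A B w] equiv_class_eq[OF E] by blast+
  qed
  then show ?thesis
    using assms by (simp add: free_product_def UN_equiv_class2[OF E E])
qed

lemma group_free_product:
  assumes "group A" "group B"
  shows "group (free_product A B)"
proof (rule groupI)
  let ?r = "fp_rel A B" and ?W = "fp_words A B" and ?P = "free_product A B"
  interpret A: group A by fact
  interpret B: group B by fact
  have car: "X \<in> carrier ?P \<longleftrightarrow> (\<exists>w\<in>?W. X = ?r `` {w})" for X
    by (auto simp: free_product_def quotient_def)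
  have one: "\<one>\<^bsub>?P\<^esub> = ?r `` {[]}" by (simp add: free_product_def)
  have app: "u @ v \<in> ?W" if "u \<in> ?W" "v \<in> ?W" for u v using that by (auto simp: fp_words_def)
  have nil: "[] \<in> ?W" by (simp add: fp_words_def)
  note mult = fp_mult[OF assms]
  show "\<one>\<^bsub>?P\<^esub> \<in> carrier ?P" using car one nil by blast
  show "X \<otimes>\<^bsub>?P\<^esub> Y \<in> carrier ?P" if "X \<in> carrier ?P" "Y \<in> carrier ?P" for X Y
    using that app by (auto simp: car mult)
  show "X \<otimes>\<^bsub>?P\<^esub> Y \<otimes>\<^bsub>?P\<^esub> Z = X \<otimes>\<^bsub>?P\<^esub> (Y \<otimes>\<^bsub>?P\<^esub> Z)"
    if "X \<in> carrier ?P" "Y \<in> carrier ?P" "Z \<in> carrier ?P" for X Y Z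
    using that app by (auto simp: car mult)
  show "\<one>\<^bsub>?P\<^esub> \<otimes>\<^bsub>?P\<^esub> X = X" if "X \<in> carrier ?P" for X
    using that nil by (auto simp: car mult one)
  have E: "equiv ?W ?r" using assms by (simp add: equiv_fp_rel)
  have "\<exists>v\<in>?W. (v @ w, []) \<in> ?r" if "w \<in> ?W" for w
    using that
  proof (induction w)
    case Nil
    then show ?case using nil fp_rel.refl by force
  next
    case (Cons a w)
    then have w: "w \<in> ?W" by (auto simp: fp_words_def)
    with Cons obtain v where v: "v \<in> ?W" "(v @ w, []) \<in> ?r" by blast
    have "\<exists>b. [b] \<in> ?W \<and> (v @ [b] @ [a] @ w, v @ w) \<in> ?r"
    proof (cases a)
      case (Inl x)
      then have x: "x \<in> carrier A" using Cons by (auto simp: fp_words_def)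
      have "(v @ [Inl (inv\<^bsub>A\<^esub> x), Inl x] @ w, v @ [Inl \<one>\<^bsub>A\<^esub>] @ w) \<in> ?r"
        using fp_rel.mult_left[OF v(1) w, of "inv\<^bsub>A\<^esub> x" x] x by simp
      then have "(v @ [Inl (inv\<^bsub>A\<^esub> x)] @ [a] @ w, v @ w) \<in> ?r"
        using fp_rel.one_left[OF v(1) w] Inl by (auto intro: fp_rel.trans)
      moreover have "[Inl (inv\<^bsub>A\<^esub> x)] \<in> ?W" using x by (auto simp: fp_words_def)
      ultimately show ?thesis by blast
    next
      case (Inr x)
      then have x: "x \<in> carrier B" using Cons by (auto simp: fp_words_def)
      have "(v @ [Inr (inv\<^bsub>B\<^esub> x), Inr x] @ w, v @ [Inr \<one>\<^bsub>B\<^esub>] @ w) \<in> ?r"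
        using fp_rel.mult_right[OF v(1) w, of "inv\<^bsub>B\<^esub> x" x] x by simp
      then have "(v @ [Inr (inv\<^bsub>B\<^esub> x)] @ [a] @ w, v @ w) \<in> ?r"
        using fp_rel.one_right[OF v(1) w] Inr by (auto intro: fp_rel.trans)
      moreover have "[Inr (inv\<^bsub>B\<^esub> x)] \<in> ?W" using x by (auto simp: fp_words_def)
      ultimately show ?thesis by blast
    qed
    then obtain b where b: "[b] \<in> ?W" "(v @ [b] @ [a] @ w, v @ w) \<in> ?r" by blast
    have "((v @ [b]) @ a # w, []) \<in> ?r"
      using fp_rel.trans[OF b(2) v(2)] by simp
    with app[OF v(1) b(1)] show ?case by blast
  qed
  then have inv: "\<exists>v\<in>?W. (v @ w, []) \<in> ?r" if "w \<in> ?W" for w using that by blast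
  show "\<exists>Y\<in>carrier ?P. Y \<otimes>\<^bsub>?P\<^esub> X = \<one>\<^bsub>?P\<^esub>" if X: "X \<in> carrier ?P" for X
  proof -
    obtain w where w: "w \<in> ?W" "X = ?r `` {w}" using X car by blast
    obtain v where v: "v \<in> ?W" "(v @ w, []) \<in> ?r" using inv[OF w(1)] by blast
    have "?r `` {v} \<otimes>\<^bsub>?P\<^esub> X = \<one>\<^bsub>?P\<^esub>"
      using v w by (simp add: mult one equiv_class_eq[OF E])
    with v(1) car show ?thesis by blast
  qed
qed

text \<open>\<open>G\<close> is the internal free product of \<open>F\<^sub>1\<close> and \<open>F\<^sub>2\<close>: the canonical map is an isomorphism.\<close>

definition is_free_product_of :: "('a, 'c) monoid_scheme \<Rightarrow> 'a set \<Rightarrow> 'a set \<Rightarrow> bool" where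
  "is_free_product_of G F\<^sub>1 F\<^sub>2 \<longleftrightarrow>
     (let A = G\<lparr>carrier := F\<^sub>1\<rparr>; B = G\<lparr>carrier := F\<^sub>2\<rparr> in
       \<exists>\<phi> \<in> iso (free_product A B) G.
         (\<forall>f\<in>F\<^sub>1. \<phi> (fp_rel A B `` {[Inl f]}) = f) \<and>
         (\<forall>f\<in>F\<^sub>2. \<phi> (fp_rel A B `` {[Inr f]}) = f))"


section \<open>Quotient orbifolds\<close>

text \<open>
  \<open>quot F S\<close> is the set \<open>S/F\<close> of \<open>F\<close>-orbits of points of \<open>S\<close>. If \<open>F\<close> is a subgroup of \<open>G\<close> that
  keeps \<open>S\<close> invariant, then \<open>quot G S\<close> is the image of \<open>S/F\<close> in \<open>quot G hyp\<close>.
\<close>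

abbreviation proj :: "(real^'n \<Rightarrow> real^'n) set \<Rightarrow> real^'n \<Rightarrow> (real^'n) set" where
  "proj F x \<equiv> orbit (isom_subgroup F) (\<lambda>f. f) x"

abbreviation quot :: "(real^'n \<Rightarrow> real^'n) set \<Rightarrow> (real^'n) set \<Rightarrow> (real^'n) set set" where
  "quot F S \<equiv> orbits (isom_subgroup F) S (\<lambda>f. f)"

definition quot_topology ::
    "(real^'n \<Rightarrow> real^'n) set \<Rightarrow> (real^'n) set \<Rightarrow> (real^'n) set topology" where
  "quot_topology F S =
     topology (\<lambda>V. V \<subseteq> quot F S \<and> openin (top_of_set S) {x \<in> S. proj F x \<in> V})"

lemma openin_quot_topology:
  "openin (quot_topology F S) V \<longleftrightarrow>
     V \<subseteq> quot F S \<and> openin (top_of_set S) {x \<in> S. proj F x \<in> V}"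
proof -
  let ?P = "\<lambda>V. V \<subseteq> quot F S \<and> openin (top_of_set S) {x \<in> S. proj F x \<in> V}"
  have "istopology ?P"
    unfolding istopology_def
  proof (intro conjI allI impI)
    fix V W assume V: "?P V" and W: "?P W"
    have "{x \<in> S. proj F x \<in> V \<inter> W} = {x \<in> S. proj F x \<in> V} \<inter> {x \<in> S. proj F x \<in> W}"
      by blast
    with V W show "V \<inter> W \<subseteq> quot F S" "openin (top_of_set S) {x \<in> S. proj F x \<in> V \<inter> W}"
      by auto
  next
    fix \<V> assume \<V>: "\<forall>V\<in>\<V>. ?P V"
    have "{x \<in> S. proj F x \<in> \<Union>\<V>} = (\<Union>V\<in>\<V>. {x \<in> S. proj F x \<in> V})"
      by blast
    with \<V> show "\<Union>\<V> \<subseteq> quot F S" "openin (top_of_set S) {x \<in> S. proj F x \<in> \<Union>\<V>}"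
      by auto
  qed
  then show ?thesis
    by (simp add: quot_topology_def topology_inverse')
qed

text \<open>
  The natural map \<open>S/F \<rightarrow> hyp/G\<close>; the \<open>G\<close>-orbits of the points of one \<open>F\<close>-orbit are all the same.
\<close>

definition nat_map :: "(real^'n \<Rightarrow> real^'n) set \<Rightarrow> (real^'n) set \<Rightarrow> (real^'n) set" where
  "nat_map G p = (\<Union>x\<in>p. proj G x)"

text \<open>
  An embedding of orbifolds: an embedding of the underlying spaces that identifies the local
  groups.
\<close>

definition quot_embeds ::
    "(real^'n \<Rightarrow> real^'n) set \<Rightarrow> (real^'n) set \<Rightarrow> (real^'n \<Rightarrow> real^'n) set \<Rightarrow> bool" where
  "quot_embeds F S G \<longleftrightarrow>
     embedding_map (quot_topology F S) (quot_topology G hyp) (nat_map G) \<and>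
     (\<forall>x\<in>S. stabilizer (isom_subgroup F) (\<lambda>f. f) x = stabilizer (isom_subgroup G) (\<lambda>f. f) x)"

text \<open>
  Since the points of \<open>quot G hyp\<close> are orbits, the preimage in \<^const>\<open>hyp\<close> of a set \<open>M\<close> of points of
  \<open>quot G hyp\<close> is \<open>\<Union>M\<close>, and the quotient distance is the distance between orbits.
\<close>

definition quot_dist :: "(real^'n) set \<Rightarrow> (real^'n) set \<Rightarrow> real" where
  "quot_dist p q = dist_sets hdist p q"

definition totally_geodesic_hypersurface :: "(real^'n) set set \<Rightarrow> bool" where
  "totally_geodesic_hypersurface \<Sigma> \<longleftrightarrow>
     (\<forall>x\<in>\<Union>\<Sigma>. \<exists>Y \<epsilon>. hyperplane Y \<and> x \<in> Y \<and> \<epsilon> > 0 \<and> \<Union>\<Sigma> \<inter> hball x \<epsilon> = Y \<inter> hball x \<epsilon>)"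

text \<open>
  The totally geodesic boundary of a subset \<open>M\<close> of an orbifold \<open>hyp/G\<close>: near the points \<open>x\<close> lying
  over it, the preimage of \<open>M\<close> is a closed half-space with \<open>x\<close> on its bounding hyperplane.
\<close>

definition geodesic_boundary_point :: "(real^'n) set set \<Rightarrow> real^'n \<Rightarrow> bool" where
  "geodesic_boundary_point M x \<longleftrightarrow>
     (\<exists>Y U \<epsilon>. half_space_of Y U \<and> x \<in> Y \<and> \<epsilon> > 0 \<and> \<Union>M \<inter> hball x \<epsilon> = hball x \<epsilon> - U)"

definition geodesic_boundary ::
    "(real^'n \<Rightarrow> real^'n) set \<Rightarrow> (real^'n) set set \<Rightarrow> (real^'n) set set" where
  "geodesic_boundary G M = {proj G x | x. x \<in> hyp \<and> geodesic_boundary_point M x}"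

definition has_geodesic_boundary :: "(real^'n) set set \<Rightarrow> bool" where
  "has_geodesic_boundary M \<longleftrightarrow>
     (\<forall>x\<in>\<Union>M. (\<exists>\<epsilon>>0. hball x \<epsilon> \<subseteq> \<Union>M) \<or> geodesic_boundary_point M x)"

definition boundary_hypersurfaces ::
    "(real^'n \<Rightarrow> real^'n) set \<Rightarrow> (real^'n \<Rightarrow> real^'n) set \<Rightarrow> (real^'n) set \<Rightarrow>
     (real^'n \<Rightarrow> real^'n) set \<Rightarrow> (real^'n) set \<Rightarrow> bool" where
  "boundary_hypersurfaces G F\<^sub>1 X\<^sub>1 F\<^sub>2 X\<^sub>2 \<longleftrightarrow>
     (\<exists>H\<^sub>1 H\<^sub>2. half_space_of X\<^sub>1 H\<^sub>1 \<and> \<not> X\<^sub>2 \<subseteq> H\<^sub>1 \<and> half_space_of X\<^sub>2 H\<^sub>2 \<and> \<not> X\<^sub>1 \<subseteq> H\<^sub>2 \<and>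
       (let N = quot_topology G hyp;
            M = quot G hyp - quot G H\<^sub>1 - quot G H\<^sub>2
        in (\<forall>(F, X, H) \<in> {(F\<^sub>1, X\<^sub>1, H\<^sub>1), (F\<^sub>2, X\<^sub>2, H\<^sub>2)}.
              quot_embeds F X G \<and> totally_geodesic_hypersurface (quot G X) \<and>
              quot_embeds F H G \<and> N frontier_of quot G H = quot G X \<and>
              quot G X \<in> connected_components_of (subtopology N (geodesic_boundary G M))) \<and>
           quot G X\<^sub>1 \<inter> quot G X\<^sub>2 = {} \<and> quot G H\<^sub>1 \<inter> quot G H\<^sub>2 = {} \<and>
           has_geodesic_boundary M))"

end

theory Submission
  imports Defs
begin

text \<open>
  Write \<open>p = x\<^sub>1\<close>, \<open>q = x\<^sub>2\<close> and \<open>D = hdist p q\<close>. The function \<open>r\<close> is the angle of parallelism in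
  disguise: if a hyperplane \<open>Y\<close> is perpendicular at distance \<open>d\<close> to a geodesic that leaves \<open>X\<^sub>1\<close>
  perpendicularly at \<open>p\<close>, then the orthogonal projection of \<open>Y\<close> to \<open>X\<^sub>1\<close> is the open disc about \<open>p\<close> of
  radius \<open>r d\<close>, and \<open>r\<close> is a decreasing involution. The assumption on the injectivity radii therefore
  allows a choice of \<open>d\<^sub>1 > r (inj p)\<close> and \<open>d\<^sub>2 > r (inj q)\<close> with \<open>d\<^sub>1 + d\<^sub>2 < D\<close>. Cut the common
  perpendicular at distance \<open>d\<^sub>1\<close> from \<open>p\<close> and at distance \<open>d\<^sub>2\<close> from \<open>q\<close> by perpendicular hyperplanes
  \<open>Y\<^sub>1\<close> and \<open>Y\<^sub>2\<close>, and let \<open>P\<^sub>1\<close> be the half-space beyond \<open>Y\<^sub>1\<close> as seen from \<open>X\<^sub>1\<close>, and \<open>P\<^sub>2\<close> the one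
  beyond \<open>Y\<^sub>2\<close> as seen from \<open>X\<^sub>2\<close>. The projection of \<open>P\<^sub>1\<close> to \<open>X\<^sub>1\<close> lies in a disc whose
  \<open>F\<^sub>1\<close>-translates are disjoint, and projection commutes with \<open>F\<^sub>1\<close>; so a nontrivial element of \<open>F\<^sub>1\<close>
  moves \<open>P\<^sub>1\<close> off itself (\<open>zone_displaced\<close>), and likewise for \<open>F\<^sub>2\<close> and \<open>P\<^sub>2\<close>. As
  \<open>P\<^sub>1 \<union> P\<^sub>2\<close> is everything (\<open>zone_cover\<close>), this is the ping-pong situation of the
  Klein combination theorem.

  Ping-pong (locale \<open>ping_pong\<close>) yields the free product and the statement about torsion, and it shows
  that the slab \<open>P\<^sub>1 \<inter> P\<^sub>2\<close> between \<open>Y\<^sub>1\<close> and \<open>Y\<^sub>2\<close> meets none of its translates by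
  nontrivial elements of \<open>G\<close>. The slab has
  interior points (\<open>slab\<close>), so \<open>G\<close> is discrete; and for \<open>n \<ge> 2\<close> its closure contains an open piece of
  the sphere at infinity, where no orbit can accumulate, so \<open>G\<close> is of the second kind.

  Let \<open>A\<^sub>i\<close> be the set of points whose signed distance to \<open>X\<^sub>i\<close> is less than \<open>d\<^sub>i\<close>: the open half-space
  \<open>H\<^sub>i\<close> together with a one-sided collar of width \<open>d\<^sub>i\<close>. It is invariant under \<open>F\<^sub>i\<close> and misses \<open>P\<^sub>i\<close>
  (\<open>tube_outside_zone\<close>). A second look at reduced words (\<open>ping_pong.precisely_invariant\<close>) shows that
  \<open>A\<^sub>i\<close> meets only its translates under \<open>F\<^sub>i\<close>, and that no translate of \<open>A\<^sub>1\<close> meets \<open>A\<^sub>2\<close>. All claims about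
  \<open>X\<^sub>i/F\<^sub>i\<close> and \<open>H\<^sub>i/F\<^sub>i\<close> in the quotient follow from these disjoint tubes (locales
  \<open>half_space_tube\<close> and \<open>two_tubes\<close>). Moreover, a geodesic from a translate of \<open>X\<^sub>1\<close> to a translate of
  \<open>X\<^sub>2\<close> has to cross both collars, so its length is at least \<open>d\<^sub>1 + d\<^sub>2\<close>; letting \<open>d\<^sub>1 + d\<^sub>2\<close> tend to \<open>D\<close>
  gives the formula for the distance.

  The computations are done on the hyperboloid, where distances and signed distances to hyperplanes
  are values of one bilinear form. Isometries are nowhere linearised: what is needed of them is
  that hyperplanes are bisectors and that signed distance to \<open>X\<^sub>i\<close> is a metric notion.
\<close>

section \<open>The hyperboloid\<close>

text \<open>The Lorentz form of signature \<open>(n, 1)\<close>, with the time coordinate first.\<close>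

definition lorentz :: "real \<times> (real^'n) \<Rightarrow> real \<times> (real^'n) \<Rightarrow> real" where
  "lorentz u v = snd u \<bullet> snd v - fst u * fst v"

text \<open>
  The point of the upper sheet of the hyperboloid \<open>lorentz v v = -1\<close> on the line through \<open>(1, x)\<close>.
\<close>

definition lift :: "real^'n \<Rightarrow> real \<times> (real^'n)" where
  "lift x = (1 / sqrt (1 - x \<bullet> x)) *\<^sub>R (1, x)"

definition cosh_dist :: "real^'n \<Rightarrow> real^'n \<Rightarrow> real" where
  "cosh_dist x y = - lorentz (lift x) (lift y)"

text \<open>
  For a vector \<open>e\<close> with \<open>lorentz e e = 1\<close> this is the hyperbolic sine of the signed distance from \<open>x\<close>
  to the hyperplane with unit normal \<open>e\<close>.
\<close>

definition side :: "real \<times> (real^'n) \<Rightarrow> real^'n \<Rightarrow> real" where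
  "side e x = lorentz (lift x) e"

lemma lorentz_commute: "lorentz u v = lorentz v u"
  by (simp add: lorentz_def inner_commute)

lemma lorentz_linear:
  "lorentz (u + v) w = lorentz u w + lorentz v w" "lorentz w (u + v) = lorentz w u + lorentz w v"
  "lorentz (u - v) w = lorentz u w - lorentz v w" "lorentz w (u - v) = lorentz w u - lorentz w v"
  "lorentz (c *\<^sub>R u) w = c * lorentz u w" "lorentz w (c *\<^sub>R u) = c * lorentz w u"
  by (simp_all add: lorentz_def inner_simps algebra_simps)

lemma hyp_inner_less_1: "x \<in> hyp \<longleftrightarrow> x \<bullet> x < 1"
  by (simp add: hyp_def norm_eq_sqrt_inner)

lemma hyp_inner_less_1': "x \<in> hyp \<Longrightarrow> norm y \<le> 1 \<Longrightarrow> x \<bullet> y < 1"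
proof -
  assume x: "x \<in> hyp" and y: "norm y \<le> 1"
  have "x \<bullet> y \<le> norm x * norm y" by (rule norm_cauchy_schwarz)
  also have "\<dots> \<le> norm x * 1" using y by (intro mult_left_mono) auto
  also have "\<dots> < 1" using x by (simp add: hyp_def)
  finally show ?thesis .
qed

lemma open_hyp: "open (hyp :: (real^'n) set)"
  by (simp add: hyp_def)

lemma lorentz_lift_self: "x \<in> hyp \<Longrightarrow> lorentz (lift x) (lift x) = -1"
proof -
  assume "x \<in> hyp"
  then have pos: "1 - x \<bullet> x > 0" by (simp add: hyp_inner_less_1)
  have "lorentz (lift x) (lift x) = - ((1 - x \<bullet> x) / (sqrt (1 - x \<bullet> x) * sqrt (1 - x \<bullet> x)))"
    by (simp add: lorentz_def lift_def diff_divide_distrib)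
  then show ?thesis using pos by simp
qed

lemma fst_lift_pos: "x \<in> hyp \<Longrightarrow> fst (lift x) > 0"
  by (simp add: hyp_inner_less_1 lift_def)

lemma side_eq: "side e x = (snd e \<bullet> x - fst e) / sqrt (1 - x \<bullet> x)"
  by (simp add: side_def lorentz_def lift_def inner_commute diff_divide_distrib)

lemma cosh_dist_eq_side: "cosh_dist x y = - side (lift y) x"
  by (simp add: cosh_dist_def side_def)

lemma cosh_dist_eq: "cosh_dist x y = (1 - x \<bullet> y) / (sqrt (1 - x \<bullet> x) * sqrt (1 - y \<bullet> y))"
  by (simp add: cosh_dist_def lorentz_def lift_def diff_divide_distrib)

lemma cosh_dist_commute: "cosh_dist x y = cosh_dist y x"
  by (simp add: cosh_dist_def lorentz_commute)

lemma cosh_dist_self: "x \<in> hyp \<Longrightarrow> cosh_dist x x = 1"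
  by (simp add: cosh_dist_def lorentz_lift_self)

lemma hdist_eq: "hdist x y = arcosh (cosh_dist x y)"
  by (simp add: hdist_def cosh_dist_eq)

lemma cosh_dist_pos: "x \<in> hyp \<Longrightarrow> y \<in> hyp \<Longrightarrow> cosh_dist x y > 0"
proof -
  assume "x \<in> hyp" "y \<in> hyp"
  moreover from this have "x \<bullet> y < 1" by (auto intro: hyp_inner_less_1' simp: hyp_def)
  ultimately show ?thesis by (simp add: cosh_dist_eq hyp_inner_less_1)
qed

text \<open>
  In terms of the hyperbolic sine: \<open>norm (x - y) \<le> sinh (hdist x y)\<close>. So hyperbolic balls shrink to
  their centres in the Euclidean topology.
\<close>

lemma norm_diff_le_cosh_dist:
  fixes x y :: "real^'n"
  assumes x: "x \<in> hyp" and y: "y \<in> hyp"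
  shows "(norm (x - y))\<^sup>2 \<le> (cosh_dist x y)\<^sup>2 - 1"
proof -
  let ?a = "1 - x \<bullet> x" and ?b = "1 - y \<bullet> y"
  have pos: "?a > 0" "?b > 0" "?b \<le> 1" using x y by (auto simp: hyp_inner_less_1)
  have eq: "(1 - x \<bullet> y)\<^sup>2 - ?a * ?b - ?a * ((x - y) \<bullet> (x - y)) = (x \<bullet> (y - x))\<^sup>2"
    by (simp add: inner_simps inner_commute power2_eq_square algebra_simps)
  then have "?a * ((x - y) \<bullet> (x - y)) \<le> (1 - x \<bullet> y)\<^sup>2 - ?a * ?b"
    by (smt (verit) zero_le_power2)
  moreover have "?b * (?a * ((x - y) \<bullet> (x - y))) \<le> 1 * (?a * ((x - y) \<bullet> (x - y)))"
    using pos by (intro mult_right_mono) auto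
  ultimately have "?a * ?b * ((x - y) \<bullet> (x - y)) \<le> (1 - x \<bullet> y)\<^sup>2 - ?a * ?b"
    by (simp add: mult_ac)
  moreover have "(cosh_dist x y)\<^sup>2 = (1 - x \<bullet> y)\<^sup>2 / (?a * ?b)"
    using pos by (simp add: cosh_dist_eq power_divide power_mult_distrib)
  moreover have "?a * ?b > 0" using pos by simp
  ultimately have "((x - y) \<bullet> (x - y)) + 1 \<le> (cosh_dist x y)\<^sup>2"
    by (simp only: le_divide_eq if_True) (simp add: algebra_simps)
  then show ?thesis by (simp add: power2_norm_eq_inner)
qed

lemma cosh_dist_ge_1: "x \<in> hyp \<Longrightarrow> y \<in> hyp \<Longrightarrow> cosh_dist x y \<ge> 1"
  using norm_diff_le_cosh_dist[of x y] cosh_dist_pos[of x y]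
  by (smt (verit) one_power2 power2_le_imp_le zero_le_power2)

lemma cosh_dist_gt_1: "x \<in> hyp \<Longrightarrow> y \<in> hyp \<Longrightarrow> x \<noteq> y \<Longrightarrow> cosh_dist x y > 1"
  using norm_diff_le_cosh_dist[of x y] cosh_dist_ge_1[of x y]
  by (metis diff_gt_0_iff_gt diff_self eq_iff_diff_eq_0 leD less_eq_real_def one_power2 zero_less_norm_iff zero_less_power)

lemma cosh_hdist: "x \<in> hyp \<Longrightarrow> y \<in> hyp \<Longrightarrow> cosh (hdist x y) = cosh_dist x y"
  by (simp add: hdist_eq cosh_dist_ge_1)

lemma hdist_nonneg: "x \<in> hyp \<Longrightarrow> y \<in> hyp \<Longrightarrow> hdist x y \<ge> 0"
  by (simp add: hdist_eq cosh_dist_ge_1)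

lemma hdist_self: "x \<in> hyp \<Longrightarrow> hdist x x = 0"
  by (simp add: hdist_eq cosh_dist_self)

lemma hdist_commute: "hdist p q = hdist q p"
  by (simp add: hdist_eq cosh_dist_commute)

lemma hdist_pos: "p \<in> hyp \<Longrightarrow> q \<in> hyp \<Longrightarrow> p \<noteq> q \<Longrightarrow> hdist p q > 0"
  using cosh_dist_gt_1[of p q] cosh_hdist[of p q] hdist_nonneg[of p q] by (cases "hdist p q = 0") auto

lemma hdist_less_iff:
  "x \<in> hyp \<Longrightarrow> y \<in> hyp \<Longrightarrow> r \<ge> 0 \<Longrightarrow> hdist x y < r \<longleftrightarrow> cosh_dist x y < cosh r"
  by (metis cosh_hdist cosh_real_nonneg_less_iff hdist_nonneg)

text \<open>
  Every timelike vector is a multiple of a point of the hyperboloid. Feet of perpendiculars and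
  midpoints are all constructed as linear combinations of lifts by means of this lemma; the sign of
  the factor can be found afterwards by pairing with a known point.
\<close>

lemma timelike_lift:
  assumes "lorentz v v < 0"
  obtains y k where "y \<in> hyp" "k \<noteq> 0" "v = k *\<^sub>R lift y" "k\<^sup>2 = - lorentz v v"
proof -
  obtain t u where v: "v = (t, u)" by (cases v)
  have tu: "u \<bullet> u < t * t" using assms by (simp add: v lorentz_def)
  then have tt: "t * t > 0" using inner_ge_zero[of u] by linarith
  then have t: "t \<noteq> 0" by auto
  define y where "y = (1/t) *\<^sub>R u"
  have "y \<bullet> y < 1"
    using tu tt by (simp add: y_def)
  then have y: "y \<in> hyp" by (simp add: hyp_inner_less_1)
  have u: "u = t *\<^sub>R y" using t by (simp add: y_def)
  define k where "k = t * sqrt (1 - y \<bullet> y)"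
  have k0: "k \<noteq> 0" using t \<open>y \<bullet> y < 1\<close> by (simp add: k_def)
  have vk: "v = k *\<^sub>R lift y"
    using u \<open>y \<bullet> y < 1\<close> by (simp add: v k_def lift_def)
  have "lorentz v v = k\<^sup>2 * lorentz (lift y) (lift y)"
    by (simp add: vk lorentz_linear power2_eq_square)
  then have "k\<^sup>2 = - lorentz v v" using y by (simp add: lorentz_lift_self)
  with y k0 vk that show ?thesis by blast
qed

text \<open>
  After normalisation of both vectors this says that the hyperbolic cosine of a distance is at least 1.
\<close>

lemma reverse_Cauchy_Schwarz:
  assumes "lorentz u u < 0" "lorentz v v < 0"
  shows "lorentz u u * lorentz v v \<le> (lorentz u v)\<^sup>2"
proof -
  obtain x k where x: "x \<in> hyp" "u = k *\<^sub>R lift x" "k\<^sup>2 = - lorentz u u" using timelike_lift[OF assms(1)] .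
  obtain y l where y: "y \<in> hyp" "v = l *\<^sub>R lift y" "l\<^sup>2 = - lorentz v v" using timelike_lift[OF assms(2)] .
  have "lorentz u v = - (k * l * cosh_dist x y)" using x y by (simp add: lorentz_linear cosh_dist_def)
  then have "(lorentz u v)\<^sup>2 = lorentz u u * lorentz v v * (cosh_dist x y)\<^sup>2"
    using x(3) y(3) by (simp add: power_mult_distrib)
  moreover have "(cosh_dist x y)\<^sup>2 \<ge> 1" using cosh_dist_ge_1[OF x(1) y(1)] by simp
  moreover have "lorentz u u * lorentz v v \<ge> 0" using assms by (simp add: mult_nonpos_nonpos)
  ultimately show ?thesis by (simp add: mult_le_cancel_left1)
qed

text \<open>
  If \<open>side e x = sinh a\<close> and \<open>side e y = sinh b\<close>, then the left-hand side is \<open>cosh (a - b)\<close>: signed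
  distance to a hyperplane is 1-Lipschitz. It is the reverse Cauchy-Schwarz inequality for the
  components of the two lifts that are orthogonal to \<open>e\<close>.
\<close>

lemma cosh_dist_ge_sides:
  assumes x: "x \<in> hyp" and y: "y \<in> hyp" and e: "lorentz e e = 1"
  shows "sqrt (1 + (side e x)\<^sup>2) * sqrt (1 + (side e y)\<^sup>2) - side e x * side e y \<le> cosh_dist x y"
proof -
  let ?s = "side e x" and ?t = "side e y"
  let ?u = "lift x - ?s *\<^sub>R e" and ?v = "lift y - ?t *\<^sub>R e"
  let ?S = "sqrt (1 + ?s\<^sup>2) * sqrt (1 + ?t\<^sup>2)"
  have uu: "lorentz ?u ?u = - (1 + ?s\<^sup>2)" "lorentz ?v ?v = - (1 + ?t\<^sup>2)"
    using x y e by (simp_all add: lorentz_linear lorentz_lift_self side_def lorentz_commute[of e "lift x"] lorentz_commute[of e "lift y"] power2_eq_square)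
  have uv: "lorentz ?u ?v = - (cosh_dist x y + ?s * ?t)"
    using e by (simp add: lorentz_linear cosh_dist_def side_def lorentz_commute[of e "lift x"] lorentz_commute[of e "lift y"] algebra_simps)
  have neg: "lorentz ?u ?u < 0" "lorentz ?v ?v < 0" unfolding uu by (smt (verit) zero_le_power2)+
  have "(1 + ?s\<^sup>2) * (1 + ?t\<^sup>2) \<le> (cosh_dist x y + ?s * ?t)\<^sup>2"
    using reverse_Cauchy_Schwarz[OF neg] unfolding uu uv by (simp only: minus_mult_minus power2_minus)
  then have "sqrt ((1 + ?s\<^sup>2) * (1 + ?t\<^sup>2)) \<le> sqrt ((cosh_dist x y + ?s * ?t)\<^sup>2)"
    by (rule real_sqrt_le_mono)
  then have S: "?S \<le> \<bar>cosh_dist x y + ?s * ?t\<bar>" by (simp add: real_sqrt_mult)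
  have "\<bar>?s * ?t\<bar> \<le> ?S"
    unfolding abs_mult by (intro mult_mono) (auto intro!: real_le_rsqrt)
  with S cosh_dist_pos[OF x y] show ?thesis by linarith
qed

lemma cosh_dist_ge_side:
  assumes "x \<in> hyp" "y \<in> hyp" "lorentz e e = 1" "side e y = 0"
  shows "sqrt (1 + (side e x)\<^sup>2) \<le> cosh_dist x y"
  using cosh_dist_ge_sides[OF assms(1-3)] assms(4) by simp

text \<open>
  The foot is the normalised component of \<open>lift x\<close> orthogonal to \<open>e\<close>. Together with
  \<open>cosh_dist_ge_side\<close> it expresses the distance to a hyperplane as an attained minimum of distances.
\<close>

lemma foot_of_perpendicular:
  assumes x: "x \<in> hyp" and e: "lorentz e e = 1"
  obtains y where "y \<in> hyp" "side e y = 0" "cosh_dist x y = sqrt (1 + (side e x)\<^sup>2)"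
proof -
  let ?s = "side e x"
  let ?v = "lift x - ?s *\<^sub>R e"
  have vv: "lorentz ?v ?v = - (1 + ?s\<^sup>2)"
    using x e by (simp add: lorentz_linear lorentz_lift_self side_def lorentz_commute[of e "lift x"] power2_eq_square)
  then have "lorentz ?v ?v < 0" by (smt (verit) zero_le_power2)
  then obtain y k where y: "y \<in> hyp" "k \<noteq> 0" "?v = k *\<^sub>R lift y" "k\<^sup>2 = - lorentz ?v ?v" by (rule timelike_lift)
  have "lorentz ?v e = 0" using e by (simp add: lorentz_linear side_def)
  then have s0: "side e y = 0" using y(2) unfolding y(3) by (simp add: lorentz_linear(5) side_def)
  have "lorentz (lift x) ?v = - (k * cosh_dist x y)" unfolding y(3) by (simp add: lorentz_linear cosh_dist_def)
  moreover have "lorentz (lift x) ?v = - (1 + ?s\<^sup>2)" using x by (simp add: lorentz_linear lorentz_lift_self side_def power2_eq_square)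
  moreover have "k * k = 1 + ?s\<^sup>2" using y(4) vv by (simp add: power2_eq_square[of k])
  ultimately have "k * cosh_dist x y = k * k" by linarith
  then have "cosh_dist x y = k" using y(2) by (metis mult_cancel_left)
  moreover have "k > 0" using cosh_dist_pos[OF x y(1)] calculation by simp
  moreover have "1 + ?s\<^sup>2 = k\<^sup>2" using y(4) vv by simp
  ultimately have "cosh_dist x y = sqrt (1 + ?s\<^sup>2)" by simp
  with y(1) s0 that show ?thesis by blast
qed

lemma midpoint_lift:
  assumes p: "p \<in> hyp" and q: "q \<in> hyp"
  obtains m k where "m \<in> hyp" "k > 0" "lift p + lift q = k *\<^sub>R lift m" "k\<^sup>2 = 2 + 2 * cosh_dist p q"
proof -
  let ?v = "lift p + lift q"
  have vv: "lorentz ?v ?v = - (2 + 2 * cosh_dist p q)"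
    using p q by (simp add: lorentz_linear lorentz_lift_self cosh_dist_def lorentz_commute[of "lift q" "lift p"])
  then have "lorentz ?v ?v < 0" using cosh_dist_pos[OF p q] by simp
  then obtain m k where m: "m \<in> hyp" "k \<noteq> 0" "?v = k *\<^sub>R lift m" "k\<^sup>2 = - lorentz ?v ?v" by (rule timelike_lift)
  have "fst ?v > 0" using fst_lift_pos[OF p] fst_lift_pos[OF q] by simp
  then have "k > 0" unfolding m(3) using fst_lift_pos[OF m(1)] by (simp add: zero_less_mult_iff)
  with m vv that show ?thesis by simp
qed

text \<open>
  The sum of the lifts of \<open>p\<close> and \<open>q\<close> is a multiple of the lift of their midpoint \<open>m\<close>. So the sum on
  the right is a multiple of \<open>cosh_dist x m\<close>, and \<open>m\<close> lies in the hyperplane again. The square root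
  of \<open>(1 + cosh_dist p q) / 2\<close> is the hyperbolic cosine of half the distance from \<open>p\<close> to \<open>q\<close>.
\<close>

lemma cosh_dist_add_ge:
  assumes x: "x \<in> hyp" and p: "p \<in> hyp" "side e p = 0" and q: "q \<in> hyp" "side e q = 0"
    and e: "lorentz e e = 1"
  shows "2 * sqrt (1 + (side e x)\<^sup>2) * sqrt ((1 + cosh_dist p q) / 2) \<le> cosh_dist x p + cosh_dist x q"
proof -
  obtain m k where m: "m \<in> hyp" "k > 0" "lift p + lift q = k *\<^sub>R lift m" "k\<^sup>2 = 2 + 2 * cosh_dist p q"
    using midpoint_lift[OF p(1) q(1)] .
  have "k * side e m = lorentz (lift p + lift q) e" unfolding m(3) by (simp add: side_def lorentz_linear)
  then have "side e m = 0" using p q m(2) by (simp add: side_def lorentz_linear)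
  then have ge: "sqrt (1 + (side e x)\<^sup>2) \<le> cosh_dist x m" using cosh_dist_ge_side x m(1) e by blast
  have "k * cosh_dist x m = - lorentz (lift x) (lift p + lift q)" unfolding m(3) by (simp add: cosh_dist_def lorentz_linear)
  then have sum: "cosh_dist x p + cosh_dist x q = k * cosh_dist x m" by (simp add: cosh_dist_def lorentz_linear)
  have "(k / 2)\<^sup>2 = (1 + cosh_dist p q) / 2" using m(4) by (simp add: power_divide)
  then have k: "sqrt ((1 + cosh_dist p q) / 2) = k / 2" using m(2) by (simp add: real_sqrt_unique)
  then show ?thesis unfolding sum using ge m(2) mult_left_mono[OF ge, of k] by (simp only: mult_ac) (simp add: k mult_ac)
qed

lemma hyp_midpoint:
  assumes p: "p \<in> hyp" "side e p = 0" and q: "q \<in> hyp" "side e q = 0"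
  obtains m where "m \<in> hyp" "side e m = 0" "cosh_dist p m = sqrt ((1 + cosh_dist p q) / 2)" "cosh_dist q m = sqrt ((1 + cosh_dist p q) / 2)"
proof -
  obtain m k where m: "m \<in> hyp" "k > 0" "lift p + lift q = k *\<^sub>R lift m" "k\<^sup>2 = 2 + 2 * cosh_dist p q"
    using midpoint_lift[OF p(1) q(1)] .
  have "k * side e m = lorentz (lift p + lift q) e" unfolding m(3) by (simp add: side_def lorentz_linear)
  then have s: "side e m = 0" using p q m(2) by (simp add: side_def lorentz_linear)
  have "k * cosh_dist p m = - lorentz (lift p) (lift p + lift q)" unfolding m(3) by (simp add: cosh_dist_def lorentz_linear)
  then have 1: "k * cosh_dist p m = 1 + cosh_dist p q" using p by (simp add: lorentz_linear lorentz_lift_self cosh_dist_def)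
  have "k * cosh_dist q m = - lorentz (lift q) (lift p + lift q)" unfolding m(3) by (simp add: cosh_dist_def lorentz_linear)
  then have 2: "k * cosh_dist q m = 1 + cosh_dist p q" using q by (simp add: lorentz_linear lorentz_lift_self cosh_dist_def lorentz_commute[of "lift q" "lift p"])
  have "(k / 2)\<^sup>2 = (1 + cosh_dist p q) / 2" using m(4) by (simp add: power_divide)
  then have k: "sqrt ((1 + cosh_dist p q) / 2) = k / 2" using m(2) by (simp add: real_sqrt_unique)
  have "k * k = k\<^sup>2" by (simp add: power2_eq_square)
  then have "k * cosh_dist p m = k * (k / 2)" "k * cosh_dist q m = k * (k / 2)" using 1 2 m(4) by simp_all
  then have "cosh_dist p m = k / 2" "cosh_dist q m = k / 2" using m(2) by simp_all
  with k s m(1) that show ?thesis by simp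
qed

section \<open>Hyperplanes and half-spaces\<close>

lemma half_space_ofI:
  assumes "lorentz e e > 0"
  shows "half_space_of {x \<in> hyp. side e x = 0} {x \<in> hyp. side e x < 0}"
proof -
  have "\<bar>fst e\<bar>\<^sup>2 < (norm (snd e))\<^sup>2" using assms by (simp add: lorentz_def power2_norm_eq_inner) (simp add: power2_eq_square)
  then have "\<bar>fst e\<bar> < norm (snd e)" by (rule power2_less_imp_less) simp
  moreover have "side e x = 0 \<longleftrightarrow> snd e \<bullet> x = fst e" "side e x < 0 \<longleftrightarrow> snd e \<bullet> x < fst e"
    if "x \<in> hyp" for x using that by (auto simp: side_eq hyp_inner_less_1 divide_less_0_iff)
  then have "{x \<in> hyp. side e x = 0} = {x \<in> hyp. snd e \<bullet> x = fst e}"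
    "{x \<in> hyp. side e x < 0} = {x \<in> hyp. snd e \<bullet> x < fst e}" by blast+
  ultimately show ?thesis unfolding half_space_of_def by blast
qed

lemma half_space_ofE:
  assumes "half_space_of X U"
  obtains e where "lorentz e e = 1" "X = {x \<in> hyp. side e x = 0}" "U = {x \<in> hyp. side e x < 0}"
proof -
  obtain a b where ab: "\<bar>b\<bar> < norm a" "X = {x \<in> hyp. a \<bullet> x = b}" "U = {x \<in> hyp. a \<bullet> x < b}"
    using assms unfolding half_space_of_def by blast
  define k where "k = sqrt (a \<bullet> a - b * b)"
  have "b\<^sup>2 < (norm a)\<^sup>2" using ab(1) by (metis abs_ge_zero power2_abs power_strict_mono zero_less_numeral)
  then have kk: "a \<bullet> a - b * b > 0" by (simp add: power2_norm_eq_inner) (simp add: power2_eq_square)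
  then have k: "k > 0" "k * k = a \<bullet> a - b * b" by (simp_all add: k_def)
  define e where "e = (1/k) *\<^sub>R (b, a)"
  have "lorentz e e = (a \<bullet> a - b * b) / (k * k)" by (simp add: e_def lorentz_def diff_divide_distrib)
  then have "lorentz e e = 1" using k kk by simp
  moreover have side_e: "side e x = (a \<bullet> x - b) / (k * sqrt (1 - x \<bullet> x))" for x
    using k(1) by (simp add: side_eq e_def field_simps)
  have "side e x = 0 \<longleftrightarrow> a \<bullet> x = b" "side e x < 0 \<longleftrightarrow> a \<bullet> x < b"
    if "x \<in> hyp" for x
  proof -
    have "k * sqrt (1 - x \<bullet> x) > 0" using that k by (simp add: hyp_inner_less_1)
    then show "side e x = 0 \<longleftrightarrow> a \<bullet> x = b" "side e x < 0 \<longleftrightarrow> a \<bullet> x < b"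
      by (auto simp: side_e divide_less_0_iff)
  qed
  then have "X = {x \<in> hyp. side e x = 0}" "U = {x \<in> hyp. side e x < 0}" unfolding ab by blast+
  ultimately show ?thesis using that by blast
qed

lemma half_space_of_imp_hyperplane: "half_space_of X U \<Longrightarrow> hyperplane X"
  unfolding half_space_of_def hyperplane_def by blast

lemma hyperplane_half_spaceE:
  assumes "hyperplane X"
  obtains U where "half_space_of X U"
  using assms unfolding hyperplane_def half_space_of_def by blast

lemma hyperplane_subset_hyp: "hyperplane X \<Longrightarrow> X \<subseteq> hyp"
  unfolding hyperplane_def by blast

lemma half_space_bisectorI:
  assumes "p \<in> hyp" "q \<in> hyp" "p \<noteq> q"
  shows "half_space_of {x \<in> hyp. cosh_dist x p = cosh_dist x q} {x \<in> hyp. cosh_dist x p < cosh_dist x q}"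
proof -
  let ?e = "lift q - lift p"
  have "lorentz ?e ?e = 2 * cosh_dist p q - 2"
    using assms by (simp add: lorentz_linear lorentz_lift_self cosh_dist_def lorentz_commute[of "lift q" "lift p"])
  then have "lorentz ?e ?e > 0" using cosh_dist_gt_1[OF assms] by simp
  moreover have "side ?e x = cosh_dist x p - cosh_dist x q" for x
    by (simp add: side_def cosh_dist_def lorentz_linear)
  ultimately show ?thesis using half_space_ofI[of ?e] by simp
qed

text \<open>
  The two points are obtained by moving a point \<open>c\<close> of the hyperplane by the same amount along the
  normal geodesic in both directions. This describes half-spaces by distances alone, so that
  isometries carry half-spaces to half-spaces.
\<close>

lemma half_space_bisectorE:
  assumes "half_space_of X U"
  obtains p q where "p \<in> hyp" "q \<in> hyp" "p \<noteq> q"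
    "X = {x \<in> hyp. cosh_dist x p = cosh_dist x q}" "U = {x \<in> hyp. cosh_dist x p < cosh_dist x q}"
proof -
  obtain e where e: "lorentz e e = 1" "X = {x \<in> hyp. side e x = 0}" "U = {x \<in> hyp. side e x < 0}"
    using assms by (rule half_space_ofE)
  have "0 \<in> hyp" by (simp add: hyp_def)
  then obtain c where c: "c \<in> hyp" "side e c = 0" using foot_of_perpendicular[OF _ e(1)] by metis
  \<comment> \<open>The point at signed distance \<open>arsinh t\<close> on the normal geodesic; \<open>sqrt 2\<close> is \<open>cosh (arsinh 1)\<close>.\<close>
  have *: "\<exists>p\<in>hyp. lift p = sqrt 2 *\<^sub>R lift c + t *\<^sub>R e" if t: "t * t = 1" for t
  proof -
    let ?v = "sqrt 2 *\<^sub>R lift c + t *\<^sub>R e"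
    have ce: "lorentz (lift c) e = 0" "lorentz e (lift c) = 0" using c by (simp_all add: side_def lorentz_commute)
    have vv: "lorentz ?v ?v = -1"
      using ce e(1) c(1) t by (simp add: lorentz_linear lorentz_lift_self algebra_simps)
    then have "lorentz ?v ?v < 0" by simp
    then obtain y k where y: "y \<in> hyp" "k \<noteq> 0" "?v = k *\<^sub>R lift y" "k\<^sup>2 = - lorentz ?v ?v" by (rule timelike_lift)
    have "lorentz (lift c) ?v = - (k * cosh_dist c y)" unfolding y(3) by (simp add: lorentz_linear cosh_dist_def)
    moreover have "lorentz (lift c) ?v = - sqrt 2" using ce c by (simp add: lorentz_linear lorentz_lift_self)
    ultimately have "k * cosh_dist c y = sqrt 2" by linarith
  then have "k * cosh_dist c y > 0" by (simp only:) simp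
    then have "k > 0" using cosh_dist_pos[OF c(1) y(1)] by (simp add: zero_less_mult_iff)
    moreover have "k = 1 \<or> k = -1" using y(4) vv by (simp add: power2_eq_1_iff)
    ultimately have "k = 1" by linarith
    then show ?thesis using y by (intro bexI[of _ y]) simp_all
  qed
  obtain p where p: "p \<in> hyp" "lift p = sqrt 2 *\<^sub>R lift c + (-1) *\<^sub>R e" using *[of "-1"] by auto
  obtain q where q: "q \<in> hyp" "lift q = sqrt 2 *\<^sub>R lift c + 1 *\<^sub>R e" using *[of 1] by auto
  have eq: "2 * side e x = cosh_dist x p - cosh_dist x q" for x
    by (simp add: side_def cosh_dist_def p q lorentz_linear)
  have X: "X = {x \<in> hyp. cosh_dist x p = cosh_dist x q}" and U: "U = {x \<in> hyp. cosh_dist x p < cosh_dist x q}"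
    unfolding e using eq by (auto simp: algebra_simps) (smt (verit))+
  have "p \<noteq> q"
  proof
    assume "p = q"
    then have "2 *\<^sub>R e = 0" using p q by (simp add: algebra_simps scaleR_2)
    then have "e = 0" by simp
    then show False using e(1) by (simp add: lorentz_def)
  qed
  with p q X U that show ?thesis by blast
qed

lemma half_space_of_isometry_image:
  assumes XU: "half_space_of X U" and b: "bij_betw f hyp hyp"
    and iso: "\<And>x y. x \<in> hyp \<Longrightarrow> y \<in> hyp \<Longrightarrow> cosh_dist (f x) (f y) = cosh_dist x y"
  shows "half_space_of (f ` X) (f ` U)"
proof -
  obtain p q where pq: "p \<in> hyp" "q \<in> hyp" "p \<noteq> q"
    "X = {x \<in> hyp. cosh_dist x p = cosh_dist x q}" "U = {x \<in> hyp. cosh_dist x p < cosh_dist x q}"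
    using XU by (rule half_space_bisectorE)
  have f: "f p \<in> hyp" "f q \<in> hyp" "f p \<noteq> f q"
    using b pq by (auto simp: bij_betw_def inj_on_def)
  have im: "f ` {x \<in> hyp. P x} = {y \<in> hyp. Q y}" if "\<And>x. x \<in> hyp \<Longrightarrow> P x = Q (f x)" for P Q
    using b that by (auto simp: bij_betw_def image_iff) (metis imageE)
  have "f ` X = {y \<in> hyp. cosh_dist y (f p) = cosh_dist y (f q)}" "f ` U = {y \<in> hyp. cosh_dist y (f p) < cosh_dist y (f q)}"
    unfolding pq(4,5) by (rule im, simp add: iso pq(1,2))+
  then show ?thesis using half_space_bisectorI[OF f] by simp
qed

section \<open>Hyperbolic balls and geodesic segments\<close>

lemma continuous_on_side: "continuous_on hyp (side e)"
  unfolding side_eq[abs_def] by (intro continuous_intros) (auto simp: hyp_inner_less_1)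

lemma open_side_less: "open {x \<in> hyp. side e x < c}"
proof -
  have "open (hyp \<inter> side e -` {..<c})"
    by (rule continuous_open_preimage[OF continuous_on_side open_hyp]) simp
  moreover have "{x \<in> hyp. side e x < c} = hyp \<inter> side e -` {..<c}" by auto
  ultimately show ?thesis by simp
qed

lemma open_hball: "x \<in> hyp \<Longrightarrow> open (hball x r)"
proof (cases "r > 0")
  case True
  assume x: "x \<in> hyp"
  then have "hball x r = {y \<in> hyp. side (- lift x) y < cosh r}"
    using True by (auto simp: hball_def hdist_less_iff cosh_dist_commute[of x]) 
      (simp_all add: cosh_dist_def side_def lorentz_def)
  then show ?thesis by (simp add: open_side_less)
next
  case False
  assume x: "x \<in> hyp"
  then have "hball x r = {}" using False hdist_nonneg[OF x] by (force simp: hball_def)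
  then show ?thesis by simp
qed

lemma centre_in_hball: "x \<in> hyp \<Longrightarrow> r > 0 \<Longrightarrow> x \<in> hball x r"
  by (simp add: hball_def hdist_self)

lemma hball_subset_open:
  assumes "open O'" "x \<in> O'" "x \<in> hyp"
  obtains r where "r > 0" "hball x r \<subseteq> O'"
proof -
  obtain e where e: "e > 0" "ball x e \<subseteq> O'" using assms open_contains_ball by blast
  \<comment> \<open>This is \<open>arsinh e\<close>, the radius that fits \<open>norm_diff_le_cosh_dist\<close>.\<close>
  define r where "r = arcosh (sqrt (1 + e\<^sup>2))"
  have 1: "sqrt (1 + e\<^sup>2) > 1" using e by simp
  then have r: "r > 0" "cosh r = sqrt (1 + e\<^sup>2)" by (simp_all add: r_def)
  have "hball x r \<subseteq> ball x e"
  proof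
    fix y assume y: "y \<in> hball x r"
    then have yh: "y \<in> hyp" "cosh_dist x y < sqrt (1 + e\<^sup>2)" 
      using assms r by (auto simp: hball_def hdist_less_iff[symmetric] less_imp_le)
        (metis hdist_less_iff less_imp_le)
    have "(cosh_dist x y)\<^sup>2 < (sqrt (1 + e\<^sup>2))\<^sup>2"
      using yh cosh_dist_pos[OF assms(3) yh(1)] by (intro power_strict_mono) auto
    also have "\<dots> = 1 + e\<^sup>2" by (smt (verit) real_sqrt_pow2 zero_le_power2)
    finally have "(norm (x - y))\<^sup>2 < e\<^sup>2" using norm_diff_le_cosh_dist[OF assms(3) yh(1)] by linarith
    then show "y \<in> ball x e" using e(1) by (auto simp: dist_norm intro: power2_less_imp_less)
  qed
  with r e that show ?thesis by blast
qed

lemma closed_segment_hyp: "a \<in> hyp \<Longrightarrow> b \<in> hyp \<Longrightarrow> closed_segment a b \<subseteq> hyp"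
  unfolding hyp_def by (intro closed_segment_subset) auto

text \<open>
  The addition formula for the hyperbolic cosine of \<open>hdist a m + hdist m b\<close>. Euclidean segments are
  geodesics, and on the hyperboloid \<open>m\<close> is a combination of \<open>a\<close> and \<open>b\<close> with nonnegative
  coefficients; nonnegativity decides the signs of the two square roots.
\<close>

lemma cosh_dist_additive_on_segment:
  assumes a: "a \<in> hyp" and b: "b \<in> hyp" and m: "m \<in> closed_segment a b"
  shows "cosh_dist a b = cosh_dist a m * cosh_dist m b + sqrt ((cosh_dist a m)\<^sup>2 - 1) * sqrt ((cosh_dist m b)\<^sup>2 - 1)"
proof -
  have mh: "m \<in> hyp" using closed_segment_hyp a b m by blast
  obtain t where t: "0 \<le> t" "t \<le> 1" "m = (1 - t) *\<^sub>R a + t *\<^sub>R b" using m by (auto simp: in_segment)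
  let ?w = "\<lambda>x. sqrt (1 - x \<bullet> x)"
  have w: "?w a > 0" "?w b > 0" "?w m > 0" using a b mh by (auto simp: hyp_inner_less_1)
  define p q where "p = (1 - t) * ?w a / ?w m" and "q = t * ?w b / ?w m"
  have pq: "p \<ge> 0" "q \<ge> 0" using w t by (simp_all add: p_def q_def)
  have "lift m = (1 / ?w m) *\<^sub>R ((1 - t) *\<^sub>R (1, a) + t *\<^sub>R (1, b))"
    unfolding lift_def using t(3) by simp
  also have "\<dots> = p *\<^sub>R lift a + q *\<^sub>R lift b"
    using w by (simp add: lift_def p_def q_def algebra_simps add_divide_distrib diff_divide_distrib)
  finally have lm: "lift m = p *\<^sub>R lift a + q *\<^sub>R lift b" .
  let ?C = "cosh_dist a b"
  have u: "cosh_dist a m = p + q * ?C" and v: "cosh_dist m b = p * ?C + q"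
    using a b by (simp_all add: cosh_dist_def lm lorentz_linear lorentz_lift_self)
  have "lorentz (lift m) (lift m) = - (p\<^sup>2 + q\<^sup>2 + 2 * p * q * ?C)"
    unfolding lm using a b
    by (simp add: lorentz_linear lorentz_lift_self cosh_dist_def lorentz_commute[of "lift b" "lift a"] power2_eq_square algebra_simps)
  then have n: "p\<^sup>2 + q\<^sup>2 + 2 * p * q * ?C = 1" using mh by (simp add: lorentz_lift_self)
  have C: "?C\<^sup>2 - 1 \<ge> 0" using cosh_dist_ge_1[OF a b] by simp
  have "(cosh_dist a m)\<^sup>2 - 1 = q\<^sup>2 * (?C\<^sup>2 - 1)" unfolding u using n
    by (simp add: power2_eq_square algebra_simps)
  then have su: "sqrt ((cosh_dist a m)\<^sup>2 - 1) = q * sqrt (?C\<^sup>2 - 1)" using pq by (simp add: real_sqrt_mult)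
  have "(cosh_dist m b)\<^sup>2 - 1 = p\<^sup>2 * (?C\<^sup>2 - 1)" unfolding v using n
    by (simp add: power2_eq_square algebra_simps)
  then have sv: "sqrt ((cosh_dist m b)\<^sup>2 - 1) = p * sqrt (?C\<^sup>2 - 1)" using pq by (simp add: real_sqrt_mult)
  have ss: "sqrt (?C\<^sup>2 - 1) * sqrt (?C\<^sup>2 - 1) = ?C\<^sup>2 - 1" using C by simp
  have "(q * sqrt (?C\<^sup>2 - 1)) * (p * sqrt (?C\<^sup>2 - 1)) = p * q * (sqrt (?C\<^sup>2 - 1) * sqrt (?C\<^sup>2 - 1))"
    by (simp only: mult_ac)
  then have ss': "(q * sqrt (?C\<^sup>2 - 1)) * (p * sqrt (?C\<^sup>2 - 1)) = p * q * (?C\<^sup>2 - 1)"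
    by (simp only: ss)
  have "cosh_dist a m * cosh_dist m b + sqrt ((cosh_dist a m)\<^sup>2 - 1) * sqrt ((cosh_dist m b)\<^sup>2 - 1)
      = (p + q * ?C) * (p * ?C + q) + p * q * (?C\<^sup>2 - 1)"
    using ss' by (simp only: su sv) (simp only: u v)
  also have "\<dots> = ?C * (p\<^sup>2 + q\<^sup>2 + 2 * p * q * ?C)"
    by (simp add: power2_eq_square algebra_simps)
  finally show ?thesis using n by simp
qed

lemma hdist_additive_on_segment:
  assumes a: "a \<in> hyp" and b: "b \<in> hyp" and m: "m \<in> closed_segment a b"
  shows "hdist a b = hdist a m + hdist m b"
proof -
  have mh: "m \<in> hyp" using closed_segment_hyp a b m by blast
  let ?p = "hdist a m" and ?q = "hdist m b"
  have pq: "?p \<ge> 0" "?q \<ge> 0" using hdist_nonneg a b mh by auto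
  have "cosh (hdist a b) = cosh ?p * cosh ?q + sqrt ((cosh ?p)\<^sup>2 - 1) * sqrt ((cosh ?q)\<^sup>2 - 1)"
    using cosh_dist_additive_on_segment[OF a b m] a b mh by (simp add: cosh_hdist)
  also have "(cosh ?p)\<^sup>2 - 1 = (sinh ?p)\<^sup>2" by (simp add: cosh_square_eq)
  also have "(cosh ?q)\<^sup>2 - 1 = (sinh ?q)\<^sup>2" by (simp add: cosh_square_eq)
  finally have "cosh (hdist a b) = cosh (?p + ?q)" using pq by (simp add: cosh_add)
  then show ?thesis using pq hdist_nonneg[OF a b] by simp
qed

lemma half_space_subset_hyp: "half_space_of X U \<Longrightarrow> X \<subseteq> hyp \<and> U \<subseteq> hyp \<and> X \<inter> U = {}"
  unfolding half_space_of_def by auto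

text \<open>
  A small step from the boundary point against the normal direction leads into the half-space.
\<close>

lemma half_space_boundary:
  assumes "half_space_of X U" "x \<in> X" "open T" "x \<in> T"
  shows "T \<inter> U \<noteq> {}"
proof -
  obtain a b where ab: "\<bar>b\<bar> < norm a" "X = {x \<in> hyp. a \<bullet> x = b}" "U = {x \<in> hyp. a \<bullet> x < b}"
    using assms(1) unfolding half_space_of_def by blast
  have "open (T \<inter> hyp)" "x \<in> T \<inter> hyp" using assms ab open_hyp by auto
  then obtain e where e: "e > 0" "ball x e \<subseteq> T \<inter> hyp" using open_contains_ball by blast
  have a0: "norm a > 0" using ab(1) by linarith
  define y where "y = x - (e / 2 / norm a) *\<^sub>R a"
  have "dist x y < e" using e a0 by (simp add: y_def dist_norm)
  then have "y \<in> T \<inter> hyp" using e by auto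
  moreover have "a \<bullet> y = b - (e / 2 / norm a) * (a \<bullet> a)" using assms(2) ab by (simp add: y_def inner_diff_right)
  moreover have "(e / 2 / norm a) * (a \<bullet> a) > 0" using e a0 by simp
  ultimately show ?thesis using ab(3) by auto
qed

lemma open_half_space: "half_space_of X U \<Longrightarrow> open U"
proof -
  assume "half_space_of X U"
  then obtain e where "U = {x \<in> hyp. side e x < 0}" by (rule half_space_ofE)
  then show ?thesis using open_side_less by simp
qed

lemma open_half_space_compl: "half_space_of X U \<Longrightarrow> open (hyp - (X \<union> U))"
proof -
  assume "half_space_of X U"
  then obtain e where e: "X = {x \<in> hyp. side e x = 0}" "U = {x \<in> hyp. side e x < 0}" by (rule half_space_ofE)
  have "hyp - (X \<union> U) = {x \<in> hyp. side (- e) x < 0}"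
    by (auto simp: e side_def lorentz_def)
  then show ?thesis using open_side_less by simp
qed

lemma connected_hyperplane: "half_space_of X U \<Longrightarrow> connected X"
proof -
  assume "half_space_of X U"
  then obtain a b where "X = {x \<in> hyp. a \<bullet> x = b}" unfolding half_space_of_def by blast
  then have "X = hyp \<inter> {x. a \<bullet> x = b}" by blast
  then have "convex X" unfolding hyp_def by (simp add: convex_Int convex_hyperplane)
  then show ?thesis by (rule convex_connected)
qed

section \<open>Reduced words in two subgroups\<close>

locale two_subgroups = group K for K (structure) +
  fixes F1 F2
  assumes sub1: "subgroup F1 K" and sub2: "subgroup F2 K"
begin

abbreviation "W \<equiv> fp_words (K\<lparr>carrier := F1\<rparr>) (K\<lparr>carrier := F2\<rparr>)"
abbreviation "L \<equiv> F1 <+> F2"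
abbreviation "rel \<equiv> fp_rel (K\<lparr>carrier := F1\<rparr>) (K\<lparr>carrier := F2\<rparr>)"

abbreviation letter :: "'a + 'a \<Rightarrow> 'a" where "letter \<equiv> case_sum id id"

definition word_eval :: "('a + 'a) list \<Rightarrow> 'a" where
  "word_eval w = foldr (\<lambda>a g. letter a \<otimes> g) w \<one>"

text \<open>
  Alternation is stated through \<open>isl\<close>, which tells from which of the two subgroups a letter is taken.
\<close>

definition reduced :: "('a + 'a) list \<Rightarrow> bool" where
  "reduced w \<longleftrightarrow> (\<forall>a\<in>set w. letter a \<noteq> \<one>) \<and> successively (\<lambda>a b. isl a \<noteq> isl b) w"

lemma W_simps [simp]:
  "[] \<in> W" "a # w \<in> W \<longleftrightarrow> a \<in> L \<and> w \<in> W" "v @ w \<in> W \<longleftrightarrow> v \<in> W \<and> w \<in> W"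
  "Inl f \<in> L \<longleftrightarrow> f \<in> F1" "Inr f \<in> L \<longleftrightarrow> f \<in> F2"
  by (auto simp: fp_words_def)

lemma letter_closed [simp]: "a \<in> L \<Longrightarrow> letter a \<in> carrier K"
  using sub1 sub2 by (cases a) (auto dest: subgroup.mem_carrier)

lemma eval_simps [simp]: "word_eval [] = \<one>" "word_eval (a # w) = letter a \<otimes> word_eval w"
  by (simp_all add: word_eval_def)

lemma eval_closed [simp]: "w \<in> W \<Longrightarrow> word_eval w \<in> carrier K"
  by (induction w) auto

lemma eval_append: "v \<in> W \<Longrightarrow> w \<in> W \<Longrightarrow> word_eval (v @ w) = word_eval v \<otimes> word_eval w"
  by (induction v) (auto simp: m_assoc)

lemma rel_eval: "(v, w) \<in> rel \<Longrightarrow> word_eval v = word_eval w"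
proof (induction rule: fp_rel.induct)
  case (mult_left u v x y)
  then have "x \<in> carrier K" "y \<in> carrier K" using sub1 by (auto dest: subgroup.mem_carrier)
  with mult_left show ?case using sub1
    by (simp add: eval_append m_assoc subgroup.m_closed)
next
  case (mult_right u v x y)
  then have "x \<in> carrier K" "y \<in> carrier K" using sub2 by (auto dest: subgroup.mem_carrier)
  with mult_right show ?case using sub2
    by (simp add: eval_append m_assoc subgroup.m_closed)
qed (simp_all add: eval_append subgroup.one_closed[OF sub1] subgroup.one_closed[OF sub2])

lemma eval_generate: "w \<in> W \<Longrightarrow> word_eval w \<in> generate K (F1 \<union> F2)"
proof (induction w)
  case Nil
  then show ?case by (simp add: generate.one)
next
  case (Cons a w)
  then have "letter a \<in> F1 \<union> F2" by (cases a) auto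
  with Cons show ?case by (auto intro: generate.eng generate.incl)
qed

lemma generate_eq_eval: "generate K (F1 \<union> F2) = word_eval ` W"
proof
  show "word_eval ` W \<subseteq> generate K (F1 \<union> F2)" using eval_generate by blast
next
  have single: "h \<in> word_eval ` W" if "h \<in> F1 \<union> F2" for h
  proof -
    have "[Inl h] \<in> W \<or> [Inr h] \<in> W" "h \<in> carrier K"
      using that sub1 sub2 by (auto dest: subgroup.mem_carrier)
    moreover have "h = word_eval [Inl h]" "h = word_eval [Inr h]" using \<open>h \<in> carrier K\<close> by simp_all
    ultimately show ?thesis by blast
  qed
  show "generate K (F1 \<union> F2) \<subseteq> word_eval ` W"
  proof
    fix g assume "g \<in> generate K (F1 \<union> F2)"
    then show "g \<in> word_eval ` W"
    proof induction
      case one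
      have "\<one> = word_eval []" by simp
      then show ?case using W_simps(1) by blast
    next
      case (incl h)
      then show ?case by (rule single)
    next
      case (inv h)
      then have "inv h \<in> F1 \<union> F2" using sub1 sub2 by (auto intro: subgroup.m_inv_closed)
      then show ?case by (rule single)
    next
      case (eng g h)
      then obtain v w where vw: "v \<in> W" "w \<in> W" "g = word_eval v" "h = word_eval w" by blast
      then have "g \<otimes> h = word_eval (v @ w)" by (simp add: eval_append)
      moreover have "v @ w \<in> W" using vw by simp
      ultimately show ?case by blast
    qed
  qed
qed

lemma not_successivelyE:
  assumes "\<not> successively P w"
  obtains u a b v where "w = u @ [a, b] @ v" "\<not> P a b"
proof -
  have "\<exists>u a b v. w = u @ [a, b] @ v \<and> \<not> P a b"
    using assms
  proof (induction w rule: induct_list012)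
    case (3 a b w)
    show ?case
    proof (cases "P a b")
      case True
      with 3 obtain u c d v where "b # w = u @ [c, d] @ v" "\<not> P c d" by auto
      then have "a # b # w = (a # u) @ [c, d] @ v \<and> \<not> P c d" by simp
      then show ?thesis by blast
    next
      case False
      then have "a # b # w = [] @ [a, b] @ w \<and> \<not> P a b" by simp
      then show ?thesis by blast
    qed
  qed auto
  with that show ?thesis by blast
qed

lemma merge_letters:
  assumes "a \<in> L" "b \<in> L" "isl a = isl b"
  obtains c where "c \<in> L" "isl c = isl a" "letter c = letter a \<otimes> letter b"
    "\<And>u v. u \<in> W \<Longrightarrow> v \<in> W \<Longrightarrow> (u @ [a, b] @ v, u @ [c] @ v) \<in> rel"
proof (cases a)
  case (Inl x)
  then obtain y where y: "b = Inl y" using assms by (cases b) auto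
  have xy: "x \<in> F1" "y \<in> F1" using assms Inl y by auto
  have "(u @ [a, b] @ v, u @ [Inl (x \<otimes> y)] @ v) \<in> rel" if "u \<in> W" "v \<in> W" for u v
    using fp_rel.mult_left[OF that, of x y] xy Inl y by simp
  moreover have "x \<otimes> y \<in> F1" using xy sub1 by (simp add: subgroup.m_closed)
  ultimately show ?thesis using that[of "Inl (x \<otimes> y)"] Inl y by simp
next
  case (Inr x)
  then obtain y where y: "b = Inr y" using assms by (cases b) auto
  have xy: "x \<in> F2" "y \<in> F2" using assms Inr y by auto
  have "(u @ [a, b] @ v, u @ [Inr (x \<otimes> y)] @ v) \<in> rel" if "u \<in> W" "v \<in> W" for u v
    using fp_rel.mult_right[OF that, of x y] xy Inr y by simp
  moreover have "x \<otimes> y \<in> F2" using xy sub2 by (simp add: subgroup.m_closed)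
  ultimately show ?thesis using that[of "Inr (x \<otimes> y)"] Inr y by simp
qed

text \<open>
  One step of reduction: a trivial letter is dropped, or two neighbours from the same subgroup are
  merged. That the word gets shorter, and not only equivalent, is what both the existence of reduced
  forms and the passage to cyclically reduced words below rest on.
\<close>

lemma shorten_non_reduced:
  assumes w: "w \<in> W" and nr: "\<not> reduced w"
  obtains v where "v \<in> W" "length v < length w" "(w, v) \<in> rel"
proof (cases "\<exists>a\<in>set w. letter a = \<one>")
  case True
  then obtain a u v where a: "letter a = \<one>" "w = u @ a # v" by (metis split_list)
  have uv: "u \<in> W" "v \<in> W" "a \<in> L" using w a by auto
  have "(w, u @ v) \<in> rel"
    using a fp_rel.one_left[OF uv(1,2)] fp_rel.one_right[OF uv(1,2)] by (cases a) auto
  then show ?thesis using that[of "u @ v"] uv a by simp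
next
  case False
  then have "\<not> successively (\<lambda>a b. isl a \<noteq> isl b) w" using nr by (simp add: reduced_def)
  then obtain u a b v where uv: "w = u @ [a, b] @ v" "\<not> isl a \<noteq> isl b" by (rule not_successivelyE)
  have W: "a \<in> L" "b \<in> L" "u \<in> W" "v \<in> W" using w uv(1) by auto
  obtain c where "c \<in> L" "(u @ [a, b] @ v, u @ [c] @ v) \<in> rel"
    using merge_letters[OF W(1,2)] uv(2) W(3,4) by metis
  then show ?thesis using that[of "u @ [c] @ v"] uv W by simp
qed

lemma reduced_form:
  assumes "w \<in> W"
  shows "\<exists>v\<in>W. reduced v \<and> (w, v) \<in> rel"
  using assms
proof (induction w rule: measure_induct_rule[of length])
  case (less w)
  show ?case
  proof (cases "reduced w")
    case True
    then show ?thesis using less.prems fp_rel.refl by blast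
  next
    case False
    then obtain v where v: "v \<in> W" "length v < length w" "(w, v) \<in> rel"
      using shorten_non_reduced less.prems by blast
    with less.IH obtain u where "u \<in> W" "reduced u" "(v, u) \<in> rel" by blast
    with v show ?thesis using fp_rel.trans by blast
  qed
qed

lemma generate_reducedE:
  assumes "g \<in> generate K (F1 \<union> F2)"
  obtains w where "w \<in> W" "reduced w" "g = word_eval w"
proof -
  obtain v where v: "v \<in> W" "g = word_eval v" using assms unfolding generate_eq_eval by blast
  obtain w where "w \<in> W" "reduced w" "(v, w) \<in> rel" using reduced_form[OF v(1)] by blast
  then show ?thesis using that rel_eval v(2) by simp
qed

lemma generate_subgroup: "subgroup (generate K (F1 \<union> F2)) K"
  using sub1 sub2 by (intro generate_is_subgroup) (auto dest: subgroup.subset)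

text \<open>
  The canonical map from the free product is evaluation of words. A word in its kernel has a reduced
  form that evaluates to the unit, hence is empty.
\<close>

lemma free_product_if_reduced_nontrivial:
  assumes nontriv: "\<And>w. w \<in> W \<Longrightarrow> reduced w \<Longrightarrow> w \<noteq> [] \<Longrightarrow> word_eval w \<noteq> \<one>"
  shows "is_free_product_of (K\<lparr>carrier := generate K (F1 \<union> F2)\<rparr>) F1 F2"
proof -
  let ?A = "K\<lparr>carrier := F1\<rparr>" and ?B = "K\<lparr>carrier := F2\<rparr>"
  let ?G = "K\<lparr>carrier := generate K (F1 \<union> F2)\<rparr>"
  let ?P = "free_product ?A ?B"
  have gA: "group ?A" and gB: "group ?B" using sub1 sub2 subgroup_imp_group by blast+
  have gP: "group ?P" by (rule group_free_product[OF gA gB])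
  have gG: "group ?G" using generate_subgroup subgroup_imp_group by blast
  have E: "equiv W rel" by (rule equiv_fp_rel[OF gA gB])
  define \<phi> where "\<phi> U = the_elem (word_eval ` U)" for U
  have phi: "\<phi> (rel `` {w}) = word_eval w" if "w \<in> W" for w
  proof -
    have "word_eval ` (rel `` {w}) = {word_eval w}"
    proof (intro equalityI subsetI)
      fix x assume "x \<in> word_eval ` (rel `` {w})"
      then show "x \<in> {word_eval w}" by (auto dest: rel_eval)
    next
      fix x assume "x \<in> {word_eval w}"
      moreover have "w \<in> rel `` {w}" using fp_rel.refl[OF that] by simp
      ultimately show "x \<in> word_eval ` (rel `` {w})" by blast
    qed
    then show ?thesis by (simp add: \<phi>_def)
  qed
  have car: "carrier ?P = {rel `` {w} | w. w \<in> W}" by (auto simp: free_product_def quotient_def)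
  have hom: "\<phi> \<in> hom ?P ?G"
  proof (rule homI)
    fix U assume "U \<in> carrier ?P"
    then show "\<phi> U \<in> carrier ?G" using phi eval_generate by (auto simp: car)
  next
    fix U V assume "U \<in> carrier ?P" "V \<in> carrier ?P"
    then obtain u v where uv: "u \<in> W" "v \<in> W" "U = rel `` {u}" "V = rel `` {v}" by (auto simp: car)
    then have "U \<otimes>\<^bsub>?P\<^esub> V = rel `` {u @ v}" using fp_mult[OF gA gB] by blast
    then show "\<phi> (U \<otimes>\<^bsub>?P\<^esub> V) = \<phi> U \<otimes>\<^bsub>?G\<^esub> \<phi> V" using uv by (simp add: phi eval_append)
  qed
  interpret H: group_hom ?P ?G \<phi> using gP gG hom by (simp add: group_hom_def group_hom_axioms_def)
  have surj: "\<phi> ` carrier ?P = carrier ?G"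
    unfolding car generate_eq_eval using phi by (auto simp: image_iff) (metis)
  have "inj_on \<phi> (carrier ?P)"
  proof (rule H.inj_on_one_iff[THEN iffD2], intro allI impI)
    fix U assume "U \<in> carrier ?P" "\<phi> U = \<one>\<^bsub>?G\<^esub>"
    then obtain w where w: "w \<in> W" "U = rel `` {w}" "word_eval w = \<one>" using phi by (auto simp: car)
    obtain v where v: "v \<in> W" "reduced v" "(w, v) \<in> rel" using reduced_form[OF w(1)] by blast
    have "v = []" using nontriv[OF v(1,2)] rel_eval[OF v(3)] w(3) by auto
    then have "U = rel `` {[]}" using v(3) w(2) equiv_class_eq[OF E] by blast
    then show "U = \<one>\<^bsub>?P\<^esub>" by (simp add: free_product_def)
  qed
  then have "\<phi> \<in> iso ?P ?G" using hom surj by (auto simp: iso_def bij_betw_def)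
  moreover have "\<phi> (rel `` {[Inl f]}) = f" if "f \<in> F1" for f
    using that phi[of "[Inl f]"] subgroup.mem_carrier[OF sub1] by simp
  moreover have "\<phi> (rel `` {[Inr f]}) = f" if "f \<in> F2" for f
    using that phi[of "[Inr f]"] subgroup.mem_carrier[OF sub2] by simp
  ultimately show ?thesis unfolding is_free_product_of_def Let_def by auto
qed

lemma conj_pow:
  assumes "h \<in> carrier K" "g \<in> carrier K"
  shows "(h \<otimes> g \<otimes> inv h) [^] (k::nat) = h \<otimes> g [^] k \<otimes> inv h"
proof (induction k)
  case (Suc k)
  have "h \<otimes> g [^] k \<otimes> inv h \<otimes> (h \<otimes> g \<otimes> inv h) = h \<otimes> g [^] k \<otimes> (inv h \<otimes> h) \<otimes> g \<otimes> inv h"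
    using assms by (simp only: m_assoc m_closed inv_closed nat_pow_closed)
  then show ?case using assms Suc by (simp add: m_assoc)
qed (use assms in simp)

lemma pow_carrier_update: "g [^]\<^bsub>K\<lparr>carrier := H\<rparr>\<^esub> (k::nat) = g [^] k"
  by (simp add: nat_pow_def)

text \<open>
  Among the words that represent a conjugate of a given torsion element choose a shortest one. If its
  first and last letters come from the same subgroup and it has more than one letter, conjugation by
  the first letter and merging gives a shorter word; if they come from different subgroups, the
  word is cyclically reduced and has infinite order by assumption. So it has at most one letter, and
  the element is conjugate into one of the two subgroups.
\<close>

lemma torsion_free_if_cyclically_reduced:
  assumes tf: "torsion_free (K\<lparr>carrier := F1\<rparr>)" "torsion_free (K\<lparr>carrier := F2\<rparr>)"
    and inf: "\<And>w k. \<lbrakk>w \<in> W; reduced w; w \<noteq> []; isl (hd w) \<noteq> isl (last w); k > 0\<rbrakk> 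
      \<Longrightarrow> word_eval w [^] (k::nat) \<noteq> \<one>"
  shows "torsion_free (K\<lparr>carrier := generate K (F1 \<union> F2)\<rparr>)"
  unfolding torsion_free_def pow_carrier_update
proof (intro ballI allI impI, simp)
  fix g :: 'a and k :: nat
  assume g: "g \<in> generate K (F1 \<union> F2)" and k: "k > 0 \<and> g [^] k = \<one>"
  let ?C = "\<lambda>v. v \<in> W \<and> (\<exists>h\<in>carrier K. word_eval v = h \<otimes> g \<otimes> inv h)"
  have gK: "g \<in> carrier K" by (rule subgroup.mem_carrier[OF generate_subgroup g])
  obtain w where "w \<in> W" "g = word_eval w" using g generate_eq_eval by blast
  then have "?C w" using gK by (auto intro!: bexI[of _ \<one>])
  then obtain v where v: "?C v" and min: "\<And>u. ?C u \<Longrightarrow> length v \<le> length u"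
    using ex_has_least_nat[of ?C w length] by blast
  obtain h where h: "h \<in> carrier K" "word_eval v = h \<otimes> g \<otimes> inv h" using v by blast
  have vk: "word_eval v [^] k = \<one>" using h k gK by (simp add: conj_pow)
  have red: "reduced v"
  proof (rule ccontr)
    assume "\<not> reduced v"
    then obtain u where u: "u \<in> W" "length u < length v" "(v, u) \<in> rel"
      using shorten_non_reduced v by blast
    then have "?C u" using rel_eval[OF u(3)] v by auto
    with min u(2) show False by fastforce
  qed
  have ev1: "word_eval v = \<one>"
  proof (cases "v = []")
    case True
    then show ?thesis by simp
  next
    case ne: False
    have same: "isl (hd v) = isl (last v)" using inf[OF _ red ne _, of k] v vk k by auto
    show ?thesis
    proof (cases "length v = 1")
      case True
      then obtain a where a: "v = [a]" by (cases v) auto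
      then have "letter a [^] k = \<one>" "letter a \<in> carrier K" using vk v by simp_all
      moreover have "letter a \<in> F1 \<or> letter a \<in> F2" using v a by (cases a) auto
      ultimately have "letter a = \<one>" using tf k unfolding torsion_free_def pow_carrier_update by auto
      then show ?thesis using a by simp
    next
      case False
      then obtain a u b where vab: "v = a # u @ [b]"
        using ne by (metis append_Nil append_butlast_last_id hd_Cons_tl length_Cons list.size(3) One_nat_def)
      have ab: "b \<in> L" "a \<in> L" "u \<in> W" "isl b = isl a" using v vab same by auto
      obtain c where c: "c \<in> L" "letter c = letter b \<otimes> letter a"
        using merge_letters[OF ab(1,2,4)] by metis
      have cl: "letter a \<in> carrier K" "letter b \<in> carrier K" "word_eval u \<in> carrier K" using ab by auto
      have "word_eval (u @ [c]) = word_eval u \<otimes> (letter b \<otimes> letter a)"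
        using ab c cl by (simp add: eval_append)
      also have "\<dots> = inv (letter a) \<otimes> word_eval v \<otimes> letter a"
        using ab cl by (simp add: vab eval_append m_assoc inv_solve_left)
      also have "\<dots> = (inv (letter a) \<otimes> h) \<otimes> g \<otimes> inv (inv (letter a) \<otimes> h)"
        using cl h gK by (simp add: inv_mult_group m_assoc)
      finally have "\<exists>h\<in>carrier K. word_eval (u @ [c]) = h \<otimes> g \<otimes> inv h"
        using cl h by (intro bexI[of _ "inv (letter a) \<otimes> h"]) simp_all
      then have "?C (u @ [c])" using ab c by simp
      then show ?thesis using min[of "u @ [c]"] vab by simp
    qed
  qed
  then have "h \<otimes> g = h" using h gK by (metis inv_closed inv_inv m_closed inv_equality)
  then show "g = \<one>" using h gK by simp
qed

end

lemma torsion_free_subgroup: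
  assumes "torsion_free (K\<lparr>carrier := G\<rparr>)" "F \<subseteq> G"
  shows "torsion_free (K\<lparr>carrier := F\<rparr>)"
  using assms by (auto simp: torsion_free_def nat_pow_def)

section \<open>Ping-pong\<close>

text \<open>
  The complement of \<open>P1\<close> lies in \<open>P2\<close> and vice versa. So a nontrivial element of \<open>F1\<close> carries \<open>P1\<close>
  into its complement, that is into \<open>P2\<close>, from where the next letter, an element of \<open>F2\<close>, carries on.
\<close>

locale ping_pong = two_subgroups K F1 F2 + group_action K E \<phi>
  for K (structure) and F1 F2 and E and \<phi> +
  fixes P1 P2
  assumes P_sub: "P1 \<subseteq> E" "P2 \<subseteq> E" and P_cover: "E \<subseteq> P1 \<union> P2"
    and move1: "f \<in> F1 \<Longrightarrow> f \<noteq> \<one> \<Longrightarrow> z \<in> P1 \<Longrightarrow> \<phi> f z \<notin> P1"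
    and move2: "f \<in> F2 \<Longrightarrow> f \<noteq> \<one> \<Longrightarrow> z \<in> P2 \<Longrightarrow> \<phi> f z \<notin> P2"
    and P_meet: "P1 \<inter> P2 \<noteq> {}"
begin

lemma swap: "ping_pong K F2 F1 E \<phi> P2 P1"
proof (intro ping_pong.intro two_subgroups.intro two_subgroups_axioms.intro ping_pong_axioms.intro)
  show "group K" "subgroup F1 K" "subgroup F2 K" "group_action K E \<phi>"
    by (fact is_group sub1 sub2 group_action_axioms)+
  show "P2 \<subseteq> E" "P1 \<subseteq> E" "E \<subseteq> P2 \<union> P1" "P2 \<inter> P1 \<noteq> {}" using P_sub P_cover P_meet by auto
qed (fact move1 move2)+

text \<open>
  The set that the letter \<open>a\<close> moves off itself. It depends only on the subgroup of \<open>a\<close>.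
\<close>

definition region where "region a = (if isl a then P1 else P2)"

lemma region_subset: "region a \<subseteq> E" using P_sub by (simp add: region_def)

lemma act_closed: "g \<in> carrier K \<Longrightarrow> z \<in> E \<Longrightarrow> \<phi> g z \<in> E"
  using element_image by blast

lemma move_letter: "a \<in> L \<Longrightarrow> letter a \<noteq> \<one> \<Longrightarrow> z \<in> region a \<Longrightarrow> \<phi> (letter a) z \<notin> region a"
  using move1 move2 by (cases a) (auto simp: region_def)

lemma region_other: "z \<in> E \<Longrightarrow> z \<notin> region b \<Longrightarrow> isl a \<noteq> isl b \<Longrightarrow> z \<in> region a"
  using P_cover by (auto simp: region_def)

lemma act_one: "z \<in> E \<Longrightarrow> \<phi> \<one> z = z"
  by (metis id_eq_one restrict_apply')

lemma act_eval_Cons: "a # w \<in> W \<Longrightarrow> z \<in> E \<Longrightarrow> \<phi> (word_eval (a # w)) z = \<phi> (letter a) (\<phi> (word_eval w) z)"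
  by (simp add: composition_rule)

lemma reduced_ConsD: "reduced (a # b # w) \<Longrightarrow> reduced (b # w) \<and> isl a \<noteq> isl b \<and> letter a \<noteq> \<one>"
  by (auto simp: reduced_def)

lemma ping_pong_word:
  assumes "w \<in> W" "reduced w" "w \<noteq> []" "z \<in> region (last w)"
  shows "\<phi> (word_eval w) z \<notin> region (hd w)"
  using assms
proof (induction w rule: induct_list012)
  case (2 a)
  then show ?case using move_letter[of a z] by (auto simp: reduced_def)
next
  case (3 a b w)
  let ?z = "\<phi> (word_eval (b # w)) z"
  have z: "z \<in> E" using 3 region_subset by blast
  have W: "b # w \<in> W" "a \<in> L" using 3 by auto
  note r = reduced_ConsD[OF \<open>reduced (a # b # w)\<close>]
  have "?z \<notin> region b" using 3 r by simp
  moreover have "?z \<in> E" using act_closed[OF eval_closed[OF W(1)] z] .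
  ultimately have "?z \<in> region a" using region_other r by blast
  then have "\<phi> (letter a) ?z \<notin> region a" using move_letter W r by blast
  then show ?case using act_eval_Cons[OF _ z, of a "b # w"] 3 by simp
qed simp

lemma reduced_nontrivial:
  assumes "w \<in> W" "reduced w" "w \<noteq> []" "z \<in> P1 \<inter> P2"
  shows "\<phi> (word_eval w) z \<notin> P1 \<inter> P2"
proof -
  have "z \<in> region (last w)" using assms(4) by (auto simp: region_def)
  then have "\<phi> (word_eval w) z \<notin> region (hd w)" by (rule ping_pong_word[OF assms(1-3)])
  then show ?thesis by (auto simp: region_def split: if_splits)
qed

text \<open>
  The overlap of \<open>P1\<close> and \<open>P2\<close> is contained in the region of every letter, so any reduced word can be
  applied to it, and the result avoids the region of the first letter.
\<close>

lemma overlap_trivial_stabilizer: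
  assumes "g \<in> generate K (F1 \<union> F2)" "z \<in> P1 \<inter> P2" "\<phi> g z \<in> P1 \<inter> P2"
  shows "g = \<one>"
proof -
  obtain w where "w \<in> W" "reduced w" "g = word_eval w" using generate_reducedE[OF assms(1)] .
  then show ?thesis using reduced_nontrivial[of w z] assms by (cases "w = []") auto
qed

lemma free_product: "is_free_product_of (K\<lparr>carrier := generate K (F1 \<union> F2)\<rparr>) F1 F2"
proof (rule free_product_if_reduced_nontrivial)
  fix w assume w: "w \<in> W" "reduced w" "w \<noteq> []"
  obtain z where z: "z \<in> P1 \<inter> P2" using P_meet by blast
  then have "z \<in> E" using P_sub by blast
  then show "word_eval w \<noteq> \<one>" using reduced_nontrivial[OF w z] act_one[of z] z by force
qed

lemma torsion_free_iff:
  "torsion_free (K\<lparr>carrier := generate K (F1 \<union> F2)\<rparr>) \<longleftrightarrow>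
    torsion_free (K\<lparr>carrier := F1\<rparr>) \<and> torsion_free (K\<lparr>carrier := F2\<rparr>)"
proof
  assume "torsion_free (K\<lparr>carrier := generate K (F1 \<union> F2)\<rparr>)"
  then show "torsion_free (K\<lparr>carrier := F1\<rparr>) \<and> torsion_free (K\<lparr>carrier := F2\<rparr>)"
    using torsion_free_subgroup generate.incl by (metis Un_iff subsetI)
next
  assume "torsion_free (K\<lparr>carrier := F1\<rparr>) \<and> torsion_free (K\<lparr>carrier := F2\<rparr>)"
  then have tf: "torsion_free (K\<lparr>carrier := F1\<rparr>)" "torsion_free (K\<lparr>carrier := F2\<rparr>)" by auto
  show "torsion_free (K\<lparr>carrier := generate K (F1 \<union> F2)\<rparr>)"
  proof (rule torsion_free_if_cyclically_reduced[OF tf])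
    fix w and k :: nat
    assume w: "w \<in> W" "reduced w" "w \<noteq> []" "isl (hd w) \<noteq> isl (last w)" and k: "k > 0"
    obtain z where z: "z \<in> P1 \<inter> P2" using P_meet by blast
    then have zE: "z \<in> E" and zr: "z \<in> region a" for a using P_sub by (auto simp: region_def)
    \<comment> \<open>As first and last letter differ in type, the image can be fed into the word again.\<close>
    have "\<phi> (word_eval w [^] Suc n) z \<notin> region (hd w)" for n
    proof (induction n)
      case 0
      then show ?case using ping_pong_word[OF w(1-3) zr] w by simp
    next
      case (Suc n)
      let ?y = "\<phi> (word_eval w [^] Suc n) z"
      have "?y \<in> E" using w zE by (intro act_closed) auto
      with Suc w(4) have "?y \<in> region (last w)" using region_other by blast
      then have "\<phi> (word_eval w) ?y \<notin> region (hd w)" by (rule ping_pong_word[OF w(1-3)])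
      moreover have "\<phi> (word_eval w) ?y = \<phi> (word_eval w \<otimes> word_eval w [^] Suc n) z"
        using w zE by (intro composition_rule[symmetric]) auto
      ultimately show ?case using w nat_pow_Suc2[of "word_eval w" "Suc n"] by simp
    qed
    then have "\<phi> (word_eval w [^] k) z \<notin> region (hd w)" using k by (metis gr0_implies_Suc)
    then show "word_eval w [^] k \<noteq> \<one>" using zr act_one[OF zE] by force
  qed
qed

text \<open>
  A refinement of \<open>ping_pong_word\<close> for a starting point in \<open>A1\<close>, which is not in \<open>P1\<close>. A final letter
  from \<open>F2\<close> can be applied since \<open>A1\<close> lies in \<open>P2\<close>, and a final letter from \<open>F1\<close> keeps the point in
  \<open>A1\<close>. Every other letter leads out of both \<open>A1\<close> and \<open>A2\<close>: a letter from \<open>F1\<close> leads into the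
  complement of \<open>P1\<close>, which is disjoint from \<open>A2\<close>, and it cannot lead into \<open>A1\<close> from outside,
  because \<open>A1\<close> is invariant; similarly for \<open>F2\<close>.
\<close>

lemma invariant_word:
  assumes A: "A1 \<subseteq> E - P1" "A2 \<subseteq> E - P2"
    and inv: "\<And>f z. f \<in> F1 \<Longrightarrow> z \<in> A1 \<Longrightarrow> \<phi> f z \<in> A1" "\<And>f z. f \<in> F2 \<Longrightarrow> z \<in> A2 \<Longrightarrow> \<phi> f z \<in> A2"
    and z: "z \<in> A1" and w: "w \<in> W" "reduced w" "w \<noteq> []"
  shows "(\<exists>f\<in>F1. w = [Inl f]) \<or> \<phi> (word_eval w) z \<notin> region (hd w) \<union> A1 \<union> A2"
proof -
  have zE: "z \<in> E" using z A by blast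
  have pull: "y \<in> A" if "\<And>f z. f \<in> F \<Longrightarrow> z \<in> A \<Longrightarrow> \<phi> f z \<in> A" "f \<in> F" "\<phi> f y \<in> A" "y \<in> E" "subgroup F K"
    for F A f y
  proof -
    have "inv f \<in> F" "f \<in> carrier K" using that by (auto intro: subgroup.m_inv_closed subgroup.mem_carrier)
    then have "\<phi> (inv f) (\<phi> f y) \<in> A" using that by blast
    moreover have "\<phi> (inv f) (\<phi> f y) = y" using orbit_sym_aux[OF \<open>f \<in> carrier K\<close> \<open>y \<in> E\<close>] by blast
    ultimately show ?thesis by simp
  qed
  note pull1 = pull[OF inv(1) _ _ _ sub1] and pull2 = pull[OF inv(2) _ _ _ sub2]
  have step: "\<phi> (letter a) y \<notin> region a \<union> A1 \<union> A2"
    if a: "a \<in> L" "letter a \<noteq> \<one>" and y: "y \<in> region a" "isl a \<longrightarrow> y \<notin> A1" "\<not> isl a \<longrightarrow> y \<notin> A2" for a y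
  proof -
    have yE: "y \<in> E" using y region_subset by blast
    have 1: "\<phi> (letter a) y \<notin> region a" using move_letter a y by blast
    have 2: "\<phi> (letter a) y \<in> E" using act_closed a yE by simp
    show ?thesis
    proof (cases a)
      case (Inl f)
      then have "\<phi> f y \<notin> A1" using pull1[of f y] a y yE by auto
      moreover have "\<phi> f y \<in> P2" using 1 2 Inl P_cover by (auto simp: region_def)
      ultimately show ?thesis using 1 Inl A by auto
    next
      case (Inr f)
      then have "\<phi> f y \<notin> A2" using pull2[of f y] a y yE by auto
      moreover have "\<phi> f y \<in> P1" using 1 2 Inr P_cover by (auto simp: region_def)
      ultimately show ?thesis using 1 Inr A by auto
    qed
  qed
  have A12: "y \<in> P2 \<and> y \<notin> A2" if "y \<in> A1" for y using that A P_cover by blast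
  show ?thesis using w
  proof (induction w rule: induct_list012)
    case (2 a)
    show ?case
    proof (cases a)
      case (Inl f)
      then show ?thesis using 2 by auto
    next
      case (Inr f)
      then have "\<phi> (letter a) z \<notin> region a \<union> A1 \<union> A2"
        using 2 A12[OF z] by (intro step) (auto simp: region_def reduced_def)
      moreover have "f \<in> carrier K" using 2 Inr subgroup.mem_carrier[OF sub2] by simp
      ultimately show ?thesis using Inr by simp
    qed
  next
    case (3 a b w)
    let ?z = "\<phi> (word_eval (b # w)) z"
    have W: "b # w \<in> W" "a \<in> L" using 3 by auto
    note r = reduced_ConsD[OF \<open>reduced (a # b # w)\<close>]
    have "?z \<in> E" using act_closed[OF eval_closed[OF W(1)] zE] .
    have IH: "(\<exists>f\<in>F1. b # w = [Inl f]) \<or> ?z \<notin> region b \<union> A1 \<union> A2" using 3 r by auto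
    have "\<phi> (letter a) ?z \<notin> region a \<union> A1 \<union> A2"
    proof (rule step)
      show "a \<in> L" "letter a \<noteq> \<one>" using W r by auto
      have "?z \<in> region a \<and> (isl a \<longrightarrow> ?z \<notin> A1) \<and> (\<not> isl a \<longrightarrow> ?z \<notin> A2)"
      proof (cases "\<exists>f\<in>F1. b # w = [Inl f]")
        case True
        then obtain f where f: "f \<in> F1" "b = Inl f" "w = []" by auto
        then have "?z \<in> A1" using inv(1)[OF f(1) z] subgroup.mem_carrier[OF sub1] by simp
        then show ?thesis using A12 r f by (auto simp: region_def)
      next
        case False
        then show ?thesis using IH region_other[OF \<open>?z \<in> E\<close>] r by blast
      qed
      then show "?z \<in> region a" "isl a \<longrightarrow> ?z \<notin> A1" "\<not> isl a \<longrightarrow> ?z \<notin> A2" by auto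
    qed
    then show ?case using act_eval_Cons[OF _ zE, of a "b # w"] 3 by simp
  qed simp
qed

text \<open>
  These are the tubes of the Klein combination theorem: \<open>A1\<close> meets only its translates under \<open>F1\<close>, and
  no translate of \<open>A1\<close> meets \<open>A2\<close>.
\<close>

lemma precisely_invariant:
  assumes A: "A1 \<subseteq> E - P1" "A2 \<subseteq> E - P2"
    and inv: "\<And>f z. f \<in> F1 \<Longrightarrow> z \<in> A1 \<Longrightarrow> \<phi> f z \<in> A1" "\<And>f z. f \<in> F2 \<Longrightarrow> z \<in> A2 \<Longrightarrow> \<phi> f z \<in> A2"
    and g: "g \<in> generate K (F1 \<union> F2)" and z: "z \<in> A1"
  shows "\<phi> g z \<notin> A2" "\<phi> g z \<in> A1 \<Longrightarrow> g \<in> F1"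
proof -
  obtain w where w: "w \<in> W" "reduced w" "g = word_eval w" using generate_reducedE[OF g] .
  have zE: "z \<in> E" "z \<notin> A2" using z A P_cover by blast+
  note iw = invariant_word[OF A inv z w(1,2)]
  have "\<phi> g z \<notin> A2 \<and> (\<phi> g z \<in> A1 \<longrightarrow> g \<in> F1)"
  proof (cases "w = []")
    case True
    then show ?thesis using w zE act_one subgroup.one_closed[OF sub1] by simp
  next
    case False
    show ?thesis
    proof (cases "\<exists>f\<in>F1. w = [Inl f]")
      case True
      then obtain f where f: "f \<in> F1" "w = [Inl f]" by blast
      then have "g = f" using w subgroup.mem_carrier[OF sub1] by simp
      then show ?thesis using inv(1)[OF f(1) z] f(1) A P_cover by blast
    next
      case F: False
      then show ?thesis using iw False w by blast
    qed
  qed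
  then show "\<phi> g z \<notin> A2" "\<phi> g z \<in> A1 \<Longrightarrow> g \<in> F1" by blast+
qed

end

section \<open>Groups of isometries and their quotients\<close>

lemma hyp_isomD:
  assumes "f \<in> carrier hyp_isom"
  shows "f \<in> Bij hyp" "bij_betw f hyp hyp" "f \<in> extensional hyp" "orientation_preserving f"
    and "\<And>x y. x \<in> hyp \<Longrightarrow> y \<in> hyp \<Longrightarrow> hdist (f x) (f y) = hdist x y"
  using assms by (auto simp: hyp_isom_def Bij_def)

lemma hyp_isom_closed: "f \<in> carrier hyp_isom \<Longrightarrow> x \<in> hyp \<Longrightarrow> f x \<in> hyp"
  using hyp_isomD(2) by (auto simp: bij_betw_def)

lemma hyp_isom_cosh_dist:
  assumes "f \<in> carrier hyp_isom" "x \<in> hyp" "y \<in> hyp"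
  shows "cosh_dist (f x) (f y) = cosh_dist x y"
  using assms by (metis cosh_hdist hyp_isomD(5) hyp_isom_closed)

lemma hyp_isom_continuous: "f \<in> carrier hyp_isom \<Longrightarrow> continuous_on hyp f"
  using hyp_isomD(4)[of f] unfolding orientation_preserving_def
  by (auto simp: continuous_on_eq_continuous_at open_hyp intro: has_derivative_continuous)

lemma hyp_isom_mult:
  assumes "f \<in> carrier hyp_isom" "g \<in> carrier hyp_isom"
  shows "f \<otimes>\<^bsub>hyp_isom\<^esub> g = compose hyp f g"
  using hyp_isomD(1)[OF assms(1)] hyp_isomD(1)[OF assms(2)] by (simp add: hyp_isom_def BijGroup_def)

lemma hyp_isom_one: "\<one>\<^bsub>hyp_isom\<^esub> = (\<lambda>x\<in>hyp. x)"
  by (simp add: hyp_isom_def BijGroup_def)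

lemma hyp_isom_action: "group_action hyp_isom hyp (\<lambda>f. f)"
proof (intro group_action.intro group_hom.intro group_hom_axioms.intro)
  show "group hyp_isom" by (rule group_hyp_isom)
  show "group (BijGroup hyp)" by (rule group_BijGroup)
  show "(\<lambda>f. f) \<in> hom hyp_isom (BijGroup hyp)"
  proof (rule homI)
    fix f :: "real^'n \<Rightarrow> real^'n" assume "f \<in> carrier hyp_isom"
    then show "f \<in> carrier (BijGroup hyp)" using hyp_isomD(1) by (simp add: BijGroup_def)
  qed (simp add: hyp_isom_def)
qed

locale isom_group =
  fixes G :: "(real^'n \<Rightarrow> real^'n) set"
  assumes subgroup_G: "subgroup G hyp_isom"
begin

lemma isom: "g \<in> G \<Longrightarrow> g \<in> carrier hyp_isom"
  by (rule subgroup.mem_carrier[OF subgroup_G])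

lemma closed: "g \<in> G \<Longrightarrow> x \<in> hyp \<Longrightarrow> g x \<in> hyp"
  using isom hyp_isom_closed by blast

lemma dist_eq: "g \<in> G \<Longrightarrow> x \<in> hyp \<Longrightarrow> y \<in> hyp \<Longrightarrow> hdist (g x) (g y) = hdist x y"
  using isom hyp_isomD(5) by blast

lemma unit: obtains e where "e \<in> G" "\<And>x. x \<in> hyp \<Longrightarrow> e x = x"
proof
  show "\<one>\<^bsub>hyp_isom\<^esub> \<in> G" using subgroup_G by (rule subgroup.one_closed)
qed (simp add: hyp_isom_one)

lemma product:
  assumes "g \<in> G" "h \<in> G"
  obtains k where "k \<in> G" "\<And>x. x \<in> hyp \<Longrightarrow> k x = g (h x)"
proof
  show "g \<otimes>\<^bsub>hyp_isom\<^esub> h \<in> G" using subgroup_G assms by (rule subgroup.m_closed)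
qed (simp add: hyp_isom_mult isom assms compose_eq)

lemma inverse:
  assumes "g \<in> G"
  obtains k where "k \<in> G" "\<And>x. x \<in> hyp \<Longrightarrow> k (g x) = x" "\<And>x. x \<in> hyp \<Longrightarrow> g (k x) = x"
proof -
  interpret group hyp_isom by (rule group_hyp_isom)
  let ?k = "inv\<^bsub>hyp_isom\<^esub> g"
  have k: "?k \<in> G" using subgroup_G assms by (rule subgroup.m_inv_closed)
  have "?k (g x) = x \<and> g (?k x) = x" if x: "x \<in> hyp" for x
  proof -
    have "compose hyp ?k g = (\<lambda>x\<in>hyp. x)" "compose hyp g ?k = (\<lambda>x\<in>hyp. x)"
      using k assms isom by (simp_all add: hyp_isom_mult[symmetric] hyp_isom_one[symmetric])
    then show ?thesis using x by (metis compose_eq restrict_apply')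
  qed
  with k that show ?thesis by blast
qed

lemma open_image:
  assumes g: "g \<in> G" and S: "open S" "S \<subseteq> hyp"
  shows "open (g ` S)"
proof -
  obtain k where k: "k \<in> G" "\<And>x. x \<in> hyp \<Longrightarrow> k (g x) = x" "\<And>x. x \<in> hyp \<Longrightarrow> g (k x) = x" using inverse[OF g] by blast
  have "g ` S = hyp \<inter> k -` S"
  proof (intro equalityI subsetI)
    fix x assume "x \<in> g ` S"
    then show "x \<in> hyp \<inter> k -` S" using k S closed[OF g] by auto
  next
    fix x assume "x \<in> hyp \<inter> k -` S"
    then show "x \<in> g ` S" using k(3)[of x] by (auto intro: image_eqI[of _ _ "k x"])
  qed
  moreover have "open (hyp \<inter> k -` S)"
    by (rule continuous_open_preimage[OF hyp_isom_continuous[OF isom[OF k(1)]] open_hyp S(1)])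
  ultimately show ?thesis by simp
qed

lemma proj_eq: "proj G x = {g x | g. g \<in> G}"
  by (simp add: orbit_def)

lemma in_proj_self: "x \<in> hyp \<Longrightarrow> x \<in> proj G x"
  using unit unfolding proj_eq by (metis (mono_tags, lifting) mem_Collect_eq)

lemma proj_eqI:
  assumes "g \<in> G" "x \<in> hyp"
  shows "proj G (g x) = proj G x"
proof (intro equalityI subsetI)
  fix y assume "y \<in> proj G (g x)"
  then obtain h where h: "h \<in> G" "y = h (g x)" unfolding proj_eq by blast
  obtain k where "k \<in> G" "\<And>x. x \<in> hyp \<Longrightarrow> k x = h (g x)" using product[OF h(1) assms(1)] by blast
  then have "k \<in> G" "y = k x" using h assms by auto
  then show "y \<in> proj G x" unfolding proj_eq by blast
next
  fix y assume "y \<in> proj G x"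
  then obtain h where h: "h \<in> G" "y = h x" unfolding proj_eq by blast
  obtain g' where g': "g' \<in> G" "g' (g x) = x" using inverse[OF assms(1)] assms(2) by metis
  obtain k where "k \<in> G" "\<And>x. x \<in> hyp \<Longrightarrow> k x = h (g' x)" using product[OF h(1) g'(1)] by blast
  then have "k \<in> G" "y = k (g x)" using h g' closed assms by auto
  then show "y \<in> proj G (g x)" unfolding proj_eq by blast
qed

lemma proj_eq_iff: "x \<in> hyp \<Longrightarrow> y \<in> hyp \<Longrightarrow> proj G x = proj G y \<longleftrightarrow> (\<exists>g\<in>G. y = g x)"
proof
  assume "x \<in> hyp" "y \<in> hyp" "proj G x = proj G y"
  then have "y \<in> proj G x" using in_proj_self[of y] by simp
  then show "\<exists>g\<in>G. y = g x" unfolding proj_eq by blast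
next
  assume "x \<in> hyp" "\<exists>g\<in>G. y = g x"
  then show "proj G x = proj G y" using proj_eqI by auto
qed

text \<open>
  The preimage in \<open>hyp\<close> of the image of \<open>S\<close> in the quotient. Topological statements about the
  quotient are reduced to statements about saturated sets.
\<close>

definition sat :: "(real^'n) set \<Rightarrow> (real^'n) set" where
  "sat S = (\<Union>g\<in>G. g ` S)"

lemma Union_quot: "\<Union>(quot G S) = sat S"
  unfolding orbits_def sat_def proj_eq by blast

lemma sat_subset: "S \<subseteq> hyp \<Longrightarrow> sat S \<subseteq> hyp"
  using closed unfolding sat_def by blast

lemma subset_sat: "S \<subseteq> hyp \<Longrightarrow> S \<subseteq> sat S"
proof
  fix x assume "S \<subseteq> hyp" "x \<in> S"
  then show "x \<in> sat S" using unit unfolding sat_def by (metis UN_iff image_eqI subsetD)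
qed

lemma sat_mono: "S \<subseteq> T \<Longrightarrow> sat S \<subseteq> sat T"
  unfolding sat_def by blast

lemma sat_Un: "sat (S \<union> T) = sat S \<union> sat T"
  unfolding sat_def by blast

lemma open_sat: "open S \<Longrightarrow> S \<subseteq> hyp \<Longrightarrow> open (sat S)"
  unfolding sat_def using open_image by blast

lemma sat_invariant: 
  assumes "S \<subseteq> hyp" "x \<in> hyp" "g \<in> G" 
  shows "g x \<in> sat S \<longleftrightarrow> x \<in> sat S"
proof -
  have 1: "g x \<in> sat S" if gx: "x \<in> sat S" "g \<in> G" for g x
  proof -
    obtain h s where h: "h \<in> G" "s \<in> S" "x = h s" using gx unfolding sat_def by blast
    obtain k where "k \<in> G" "\<And>x. x \<in> hyp \<Longrightarrow> k x = g (h x)" using product[OF gx(2) h(1)] by blast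
    then have "k \<in> G" "g x = k s" using h assms by auto
    then show ?thesis using h unfolding sat_def by blast
  qed
  obtain k where "k \<in> G" "k (g x) = x" using inverse[OF assms(3)] assms(2) by metis
  then show ?thesis using 1[of x g] 1[of "g x" k] assms(3) by auto
qed

lemma proj_in_quot_iff:
  assumes "S \<subseteq> hyp" "x \<in> hyp"
  shows "proj G x \<in> quot G S \<longleftrightarrow> x \<in> sat S"
proof
  assume "proj G x \<in> quot G S"
  then show "x \<in> sat S" using in_proj_self[OF assms(2)] Union_quot by blast
next
  assume "x \<in> sat S"
  then obtain g s where g: "g \<in> G" "s \<in> S" "x = g s" unfolding sat_def by blast
  then have "proj G x = proj G s" using assms proj_eqI by blast
  then show "proj G x \<in> quot G S" using g unfolding orbits_def by blast
qed

lemma quot_sat: "S \<subseteq> hyp \<Longrightarrow> quot G (sat S) = quot G S"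
proof (intro equalityI subsetI)
  assume S: "S \<subseteq> hyp"
  fix p
  { assume "p \<in> quot G (sat S)"
    then obtain x where "x \<in> sat S" "p = proj G x" unfolding orbits_def by blast
    then show "p \<in> quot G S" using proj_in_quot_iff[OF S] sat_subset[OF S] by blast
  next
    assume "p \<in> quot G S"
    then show "p \<in> quot G (sat S)" using subset_sat[OF S] unfolding orbits_def by blast
  }
qed

lemma quot_Diff:
  assumes "S \<subseteq> hyp" "T \<subseteq> hyp"
  shows "quot G S - quot G T = quot G (sat S - sat T)"
proof (intro equalityI subsetI)
  fix p assume "p \<in> quot G S - quot G T"
  then obtain x where x: "x \<in> S" "p = proj G x" "p \<notin> quot G T" unfolding orbits_def by blast
  then have "x \<in> sat S - sat T" using assms subset_sat proj_in_quot_iff[OF assms(2), of x] by blast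
  then show "p \<in> quot G (sat S - sat T)" using x unfolding orbits_def by blast
next
  fix p assume "p \<in> quot G (sat S - sat T)"
  then obtain x where x: "x \<in> sat S" "x \<notin> sat T" "p = proj G x" unfolding orbits_def by blast
  then have "x \<in> hyp" using sat_subset assms by blast
  then show "p \<in> quot G S - quot G T" using x proj_in_quot_iff assms by blast
qed

lemma sat_hyp: "sat hyp = hyp"
  using sat_subset subset_sat by blast

lemma quot_mono: "S \<subseteq> T \<Longrightarrow> quot G S \<subseteq> quot G T"
  unfolding orbits_def by blast

lemma topspace_quot [simp]: "topspace (quot_topology F S) = quot F S"
proof -
  have "{x \<in> S. proj F x \<in> quot F S} = S" by (auto simp: orbits_def)
  then have "openin (quot_topology F S) (quot F S)" by (simp add: openin_quot_topology)
  then have "quot F S \<subseteq> topspace (quot_topology F S)" by (rule openin_subset)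
  moreover have "topspace (quot_topology F S) \<subseteq> quot F S"
    using openin_topspace[of "quot_topology F S"] unfolding openin_quot_topology by blast
  ultimately show ?thesis by blast
qed

abbreviation "N \<equiv> quot_topology G hyp"

lemma openin_N: "openin N V \<longleftrightarrow> V \<subseteq> quot G hyp \<and> open {x \<in> hyp. proj G x \<in> V}"
  by (auto simp: openin_quot_topology openin_open_eq[OF open_hyp])

lemma openin_quot: 
  assumes "S \<subseteq> hyp" "open (sat S)"
  shows "openin N (quot G S)"
proof -
  have "{x \<in> hyp. proj G x \<in> quot G S} = sat S"
    using proj_in_quot_iff[OF assms(1)] sat_subset[OF assms(1)] by blast
  then show ?thesis using assms quot_mono by (auto simp: openin_N)
qed

lemma closedin_quot:
  assumes "S \<subseteq> hyp" "open (hyp - sat S)"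
  shows "closedin N (quot G S)"
proof -
  have eq: "sat (hyp - sat S) = hyp - sat S"
  proof -
    have "sat (hyp - sat S) \<subseteq> hyp - sat S"
      using sat_invariant[OF assms(1)] closed unfolding sat_def[of "hyp - sat S"] by blast
    then show ?thesis using subset_sat[of "hyp - sat S"] by blast
  qed
  have "quot G hyp - quot G S = quot G (hyp - sat S)"
    using quot_Diff[OF subset_refl assms(1)] sat_hyp by simp
  moreover have "openin N (quot G (hyp - sat S))"
    by (rule openin_quot) (use eq assms in auto)
  ultimately show ?thesis unfolding closedin_def using quot_mono[OF assms(1)] by simp
qed

lemma continuous_map_proj: "continuous_map (top_of_set hyp) N (proj G)"
  unfolding continuous_map by (auto simp: openin_N openin_open_eq[OF open_hyp] orbits_def)

lemma connectedin_quot: "S \<subseteq> hyp \<Longrightarrow> connected S \<Longrightarrow> connectedin N (quot G S)"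
proof -
  assume S: "S \<subseteq> hyp" "connected S"
  then have "connectedin (top_of_set hyp) S" by (simp add: connectedin_subtopology)
  then have "connectedin N (proj G ` S)" using connectedin_continuous_map_image continuous_map_proj by blast
  moreover have "proj G ` S = quot G S" unfolding orbits_def by blast
  ultimately show ?thesis by simp
qed

lemma isometry_image_half_space:
  "g \<in> G \<Longrightarrow> half_space_of X U \<Longrightarrow> half_space_of (g ` X) (g ` U)"
  using isom hyp_isom_cosh_dist hyp_isomD(2) by (intro half_space_of_isometry_image) blast+

end

section \<open>Tubes around a hyperplane\<close>

text \<open>
  An open set \<open>A\<close> that is invariant under \<open>F\<close> and disjoint from its other translates under \<open>G\<close>. For
  invariant subsets of \<open>A\<close>, the quotients by \<open>F\<close> and by \<open>G\<close> agree near \<open>A\<close>.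
\<close>

locale precisely_invariant = isom_group G for G :: "(real^'n \<Rightarrow> real^'n) set" +
  fixes F A
  assumes subgroup_F: "subgroup F hyp_isom" and F_sub_G: "F \<subseteq> G"
    and A: "open A" "A \<subseteq> hyp"
    and F_A: "f \<in> F \<Longrightarrow> x \<in> A \<Longrightarrow> f x \<in> A"
    and precise: "g \<in> G \<Longrightarrow> x \<in> A \<Longrightarrow> g x \<in> A \<Longrightarrow> g \<in> F"
begin

sublocale F: isom_group F
  by (rule isom_group.intro) (rule subgroup_F)

lemma translates_agree:
  assumes "g \<in> G" "h \<in> G" "x \<in> A" "y \<in> A" "g x = h y"
  obtains f where "f \<in> F" "y = f x"
proof -
  obtain k where k: "k \<in> G" "\<And>x. x \<in> hyp \<Longrightarrow> k (h x) = x" "\<And>x. x \<in> hyp \<Longrightarrow> h (k x) = x" using inverse[OF assms(2)] by blast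
  obtain l where l: "l \<in> G" "\<And>x. x \<in> hyp \<Longrightarrow> l x = k (g x)" using product[OF k(1) assms(1)] by blast
  have "x \<in> hyp" "y \<in> hyp" using assms A by auto
  then have "l x = y" using l(2) k(2) assms(5) by simp
  then show ?thesis using precise[OF l(1)] that assms by blast
qed

text \<open>
  Inside one translate of \<open>A\<close>, only the corresponding translate of \<open>S\<close> is seen of the preimage of the
  quotient of \<open>S\<close>.
\<close>

lemma sat_local:
  assumes S: "S \<subseteq> A" "\<forall>f\<in>F. f ` S \<subseteq> S" and g: "g \<in> G"
  shows "sat S \<inter> g ` A = g ` S"
proof (intro equalityI subsetI)
  fix z assume "z \<in> sat S \<inter> g ` A"
  then obtain h s a where h: "h \<in> G" "s \<in> S" "a \<in> A" "z = h s" "z = g a" unfolding sat_def by blast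
  have "s \<in> A" using h S by blast
  obtain f where "f \<in> F" "a = f s"
    by (rule translates_agree[OF h(1) g \<open>s \<in> A\<close> h(3)]) (use h(4,5) in auto)
  then show "z \<in> g ` S" using S h by blast
qed (use S g in \<open>auto simp: sat_def\<close>)

lemma proj_F_eqI:
  assumes "x \<in> A" "y \<in> A" "proj G x = proj G y"
  shows "proj F x = proj F y"
proof -
  obtain g where g: "g \<in> G" "y = g x" using proj_eq_iff assms A by blast
  then have "g \<in> F" using precise assms by blast
  then show ?thesis using g F.proj_eqI[of g x] assms A by auto
qed

lemma nat_map_proj: "x \<in> hyp \<Longrightarrow> nat_map G (proj F x) = proj G x"
proof -
  assume x: "x \<in> hyp"
  have "proj G y = proj G x" if "y \<in> proj F x" for y
    using that proj_eqI[OF _ x] F_sub_G unfolding F.proj_eq by blast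
  then show ?thesis using F.in_proj_self[OF x] unfolding nat_map_def by blast
qed

text \<open>
  Injectivity, openness onto the image and equality of the stabilizers all come from the fact that
  an element of \<open>G\<close> which carries a point of \<open>A\<close> into \<open>A\<close> belongs to \<open>F\<close>. For openness, an open subset of
  \<open>S/F\<close> is cut out by an open set, which has to be shrunk into \<open>A\<close> first.
\<close>

lemma quot_embeds:
  assumes S: "S \<subseteq> A" "\<forall>f\<in>F. f ` S \<subseteq> S"
  shows "quot_embeds F S G"
proof -
  have Sh: "S \<subseteq> hyp" using S A by blast
  have im: "nat_map G ` quot F S = quot G S"
    unfolding orbits_def using nat_map_proj Sh by (auto simp: image_iff)
  have "homeomorphic_map (quot_topology F S) (subtopology N (quot G S)) (nat_map G)"
  proof (rule bijective_open_imp_homeomorphic_map)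
    show "inj_on (nat_map G) (topspace (quot_topology F S))"
    proof (rule inj_onI)
      fix p q assume "p \<in> topspace (quot_topology F S)" "q \<in> topspace (quot_topology F S)"
        and eq: "nat_map G p = nat_map G q"
      then obtain x y where xy: "x \<in> S" "p = proj F x" "y \<in> S" "q = proj F y" unfolding topspace_quot orbits_def by blast
      moreover have "x \<in> hyp" "y \<in> hyp" using xy Sh by auto
      ultimately have "proj G x = proj G y" using eq by (simp add: nat_map_proj)
      then show "p = q" using proj_F_eqI xy S(1) by blast
    qed
    show "nat_map G ` topspace (quot_topology F S) = topspace (subtopology N (quot G S))"
      using im quot_mono[OF Sh] by (auto simp: topspace_subtopology)
    show "continuous_map (quot_topology F S) (subtopology N (quot G S)) (nat_map G)"
      unfolding continuous_map_in_subtopology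
    proof
      show "nat_map G \<in> topspace (quot_topology F S) \<rightarrow> quot G S" using im by auto
      show "continuous_map (quot_topology F S) N (nat_map G)"
        unfolding continuous_map
      proof (intro conjI allI impI)
        show "nat_map G ` topspace (quot_topology F S) \<subseteq> topspace N"
          using im quot_mono[OF Sh] by simp
        fix V assume "openin N V"
        then have V: "open {x \<in> hyp. proj G x \<in> V}" by (simp add: openin_N)
        have "{x \<in> S. proj F x \<in> {p \<in> topspace (quot_topology F S). nat_map G p \<in> V}} = S \<inter> {x \<in> hyp. proj G x \<in> V}"
          using nat_map_proj Sh unfolding topspace_quot orbits_def by (auto simp: subset_iff)
        then show "openin (quot_topology F S) {p \<in> topspace (quot_topology F S). nat_map G p \<in> V}"
          unfolding openin_quot_topology using V by (auto simp: openin_open)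
      qed
    qed
    show "open_map (quot_topology F S) (subtopology N (quot G S)) (nat_map G)"
      unfolding open_map_def
    proof (intro allI impI)
      fix V assume "openin (quot_topology F S) V"
      then have V: "V \<subseteq> quot F S" "openin (top_of_set S) {x \<in> S. proj F x \<in> V}" by (auto simp: openin_quot_topology)
      then obtain T where T: "open T" "{x \<in> S. proj F x \<in> V} = S \<inter> T" unfolding openin_open by blast
      let ?O = "T \<inter> A"
      have O: "open ?O" "?O \<subseteq> hyp" using T A by auto
      have op: "openin N (quot G ?O)" using openin_quot[OF O(2) open_sat[OF O]] .
      have "nat_map G ` V = quot G ?O \<inter> quot G S"
      proof (intro equalityI subsetI)
        fix p assume "p \<in> nat_map G ` V"
        then obtain x where x: "x \<in> S" "proj F x \<in> V" "p = nat_map G (proj F x)" using V(1) unfolding orbits_def by blast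
        then have "p = proj G x" "x \<in> ?O" using nat_map_proj Sh T S by auto
        then show "p \<in> quot G ?O \<inter> quot G S" using x unfolding orbits_def by blast
      next
        fix p assume "p \<in> quot G ?O \<inter> quot G S"
        then obtain x y where xy: "x \<in> ?O" "p = proj G x" "y \<in> S" "p = proj G y" unfolding orbits_def by blast
        then obtain g where g: "g \<in> G" "x = g y" using proj_eq_iff[of y x] Sh O by auto
        have "y \<in> A" using xy S by blast
        then have gF: "g \<in> F" using precise g xy by blast
        then have "x \<in> S" using S g xy by blast
        then have "proj F x \<in> V" using T(2) xy by blast
        moreover have "p = nat_map G (proj F x)" using nat_map_proj xy O by auto
        ultimately show "p \<in> nat_map G ` V" by blast
      qed
      then show "openin (subtopology N (quot G S)) (nat_map G ` V)"
        using op by (auto simp: openin_subtopology)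
    qed
  qed
  moreover have "stabilizer (isom_subgroup F) (\<lambda>f. f) x = stabilizer (isom_subgroup G) (\<lambda>f. f) x" if "x \<in> S" for x
    unfolding stabilizer_def using precise[of _ x] that S F_sub_G by auto
  ultimately show ?thesis
    unfolding quot_embeds_def embedding_map_def topspace_quot im by blast
qed

end

text \<open>
  The set \<open>A\<close> contains the \<open>\<delta>\<close>-neighbourhood of the closed half-space \<open>X \<union> H\<close>. The uniform width is
  what makes the translates of the closed half-space a locally finite family.
\<close>

locale half_space_tube = precisely_invariant G F A for G :: "(real^'n \<Rightarrow> real^'n) set" and F A +
  fixes X H and \<delta> :: real
  assumes half_space: "half_space_of X H"
    and F_X: "f \<in> F \<Longrightarrow> x \<in> X \<Longrightarrow> f x \<in> X" and F_H: "f \<in> F \<Longrightarrow> x \<in> H \<Longrightarrow> f x \<in> H"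
    and delta_pos: "\<delta> > 0"
    and near: "x \<in> hyp \<Longrightarrow> y \<in> X \<union> H \<Longrightarrow> hdist x y < \<delta> \<Longrightarrow> x \<in> A"
begin

lemma XH_hyp: "X \<subseteq> hyp" "H \<subseteq> hyp" "X \<union> H \<subseteq> hyp" "X \<inter> H = {}"
  using half_space_subset_hyp[OF half_space] by auto

lemma XH_A: "X \<union> H \<subseteq> A" "X \<subseteq> A" "H \<subseteq> A"
proof -
  show "X \<union> H \<subseteq> A" using near hdist_self delta_pos XH_hyp by (metis subsetD subsetI)
  then show "X \<subseteq> A" "H \<subseteq> A" by auto
qed

lemma F_XH_image: "\<forall>f\<in>F. f ` (X \<union> H) \<subseteq> X \<union> H"
  and F_X_image: "\<forall>f\<in>F. f ` X \<subseteq> X" and F_H_image: "\<forall>f\<in>F. f ` H \<subseteq> H"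
  using F_X F_H by blast+

lemma quot_embeds_X: "quot_embeds F X G" and quot_embeds_H: "quot_embeds F H G"
  using quot_embeds[OF XH_A(2) F_X_image] quot_embeds[OF XH_A(3) F_H_image] by auto

lemma tube_around:
  assumes "x \<in> sat X"
  obtains g \<epsilon> where "g \<in> G" "x \<in> g ` X" "\<epsilon> > 0" "hball x \<epsilon> \<subseteq> g ` A"
proof -
  obtain g where g: "g \<in> G" "x \<in> g ` X" using assms unfolding sat_def by blast
  then have "x \<in> g ` A" using XH_A by blast
  moreover have "x \<in> hyp" using g XH_hyp closed by auto
  ultimately obtain \<epsilon> where "\<epsilon> > 0" "hball x \<epsilon> \<subseteq> g ` A"
    using hball_subset_open[OF open_image[OF g(1) A]] by blast
  with g that show ?thesis by blast
qed

lemma totally_geodesic: "totally_geodesic_hypersurface (quot G X)"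
  unfolding totally_geodesic_hypersurface_def Union_quot
proof
  fix x assume "x \<in> sat X"
  then obtain g \<epsilon> where g: "g \<in> G" "x \<in> g ` X" "\<epsilon> > 0" "hball x \<epsilon> \<subseteq> g ` A" by (rule tube_around)
  have "sat X \<inter> g ` A = g ` X" using sat_local[OF XH_A(2) F_X_image g(1)] .
  then have "sat X \<inter> hball x \<epsilon> = g ` X \<inter> hball x \<epsilon>" using g(4) by blast
  moreover have "hyperplane (g ` X)"
    using isometry_image_half_space[OF g(1) half_space] by (rule half_space_of_imp_hyperplane)
  ultimately show "\<exists>Y \<epsilon>. hyperplane Y \<and> x \<in> Y \<and> \<epsilon> > 0 \<and> sat X \<inter> hball x \<epsilon> = Y \<inter> hball x \<epsilon>"
    using g by blast
qed

text \<open>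
  A point in some translate of \<open>A\<close> sees at most one translate of the closed half-space. A point
  outside all of them is at distance at least \<open>\<delta>\<close> from every translate of the half-space.
\<close>

lemma open_compl_sat_closed_half_space: "open (hyp - sat (X \<union> H))"
  unfolding open_subopen[of "hyp - sat (X \<union> H)"]
proof
  fix x assume x: "x \<in> hyp - sat (X \<union> H)"
  show "\<exists>T. open T \<and> x \<in> T \<and> T \<subseteq> hyp - sat (X \<union> H)"
  proof (cases "x \<in> sat A")
    case True
    then obtain g where g: "g \<in> G" "x \<in> g ` A" unfolding sat_def by blast
    let ?T = "g ` (A - (X \<union> H))"
    have "A - (X \<union> H) = A \<inter> (hyp - (X \<union> H))" using A by blast
    then have "open (A - (X \<union> H))" using A open_half_space_compl[OF half_space] by auto
    then have "open ?T" using open_image[OF g(1)] A by blast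
    have loc: "sat (X \<union> H) \<inter> g ` A = g ` (X \<union> H)" using sat_local[OF XH_A(1) F_XH_image g(1)] .
    have inj: "inj_on g hyp" using hyp_isomD(2)[OF isom[OF g(1)]] by (simp add: bij_betw_def)
    have im: "?T = g ` A - g ` (X \<union> H)"
      using inj_on_image_set_diff[OF inj, of A "X \<union> H"] A XH_hyp by blast
    have "x \<in> ?T" unfolding im using g loc x by blast
    moreover have "?T \<subseteq> hyp - sat (X \<union> H)" 
    proof -
      have "g ` A \<subseteq> hyp" using A closed[OF g(1)] by blast
      then show ?thesis unfolding im using loc by blast
    qed
    ultimately show ?thesis using \<open>open ?T\<close> by blast
  next
    case False
    have xh: "x \<in> hyp" using x by blast
    have "hball x \<delta> \<subseteq> hyp - sat (X \<union> H)"
    proof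
      fix y assume y: "y \<in> hball x \<delta>"
      have "y \<notin> sat (X \<union> H)"
      proof
        assume "y \<in> sat (X \<union> H)"
        then obtain g c where g: "g \<in> G" "c \<in> X \<union> H" "y = g c" unfolding sat_def by blast
        obtain k where k: "k \<in> G" "\<And>x. x \<in> hyp \<Longrightarrow> k (g x) = x" "\<And>x. x \<in> hyp \<Longrightarrow> g (k x) = x" using inverse[OF g(1)] by blast
        have "c \<in> hyp" using g XH_hyp by blast
        then have "hdist (k x) c = hdist x y"
          using dist_eq[OF g(1) closed[OF k(1) xh], of c] k g xh by simp
        then have "k x \<in> A" using near[OF closed[OF k(1) xh] g(2)] y by (simp add: hball_def)
        then have "g (k x) \<in> sat A" using g(1) unfolding sat_def by blast
        then have "x \<in> sat A" using k(3)[OF xh] by simp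
        with False show False by blast
      qed
      then show "y \<in> hyp - sat (X \<union> H)" using y by (simp add: hball_def)
    qed
    then show ?thesis using open_hball[OF xh] centre_in_hball[OF xh delta_pos] by blast
  qed
qed

lemma sat_X_H_disjoint: "sat X \<inter> sat H = {}"
proof -
  have "z \<notin> sat H" if z: "z \<in> sat X" for z
  proof
    obtain g where g: "g \<in> G" "z \<in> g ` X" using z unfolding sat_def by blast
    assume "z \<in> sat H"
    moreover have "z \<in> g ` A" using g XH_A by blast
    ultimately have "z \<in> g ` H" using sat_local[OF XH_A(3) F_H_image g(1)] by blast
    then obtain x h where "x \<in> X" "h \<in> H" "g x = g h" using g by auto
    moreover have "inj_on g hyp" using hyp_isomD(2)[OF isom[OF g(1)]] by (simp add: bij_betw_def)
    ultimately show False using XH_hyp unfolding inj_on_def by blast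
  qed
  then show ?thesis by blast
qed

lemma openin_quot_H: "openin N (quot G H)"
  using openin_quot[OF XH_hyp(2) open_sat[OF open_half_space[OF half_space] XH_hyp(2)]] .

lemma closedin_quot_XH: "closedin N (quot G (X \<union> H))"
  using closedin_quot[OF XH_hyp(3) open_compl_sat_closed_half_space] .

text \<open>
  The closed half-spaces have a closed image, and every neighbourhood of a point of \<open>X\<close> meets \<open>H\<close>. So
  the closure adds exactly the image of \<open>X\<close>, which is disjoint from that of \<open>H\<close> by \<open>sat_X_H_disjoint\<close>.
\<close>

lemma frontier_quot_H: "N frontier_of quot G H = quot G X"
proof -
  have "N closure_of quot G H = quot G (X \<union> H)"
  proof (intro equalityI)
    show "N closure_of quot G H \<subseteq> quot G (X \<union> H)"
      by (rule closure_of_minimal[OF quot_mono closedin_quot_XH]) blast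
    show "quot G (X \<union> H) \<subseteq> N closure_of quot G H"
    proof
      fix p assume "p \<in> quot G (X \<union> H)"
      then obtain x where x: "x \<in> X \<union> H" "p = proj G x" unfolding orbits_def by blast
      show "p \<in> N closure_of quot G H"
      proof (cases "x \<in> H")
        case True
        then have "p \<in> quot G H" using x unfolding orbits_def by blast
        then show ?thesis using closure_of_subset[of "quot G H" N] quot_mono[OF XH_hyp(2)] by auto
      next
        case False
        then have xX: "x \<in> X" using x by blast
        show ?thesis unfolding closure_of_def
        proof (intro CollectI conjI allI impI)
          show "p \<in> topspace N" using x XH_hyp unfolding topspace_quot orbits_def by blast
          fix T assume T: "p \<in> T \<and> openin N T"
          then have "open {x \<in> hyp. proj G x \<in> T}" "x \<in> {x \<in> hyp. proj G x \<in> T}"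
            using x XH_hyp by (auto simp: openin_N)
          then have "{x \<in> hyp. proj G x \<in> T} \<inter> H \<noteq> {}" using half_space_boundary[OF half_space xX] by blast
          then show "\<exists>y\<in>quot G H. y \<in> T" unfolding orbits_def by blast
        qed
      qed
    qed
  qed
  moreover have "N interior_of quot G H = quot G H" using openin_quot_H by (rule interior_of_openin)
  moreover have "quot G (X \<union> H) - quot G H = quot G X"
  proof -
    have "quot G (X \<union> H) - quot G H = quot G (sat (X \<union> H) - sat H)" 
      using quot_Diff XH_hyp by blast
    also have "sat (X \<union> H) - sat H = sat X" using sat_X_H_disjoint unfolding sat_Un by blast
    also have "quot G (sat X) = quot G X" using quot_sat XH_hyp by blast
    finally show ?thesis .
  qed
  ultimately show ?thesis unfolding frontier_of_def by simp
qed

text \<open>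
  The assumption says that within the translates of \<open>A\<close> the set \<open>M\<close> arises by removing the translates
  of \<open>H\<close> and nothing else.
\<close>

lemma geodesic_boundary_pointI:
  assumes x: "x \<in> sat X" and M: "\<Union>M \<inter> sat A = sat A - sat H"
  shows "geodesic_boundary_point M x"
proof -
  obtain g \<epsilon> where g: "g \<in> G" "x \<in> g ` X" "\<epsilon> > 0" "hball x \<epsilon> \<subseteq> g ` A" using tube_around[OF x] .
  have loc: "sat H \<inter> g ` A = g ` H" using sat_local[OF XH_A(3) F_H_image g(1)] .
  have "g ` A \<subseteq> sat A" using g(1) unfolding sat_def by blast
  then have "hball x \<epsilon> \<subseteq> sat A" using g(4) by blast
  then have "\<Union>M \<inter> hball x \<epsilon> = hball x \<epsilon> - sat H" using M by blast
  also have "\<dots> = hball x \<epsilon> - g ` H" using loc g(4) by blast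
  finally have "\<Union>M \<inter> hball x \<epsilon> = hball x \<epsilon> - g ` H" .
  then show ?thesis
    unfolding geodesic_boundary_point_def
    using isometry_image_half_space[OF g(1) half_space] g(2,3)
    by (intro exI[of _ "g ` X"] exI[of _ "g ` H"] exI[of _ \<epsilon>] conjI)
qed

end

section \<open>Two disjoint tubes\<close>

lemma clopen_connected_component:
  assumes "connectedin T C" "openin T C" "closedin T C" "C \<noteq> {}"
  shows "C \<in> connected_components_of T"
proof -
  obtain x where x: "x \<in> C" using assms by blast
  let ?D = "connected_component_of_set T x"
  have "x \<in> topspace T" using x assms(2) openin_subset by blast
  then have D: "?D \<in> connected_components_of T" by (simp add: connected_component_in_connected_components_of)
  have "C \<subseteq> ?D" using connected_component_of_maximal[OF assms(1) x] .
  moreover have "?D \<subseteq> C \<or> disjnt ?D C"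
    using connectedin_clopen_cases[OF connectedin_connected_component_of assms(3,2)] .
  ultimately have "?D = C" using x by (auto simp: disjnt_def)
  with D show ?thesis by simp
qed

locale two_tubes =
  T1: half_space_tube G F1 A1 X1 H1 d1 + T2: half_space_tube G F2 A2 X2 H2 d2
  for G :: "(real^'n \<Rightarrow> real^'n) set" and F1 A1 X1 H1 d1 F2 A2 X2 H2 d2 +
  assumes tubes_disjoint: "g \<in> G \<Longrightarrow> x \<in> A1 \<Longrightarrow> g x \<notin> A2"
    and nonempty: "X1 \<noteq> {}" "X2 \<noteq> {}"
begin

lemma sat_disjoint: "T1.sat A1 \<inter> T1.sat A2 = {}"
proof -
  have False if z: "z \<in> T1.sat A1" "z \<in> T1.sat A2" for z
  proof -
    obtain g h x y where g: "g \<in> G" "x \<in> A1" "z = g x" and h: "h \<in> G" "y \<in> A2" "z = h y"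
      using z unfolding T1.sat_def by blast
    obtain k where k: "k \<in> G" "\<And>x. x \<in> hyp \<Longrightarrow> k (h x) = x" "\<And>x. x \<in> hyp \<Longrightarrow> h (k x) = x" using T1.inverse[OF h(1)] by blast
    obtain l where l: "l \<in> G" "\<And>x. x \<in> hyp \<Longrightarrow> l x = k (g x)" using T1.product[OF k(1) g(1)] by blast
    have "x \<in> hyp" "y \<in> hyp" using g h T1.A T2.A by auto
    moreover have "g x = h y" using g h by simp
    ultimately have "l x = y" using l(2) k(2) by simp
    then show False using tubes_disjoint[OF l(1) g(2)] h by blast
  qed
  then show ?thesis by blast
qed

lemma swap: "two_tubes G F2 A2 X2 H2 d2 F1 A1 X1 H1 d1"
proof (intro two_tubes.intro two_tubes_axioms.intro)
  show "half_space_tube G F2 A2 X2 H2 d2" "half_space_tube G F1 A1 X1 H1 d1"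
    by (fact T2.half_space_tube_axioms T1.half_space_tube_axioms)+
  show "g x \<notin> A1" if gx: "g \<in> G" "x \<in> A2" for g x
  proof
    assume "g x \<in> A1"
    moreover have xh: "x \<in> hyp" using gx T2.A by blast
    obtain k where "k \<in> G" "k (g x) = x" using T1.inverse[OF gx(1)] xh by metis
    ultimately show False using tubes_disjoint gx(2) by metis
  qed
qed (fact nonempty)+

text \<open>
  The orbifold that remains when both half-space quotients are cut off.
\<close>

abbreviation "M \<equiv> quot G hyp - quot G H1 - quot G H2"

lemma M_swap: "quot G hyp - quot G H2 - quot G H1 = M"
  by blast

lemma Union_M: "\<Union>M = hyp - T1.sat H1 - T1.sat H2"
proof (intro equalityI subsetI)
  fix z assume "z \<in> \<Union>M"
  then obtain x where x: "x \<in> hyp" "z \<in> proj G x" "proj G x \<notin> quot G H1" "proj G x \<notin> quot G H2"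
    unfolding orbits_def by blast
  then obtain g where g: "g \<in> G" "z = g x" unfolding T1.proj_eq by blast
  have zh: "z \<in> hyp" using g x T1.closed by blast
  have "proj G z = proj G x" using g x T1.proj_eqI by blast
  then show "z \<in> hyp - T1.sat H1 - T1.sat H2"
    using x zh T1.proj_in_quot_iff[of H1 z] T1.proj_in_quot_iff[of H2 z] T1.XH_hyp T2.XH_hyp by auto
next
  fix z assume z: "z \<in> hyp - T1.sat H1 - T1.sat H2"
  then have "proj G z \<in> M"
    using T1.proj_in_quot_iff[of H1 z] T1.proj_in_quot_iff[of H2 z] T1.XH_hyp T2.XH_hyp
    by (auto simp: orbits_def)
  then show "z \<in> \<Union>M" using T1.in_proj_self z by blast
qed

lemma geodesic_boundary_point_X1: "x \<in> T1.sat X1 \<Longrightarrow> geodesic_boundary_point M x"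
proof (rule T1.geodesic_boundary_pointI)
  have "T1.sat H2 \<subseteq> T1.sat A2" using T1.sat_mono T2.XH_A by blast
  then show "\<Union>M \<inter> T1.sat A1 = T1.sat A1 - T1.sat H1"
    unfolding Union_M using sat_disjoint T1.sat_subset[OF T1.A(2)] by blast
qed

lemma geodesic_boundary_point_X2: "x \<in> T1.sat X2 \<Longrightarrow> geodesic_boundary_point M x"
  using two_tubes.geodesic_boundary_point_X1[OF swap, of x] by (simp only: M_swap)

text \<open>
  A geodesic boundary point belongs to the preimage of \<open>M\<close> but is approached from its complement,
  which consists of the translates of \<open>H1\<close> and \<open>H2\<close>. So it lies on the boundary of one of them.
\<close>

lemma geodesic_boundary_point_iff:
  assumes x: "x \<in> hyp"
  shows "geodesic_boundary_point M x \<longleftrightarrow> x \<in> T1.sat X1 \<union> T1.sat X2"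
proof
  assume "geodesic_boundary_point M x"
  then obtain Y U \<epsilon> where Y: "half_space_of Y U" "x \<in> Y" "\<epsilon> > 0" "\<Union>M \<inter> hball x \<epsilon> = hball x \<epsilon> - U"
    unfolding geodesic_boundary_point_def by blast
  have "x \<in> \<Union>M" using Y centre_in_hball[OF x Y(3)] half_space_subset_hyp[OF Y(1)] by blast
  then have n: "x \<notin> T1.sat H1" "x \<notin> T1.sat H2" unfolding Union_M by auto
  show "x \<in> T1.sat X1 \<union> T1.sat X2"
  proof (rule ccontr)
    assume "x \<notin> T1.sat X1 \<union> T1.sat X2"
    then have "x \<in> (hyp - T1.sat (X1 \<union> H1)) \<inter> (hyp - T1.sat (X2 \<union> H2))" using n x unfolding T1.sat_Un by blast
    moreover have "open ((hyp - T1.sat (X1 \<union> H1)) \<inter> (hyp - T1.sat (X2 \<union> H2)) \<inter> hball x \<epsilon>)"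
      using T1.open_compl_sat_closed_half_space T2.open_compl_sat_closed_half_space open_hball[OF x] by blast
    ultimately have "(hyp - T1.sat (X1 \<union> H1)) \<inter> (hyp - T1.sat (X2 \<union> H2)) \<inter> hball x \<epsilon> \<inter> U \<noteq> {}"
      using half_space_boundary[OF Y(1,2)] centre_in_hball[OF x Y(3)] by blast
    then obtain u where "u \<in> U" "u \<in> hball x \<epsilon>" "u \<in> hyp" "u \<notin> T1.sat H1" "u \<notin> T1.sat H2" unfolding T1.sat_Un by blast
    then have "u \<in> \<Union>M \<inter> hball x \<epsilon>" unfolding Union_M by blast
    then show False using Y(4) \<open>u \<in> U\<close> by blast
  qed
next
  assume "x \<in> T1.sat X1 \<union> T1.sat X2"
  then show "geodesic_boundary_point M x" using geodesic_boundary_point_X1 geodesic_boundary_point_X2 by blast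
qed

lemma geodesic_boundary_eq: "geodesic_boundary G M = quot G X1 \<union> quot G X2"
proof -
  have "geodesic_boundary G M = quot G (T1.sat X1 \<union> T1.sat X2)"
  proof -
    have "x \<in> hyp \<and> geodesic_boundary_point M x \<longleftrightarrow> x \<in> T1.sat X1 \<union> T1.sat X2" for x
      using geodesic_boundary_point_iff T1.sat_subset[OF T1.XH_hyp(1)] T1.sat_subset[OF T2.XH_hyp(1)] by blast
    then have "geodesic_boundary G M = {proj G x |x. x \<in> T1.sat X1 \<union> T1.sat X2}"
      unfolding geodesic_boundary_def by presburger
    then show ?thesis unfolding orbits_def by blast
  qed
  also have "\<dots> = quot G (T1.sat (X1 \<union> X2))" unfolding T1.sat_Un ..
  also have "\<dots> = quot G (X1 \<union> X2)" using T1.quot_sat T1.XH_hyp T2.XH_hyp by simp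
  finally show ?thesis by (auto simp: orbits_def)
qed

lemma has_geodesic_boundary: "has_geodesic_boundary M"
  unfolding has_geodesic_boundary_def
proof
  fix x assume x: "x \<in> \<Union>M"
  then have xh: "x \<in> hyp" unfolding Union_M by blast
  show "(\<exists>\<epsilon>>0. hball x \<epsilon> \<subseteq> \<Union>M) \<or> geodesic_boundary_point M x"
  proof (cases "x \<in> T1.sat X1 \<union> T1.sat X2")
    case True
    then show ?thesis using geodesic_boundary_point_iff[OF xh] by blast
  next
    case False
    let ?T = "(hyp - T1.sat (X1 \<union> H1)) \<inter> (hyp - T1.sat (X2 \<union> H2))"
    have "x \<in> ?T" using x False unfolding Union_M T1.sat_Un by blast
    moreover have "open ?T"
      using T1.open_compl_sat_closed_half_space T2.open_compl_sat_closed_half_space by blast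
    ultimately obtain \<epsilon> where "\<epsilon> > 0" "hball x \<epsilon> \<subseteq> ?T" using hball_subset_open xh by blast
    moreover have "?T \<subseteq> \<Union>M" unfolding Union_M T1.sat_Un by blast
    ultimately show ?thesis by blast
  qed
qed

lemma quot_disjoint:
  "quot G A1 \<inter> quot G A2 = {}" "quot G X1 \<inter> quot G X2 = {}" "quot G H1 \<inter> quot G H2 = {}"
proof -
  show 1: "quot G A1 \<inter> quot G A2 = {}"
  proof -
    have False if p: "p \<in> quot G A1" "p \<in> quot G A2" for p
    proof -
      obtain x where x: "x \<in> A1" "p = proj G x" using p unfolding orbits_def by blast
      then have "x \<in> T1.sat A2" "x \<in> T1.sat A1"
        using p T1.proj_in_quot_iff[of A2 x] T1.proj_in_quot_iff[of A1 x] T1.A T2.A by auto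
      then show False using sat_disjoint by blast
    qed
    then show ?thesis by blast
  qed
  show "quot G X1 \<inter> quot G X2 = {}" "quot G H1 \<inter> quot G H2 = {}"
    using 1 T1.quot_mono[OF T1.XH_A(2)] T1.quot_mono[OF T2.XH_A(2)]
      T1.quot_mono[OF T1.XH_A(3)] T1.quot_mono[OF T2.XH_A(3)] by blast+
qed

text \<open>
  The image of \<open>X1\<close> is connected, and within the geodesic boundary it is open and closed, because the
  two tubes have disjoint open images.
\<close>

lemma component_X1: "quot G X1 \<in> connected_components_of (subtopology T1.N (geodesic_boundary G M))"
proof (rule clopen_connected_component)
  let ?B = "quot G X1 \<union> quot G X2"
  have sub: "quot G X1 \<subseteq> quot G A1" "quot G X2 \<subseteq> quot G A2" using T1.quot_mono T1.XH_A T2.XH_A by auto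
  have op: "openin T1.N (quot G A1)" "openin T1.N (quot G A2)"
    using T1.openin_quot T1.open_sat T1.A T2.A by auto
  have tb: "topspace (subtopology T1.N ?B) = ?B"
    using T1.quot_mono[OF T1.XH_hyp(1)] T1.quot_mono[OF T2.XH_hyp(1)] by auto
  show "connectedin (subtopology T1.N (geodesic_boundary G M)) (quot G X1)"
    unfolding geodesic_boundary_eq connectedin_subtopology
    using T1.connectedin_quot[OF T1.XH_hyp(1) connected_hyperplane[OF T1.half_space]] by blast
  have 1: "quot G X1 = quot G A1 \<inter> ?B" "?B - quot G X1 = quot G A2 \<inter> ?B" using sub quot_disjoint by blast+
  then show "openin (subtopology T1.N (geodesic_boundary G M)) (quot G X1)"
    unfolding geodesic_boundary_eq openin_subtopology using op by blast
  have "openin (subtopology T1.N ?B) (?B - quot G X1)"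
    unfolding openin_subtopology using op 1 by blast
  then show "closedin (subtopology T1.N (geodesic_boundary G M)) (quot G X1)"
    unfolding geodesic_boundary_eq closedin_def tb by blast
  show "quot G X1 \<noteq> {}" using nonempty by (auto simp: orbits_def)
qed

lemma boundary_hypersurfaces:
  assumes "\<not> X2 \<subseteq> H1" "\<not> X1 \<subseteq> H2"
  shows "boundary_hypersurfaces G F1 X1 F2 X2"
proof -
  have c2: "quot G X2 \<in> connected_components_of (subtopology T1.N (geodesic_boundary G M))"
    using two_tubes.component_X1[OF swap] by (simp only: M_swap)
  show ?thesis
    unfolding boundary_hypersurfaces_def Let_def
    using T1.half_space T2.half_space assms T1.quot_embeds_X T1.quot_embeds_H T2.quot_embeds_X T2.quot_embeds_H
      T1.totally_geodesic T2.totally_geodesic T1.frontier_quot_H T2.frontier_quot_H component_X1 c2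
      quot_disjoint has_geodesic_boundary
    by (intro exI[of _ H1] exI[of _ H2]) auto
qed

text \<open>
  The segment from \<open>a\<close> to \<open>b\<close> is connected and meets two disjoint open translates of the tubes. So it
  contains a point \<open>m\<close> outside both of them, and \<open>m\<close> has distance at least \<open>d1\<close> from \<open>a\<close> and at least
  \<open>d2\<close> from \<open>b\<close>.
\<close>

lemma hdist_translates:
  assumes a: "a \<in> T1.sat X1" and b: "b \<in> T1.sat X2"
  shows "d1 + d2 \<le> hdist a b"
proof -
  obtain g x where g: "g \<in> G" "x \<in> X1" "a = g x" using a unfolding T1.sat_def by blast
  obtain h y where h: "h \<in> G" "y \<in> X2" "b = h y" using b unfolding T1.sat_def by blast
  have ab: "a \<in> hyp" "b \<in> hyp" "x \<in> hyp" "y \<in> hyp" using g h T1.XH_hyp T2.XH_hyp T1.closed by auto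
  have disj: "g ` A1 \<inter> h ` A2 = {}" using sat_disjoint g h unfolding T1.sat_def by blast
  have op: "open (g ` A1)" "open (h ` A2)" using T1.open_image g h T1.A T2.A by auto
  have "a \<in> g ` A1" "b \<in> h ` A2" using g h T1.XH_A T2.XH_A by auto
  moreover have "a \<in> closed_segment a b" "b \<in> closed_segment a b" by auto
  ultimately have "\<not> closed_segment a b \<subseteq> g ` A1 \<union> h ` A2"
    using connectedD[OF connected_segment(1)[of a b] op] disj by blast
  then obtain m where m: "m \<in> closed_segment a b" "m \<notin> g ` A1" "m \<notin> h ` A2" by blast
  have mh: "m \<in> hyp" using closed_segment_hyp ab m by blast
  have "d1 \<le> hdist a m"
  proof (rule ccontr)
    assume l: "\<not> d1 \<le> hdist a m"
    obtain k where k: "k \<in> G" "\<And>x. x \<in> hyp \<Longrightarrow> k (g x) = x" "\<And>x. x \<in> hyp \<Longrightarrow> g (k x) = x" using T1.inverse[OF g(1)] by blast 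
    have "hdist (k m) x = hdist m a" using T1.dist_eq[OF g(1) T1.closed[OF k(1) mh] ab(3)] k mh g by simp
    then have "k m \<in> A1" using T1.near[OF T1.closed[OF k(1) mh], of x] g l by (simp add: hdist_eq cosh_dist_commute)
    then show False using m(2) k(3)[OF mh] by force
  qed
  moreover have "d2 \<le> hdist m b"
  proof (rule ccontr)
    assume l: "\<not> d2 \<le> hdist m b"
    obtain k where k: "k \<in> G" "\<And>x. x \<in> hyp \<Longrightarrow> k (h x) = x" "\<And>x. x \<in> hyp \<Longrightarrow> h (k x) = x" using T1.inverse[OF h(1)] by blast 
    have "hdist (k m) y = hdist m b" using T1.dist_eq[OF h(1) T1.closed[OF k(1) mh] ab(4)] k mh h by simp
    then have "k m \<in> A2" using T2.near[OF T1.closed[OF k(1) mh], of y] h l by simp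
    then show False using m(3) k(3)[OF mh] by force
  qed
  ultimately show ?thesis using hdist_additive_on_segment[OF ab(1,2) m(1)] by linarith
qed

end

section \<open>The common perpendicular\<close>

text \<open>
  The square of the signed distance is determined by the minimal distance to the points of the
  hyperplane, and its sign by the half-spaces; the isometry preserves both.
\<close>

lemma side_isometry_invariant:
  assumes e: "lorentz e e = 1" and f: "f \<in> carrier hyp_isom"
    and X: "f ` {x \<in> hyp. side e x = 0} = {x \<in> hyp. side e x = 0}"
    and U: "f ` {x \<in> hyp. side e x < 0} = {x \<in> hyp. side e x < 0}"
    and x: "x \<in> hyp"
  shows "side e (f x) = side e x"
proof -
  have fx: "f x \<in> hyp" using hyp_isom_closed f x by blast
  obtain y where y: "y \<in> hyp" "side e y = 0" "cosh_dist x y = sqrt (1 + (side e x)\<^sup>2)"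
    using foot_of_perpendicular[OF x e] .
  have "f y \<in> hyp" "side e (f y) = 0" using X y by blast+
  then have "sqrt (1 + (side e (f x))\<^sup>2) \<le> cosh_dist (f x) (f y)" using cosh_dist_ge_side fx e by blast
  then have 1: "(side e (f x))\<^sup>2 \<le> (side e x)\<^sup>2" using hyp_isom_cosh_dist[OF f x y(1)] y(3) by simp
  obtain z where z: "z \<in> hyp" "side e z = 0" "cosh_dist (f x) z = sqrt (1 + (side e (f x))\<^sup>2)"
    using foot_of_perpendicular[OF fx e] .
  then have "z \<in> f ` {x \<in> hyp. side e x = 0}" using X by blast
  then obtain z' where z': "z' \<in> hyp" "side e z' = 0" "z = f z'" by blast
  have "sqrt (1 + (side e x)\<^sup>2) \<le> cosh_dist x z'" using cosh_dist_ge_side x z' e by blast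
  then have 2: "(side e x)\<^sup>2 \<le> (side e (f x))\<^sup>2" using hyp_isom_cosh_dist[OF f x z'(1)] z'(3) z(3) by simp
  have abs: "\<bar>side e (f x)\<bar> = \<bar>side e x\<bar>" using 1 2 by (metis order_antisym power2_eq_iff abs_eq_iff)
  have "f x \<in> f ` {x \<in> hyp. side e x < 0} \<longleftrightarrow> x \<in> {x \<in> hyp. side e x < 0}"
    using inj_on_image_mem_iff[of f hyp x "{x \<in> hyp. side e x < 0}"] hyp_isomD(2)[OF f] x
    by (simp add: bij_betw_def)
  then have "side e (f x) < 0 \<longleftrightarrow> side e x < 0" using U x fx by simp
  with abs show ?thesis by linarith
qed

lemma hyperplane_eq_normal:
  fixes X :: "(real^'n) set"
  assumes X: "hyperplane X" and c: "c \<in> X" and n: "n \<noteq> 0" and perp: "\<And>y. y \<in> X \<Longrightarrow> n \<bullet> (y - c) = 0"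
  shows "X = {x \<in> hyp. n \<bullet> (x - c) = 0}"
proof -
  obtain a b where ab: "\<bar>b\<bar> < norm a" "X = {x \<in> hyp. a \<bullet> x = b}" using X unfolding hyperplane_def by blast
  have a0: "a \<noteq> 0" using ab(1) by auto
  have cb: "a \<bullet> c = b" "c \<in> hyp" using c ab by auto
  define v where "v = n - ((a \<bullet> n) / (a \<bullet> a)) *\<^sub>R a"
  have av: "a \<bullet> v = 0" using a0 by (simp add: v_def inner_diff_right)
  have "n \<bullet> v = 0"
  proof -
    obtain \<epsilon> where e: "\<epsilon> > 0" "ball c \<epsilon> \<subseteq> hyp" using open_hyp cb open_contains_ball by blast
    \<comment> \<open>So small that \<open>c + t *\<^sub>R v\<close> is still in the ball, whatever the size of \<open>v\<close>.\<close>
    define t where "t = \<epsilon> / 2 / (norm v + 1)"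
    have nv: "norm v + 1 > 0" by (smt (verit) norm_ge_zero)
    then have t: "t > 0" using e by (simp add: t_def)
    have "norm (t *\<^sub>R v) = t * norm v" using t by simp
    also have "\<dots> = \<epsilon> / 2 * (norm v / (norm v + 1))" by (simp add: t_def)
    also have "\<dots> \<le> \<epsilon> / 2 * 1" using e nv by (intro mult_left_mono) auto
    also have "\<dots> < \<epsilon>" using e by simp
    finally have "c + t *\<^sub>R v \<in> ball c \<epsilon>" by (simp add: dist_norm)
    then have "c + t *\<^sub>R v \<in> X" using e cb av by (auto simp: ab inner_add_right)
    then have "n \<bullet> (t *\<^sub>R v) = 0" using perp[of "c + t *\<^sub>R v"] by simp
    then show ?thesis using t by simp
  qed
  then have "v \<bullet> v = 0" using av by (simp add: v_def inner_diff_left inner_diff_right inner_commute)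
  then have "v = 0" by simp
  then have na: "n = ((a \<bullet> n) / (a \<bullet> a)) *\<^sub>R a" (is "n = ?l *\<^sub>R a") by (simp add: v_def)
  then have l: "?l \<noteq> 0" using n by (metis scaleR_zero_left)
  have "n \<bullet> (x - c) = 0 \<longleftrightarrow> a \<bullet> x = b" for x
  proof -
    have "n \<bullet> (x - c) = ?l * (a \<bullet> x - b)" by (subst na) (simp add: inner_diff_right cb right_diff_distrib diff_divide_distrib)
    then show ?thesis using l by simp
  qed
  then show ?thesis using ab by simp
qed

text \<open>
  The unit tangent vector at \<open>p\<close> that points to \<open>q\<close>. It is also the unit normal of the hyperplane
  through \<open>p\<close> perpendicular to the geodesic from \<open>p\<close> to \<open>q\<close>.
\<close>

definition perp :: "real^'n \<Rightarrow> real^'n \<Rightarrow> real \<times> (real^'n)" where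
  "perp p q = (1 / sinh (hdist p q)) *\<^sub>R (lift q - cosh (hdist p q) *\<^sub>R lift p)"

lemma side_perp: "side (perp p q) x = (cosh (hdist p q) * cosh_dist x p - cosh_dist x q) / sinh (hdist p q)"
  by (simp add: side_def perp_def cosh_dist_def lorentz_linear)

lemma lorentz_perp:
  assumes "p \<in> hyp" "q \<in> hyp" "p \<noteq> q"
  shows "lorentz (perp p q) (perp p q) = 1"
proof -
  let ?D = "hdist p q"
  have s: "sinh ?D > 0" using hdist_pos[OF assms] by simp
  have c: "lorentz (lift p) (lift q) = - cosh ?D" "lorentz (lift q) (lift p) = - cosh ?D"
    using assms by (simp_all add: cosh_hdist cosh_dist_def lorentz_commute[of "lift q" "lift p"])
  let ?v = "lift q - cosh ?D *\<^sub>R lift p"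
  have "lorentz ?v ?v = (cosh ?D)\<^sup>2 - 1"
    using assms by (simp add: lorentz_linear lorentz_lift_self c power2_eq_square)
  then have "lorentz ?v ?v = sinh ?D * sinh ?D"
    using cosh_square_eq[of ?D] by (simp add: power2_eq_square[of "sinh _"])
  then have "lorentz (perp p q) (perp p q) = 1 / sinh ?D * (1 / sinh ?D * (sinh ?D * sinh ?D))"
    unfolding perp_def lorentz_linear(5,6) by simp
  then show ?thesis using s by simp
qed

lemma side_perp_at:
  assumes "p \<in> hyp" "q \<in> hyp" "p \<noteq> q"
  shows "side (perp p q) p = 0" "side (perp p q) q = sinh (hdist p q)"
proof -
  have s: "sinh (hdist p q) > 0" using hdist_pos[OF assms] by simp
  show "side (perp p q) p = 0" using assms by (simp add: side_perp cosh_dist_self cosh_hdist)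
  have "side (perp p q) q = ((cosh (hdist p q))\<^sup>2 - 1) / sinh (hdist p q)"
    using assms by (simp add: side_perp cosh_dist_self cosh_hdist cosh_dist_commute[of q p] power2_eq_square)
  also have "(cosh (hdist p q))\<^sup>2 - 1 = sinh (hdist p q) * sinh (hdist p q)"
    using cosh_square_eq[of "hdist p q"] by (simp add: power2_eq_square[of "sinh _"])
  finally show "side (perp p q) q = sinh (hdist p q)" using s by simp
qed

text \<open>
  Up to positive factors, pairing with \<open>q - p\<close> in the Riemannian metric at \<open>p\<close> is the Euclidean pairing
  with the vector \<open>n\<close> of the proof, which is the space component of \<open>perp p q\<close>. So \<open>n\<close> is a Euclidean
  normal vector of \<open>X\<close>.
\<close>

lemma hyperplane_eq_side_perp:
  assumes X: "hyperplane X" and p: "p \<in> X" and q: "q \<in> hyp" and pq: "p \<noteq> q"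
    and perp: "\<And>y. y \<in> X \<Longrightarrow> hinner p (q - p) (y - p) = 0"
  shows "X = {x \<in> hyp. side (perp p q) x = 0}"
proof -
  have ph: "p \<in> hyp" using X p unfolding hyperplane_def by auto
  have w: "1 - p \<bullet> p > 0" "1 - q \<bullet> q > 0" using ph q by (auto simp: hyp_inner_less_1)
  have s: "sinh (hdist p q) > 0" using hdist_pos[OF ph q pq] by simp
  define k where "k = (1 - p \<bullet> q) / (1 - p \<bullet> p)"
  define n where "n = q - k *\<^sub>R p"
  have hin: "hinner p (q - p) v = (n \<bullet> v) / (1 - p \<bullet> p)" for v
  proof -
    have "hinner p (q - p) v = (((q - p) \<bullet> v) + (p \<bullet> (q - p)) / (1 - p \<bullet> p) * (p \<bullet> v)) / (1 - p \<bullet> p)"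
      using w by (simp add: hinner_def add_divide_distrib power2_eq_square)
    also have "(p \<bullet> (q - p)) / (1 - p \<bullet> p) = 1 - k"
      using w by (simp add: k_def inner_diff_right field_simps)
    also have "((q - p) \<bullet> v) + (1 - k) * (p \<bullet> v) = n \<bullet> v"
      by (simp add: n_def inner_diff_left algebra_simps)
    finally show ?thesis .
  qed
  have sn: "side (perp p q) x = (n \<bullet> (x - p)) / (sinh (hdist p q) * (sqrt (1 - x \<bullet> x) * sqrt (1 - q \<bullet> q)))"
    if x: "x \<in> hyp" for x
  proof -
    have wx: "1 - x \<bullet> x > 0" using x by (auto simp: hyp_inner_less_1)
    have kp: "k * (1 - p \<bullet> p) = 1 - p \<bullet> q" using w by (simp add: k_def)
    have "cosh (hdist p q) * cosh_dist x p = cosh_dist p q * cosh_dist x p" using ph q by (simp add: cosh_hdist)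
    also have "\<dots> = ((1 - p \<bullet> q) * (1 - x \<bullet> p)) / ((sqrt (1 - p \<bullet> p) * sqrt (1 - p \<bullet> p)) * (sqrt (1 - x \<bullet> x) * sqrt (1 - q \<bullet> q)))"
      by (simp add: cosh_dist_eq mult_ac)
    also have "sqrt (1 - p \<bullet> p) * sqrt (1 - p \<bullet> p) = 1 - p \<bullet> p" using w by simp
    also have "((1 - p \<bullet> q) * (1 - x \<bullet> p)) / ((1 - p \<bullet> p) * (sqrt (1 - x \<bullet> x) * sqrt (1 - q \<bullet> q)))
        = k * (1 - x \<bullet> p) / (sqrt (1 - x \<bullet> x) * sqrt (1 - q \<bullet> q))" by (simp add: k_def)
    finally have "cosh (hdist p q) * cosh_dist x p - cosh_dist x q
        = (k * (1 - x \<bullet> p) - (1 - x \<bullet> q)) / (sqrt (1 - x \<bullet> x) * sqrt (1 - q \<bullet> q))"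
      by (simp add: cosh_dist_eq diff_divide_distrib)
    also have "k * (1 - x \<bullet> p) - (1 - x \<bullet> q) = n \<bullet> (x - p)"
      using kp by (simp add: n_def inner_diff_left inner_diff_right inner_commute algebra_simps)
    finally show ?thesis by (simp add: side_perp)
  qed
  have "n \<noteq> 0"
  proof
    assume "n = 0"
    then have "side (perp p q) q = 0" using sn[OF q] by simp
    then show False using side_perp_at(2)[OF ph q pq] s by simp
  qed
  moreover have "n \<bullet> (y - p) = 0" if "y \<in> X" for y using perp[OF that] w by (simp add: hin)
  ultimately have "X = {x \<in> hyp. n \<bullet> (x - p) = 0}" using hyperplane_eq_normal X p by blast
  moreover have "n \<bullet> (x - p) = 0 \<longleftrightarrow> side (perp p q) x = 0" if "x \<in> hyp" for x
    using sn[OF that] s w that by (simp add: hyp_inner_less_1)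
  ultimately show ?thesis by blast
qed

section \<open>Half-spaces perpendicular to the common perpendicular\<close>

text \<open>
  The closed half-space that is bounded by the hyperplane perpendicular to the geodesic from \<open>p\<close> to
  \<open>q\<close> at distance \<open>d\<close> from \<open>p\<close>, on the side away from \<open>p\<close>. Indeed, the quotient of
  \<open>side (perp p q) x\<close> and \<open>cosh_dist x p\<close> is the hyperbolic tangent of the signed distance from \<open>p\<close>
  to the projection of \<open>x\<close> to that geodesic.
\<close>

definition zone :: "real^'n \<Rightarrow> real^'n \<Rightarrow> real \<Rightarrow> (real^'n) set" where
  "zone p q d = {x \<in> hyp. tanh d * cosh_dist x p \<le> side (perp p q) x}"

text \<open>
  A form that treats \<open>p\<close> and \<open>q\<close> alike, so that zones with respect to \<open>p\<close> and to \<open>q\<close> can be compared.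
\<close>

lemma zone_iff:
  assumes "p \<in> hyp" "q \<in> hyp" "p \<noteq> q" "x \<in> hyp"
  shows "x \<in> zone p q d \<longleftrightarrow> cosh d * cosh_dist x q \<le> cosh (hdist p q - d) * cosh_dist x p"
proof -
  let ?D = "hdist p q"
  have s: "sinh ?D > 0" using hdist_pos[OF assms(1-3)] by simp
  have c: "cosh d > 0" by simp
  have "x \<in> zone p q d \<longleftrightarrow> (sinh d / cosh d) * cosh_dist x p \<le> (cosh ?D * cosh_dist x p - cosh_dist x q) / sinh ?D"
    using assms(4) by (simp add: zone_def side_perp tanh_def)
  also have "\<dots> \<longleftrightarrow> sinh d * cosh_dist x p * sinh ?D \<le> (cosh ?D * cosh_dist x p - cosh_dist x q) * cosh d"
    using s c by (simp add: field_simps)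
  also have "\<dots> \<longleftrightarrow> cosh d * cosh_dist x q \<le> (cosh ?D * cosh d - sinh ?D * sinh d) * cosh_dist x p"
    by (simp add: algebra_simps)
  finally show ?thesis by (simp add: cosh_diff)
qed

lemma zone_cover:
  fixes p q :: "real^'n"
  assumes pq: "p \<in> hyp" "q \<in> hyp" "p \<noteq> q" and d: "d1 > 0" "d2 > 0" "d1 + d2 < hdist p q"
  shows "hyp \<subseteq> zone p q d1 \<union> zone q p d2"
proof
  fix x :: "real^'n" assume x: "x \<in> hyp"
  let ?D = "hdist p q"
  have C: "cosh_dist x p > 0" "cosh_dist x q > 0" using cosh_dist_pos x pq by auto
  show "x \<in> zone p q d1 \<union> zone q p d2"
  proof (rule ccontr)
    assume "x \<notin> zone p q d1 \<union> zone q p d2"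
    then have a: "cosh (?D - d1) * cosh_dist x p < cosh d1 * cosh_dist x q"
      and b: "cosh (?D - d2) * cosh_dist x q < cosh d2 * cosh_dist x p"
      using zone_iff[OF pq x] zone_iff[of q p x d2] pq x by (auto simp: hdist_commute[of q p])
    have "cosh d2 < cosh (?D - d1)" "cosh d1 < cosh (?D - d2)" 
      using d by (auto intro: cosh_real_strict_mono)
    then have "cosh d2 * cosh_dist x p < cosh (?D - d1) * cosh_dist x p" "cosh d1 * cosh_dist x q < cosh (?D - d2) * cosh_dist x q"
      using C by auto
    with a b show False by linarith
  qed
qed

text \<open>
  The hypersurface at signed distance \<open>d\<close> from the hyperplane through \<open>p\<close> touches the zone at the
  point of the geodesic at distance \<open>d\<close> from \<open>p\<close>, and its other points lie outside the zone.
\<close>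

lemma tube_outside_zone:
  assumes pq: "p \<in> hyp" "q \<in> hyp" "p \<noteq> q" and d: "d > 0" and x: "x \<in> hyp" "side (perp p q) x < sinh d"
  shows "x \<notin> zone p q d"
proof
  let ?s = "side (perp p q) x"
  assume "x \<in> zone p q d"
  then have "tanh d * cosh_dist x p \<le> ?s" by (simp add: zone_def)
  moreover have "sqrt (1 + ?s\<^sup>2) \<le> cosh_dist x p"
    using cosh_dist_ge_side[OF x(1) pq(1) lorentz_perp[OF pq]] side_perp_at[OF pq] by simp
  moreover have t: "tanh d > 0" using d by simp
  ultimately have "tanh d * sqrt (1 + ?s\<^sup>2) \<le> ?s"
    by (meson mult_le_cancel_left_pos order_trans)
  moreover have "tanh d * sqrt (1 + ?s\<^sup>2) \<ge> 0" using t by simp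
  ultimately have "(tanh d * sqrt (1 + ?s\<^sup>2))\<^sup>2 \<le> ?s\<^sup>2" and s0: "?s \<ge> 0" by (auto intro: power_mono)
  then have "(tanh d)\<^sup>2 * (1 + ?s\<^sup>2) \<le> ?s\<^sup>2" by (simp add: power_mult_distrib)
  then have "(sinh d)\<^sup>2 * (1 + ?s\<^sup>2) \<le> ?s\<^sup>2 * (cosh d)\<^sup>2"
    by (simp add: tanh_def power_divide field_simps)
  then have "(sinh d)\<^sup>2 \<le> ?s\<^sup>2" by (simp add: cosh_square_eq algebra_simps)
  then have "sinh d \<le> ?s" using s0 by (rule power2_le_imp_le)
  with x show False by simp
qed

text \<open>
  Suppose that \<open>x = f z\<close> and \<open>z\<close> are both in the zone. As \<open>f\<close> preserves the signed distance to the
  hyperplane, \<open>x\<close> satisfies the inequality that defines the zone with centre \<open>p\<close> and with centre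
  \<open>f p\<close>. By \<open>cosh_dist_add_ge\<close>, the sum of the two inequalities cannot hold if \<open>p\<close> and \<open>f p\<close> are far
  apart; the required separation is that \<open>tanh d\<close> times the hyperbolic cosine of half their
  distance is at least 1.
\<close>

lemma zone_displaced:
  assumes pq: "p \<in> hyp" "q \<in> hyp" "p \<noteq> q" and d: "d > 0"
    and f: "f \<in> carrier hyp_isom" and inv: "\<And>x. x \<in> hyp \<Longrightarrow> side (perp p q) (f x) = side (perp p q) x"
    and far: "1 \<le> tanh d * sqrt ((1 + cosh_dist p (f p)) / 2)" and z: "z \<in> zone p q d"
  shows "f z \<notin> zone p q d"
proof
  assume fz: "f z \<in> zone p q d"
  let ?e = "perp p q"
  have zh: "z \<in> hyp" "f z \<in> hyp" "f p \<in> hyp" using z hyp_isom_closed[OF f] pq by (auto simp: zone_def)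
  let ?s = "side ?e (f z)"
  have "tanh d * cosh_dist (f z) p \<le> ?s" using fz by (simp add: zone_def)
  moreover have "tanh d * cosh_dist (f z) (f p) \<le> ?s"
    using z inv[OF zh(1)] hyp_isom_cosh_dist[OF f zh(1) pq(1)] by (simp add: zone_def)
  ultimately have le: "tanh d * (cosh_dist (f z) p + cosh_dist (f z) (f p)) \<le> 2 * ?s" by (simp add: distrib_left)
  have t: "tanh d > 0" using d by simp
  have "2 * sqrt (1 + ?s\<^sup>2) * sqrt ((1 + cosh_dist p (f p)) / 2) \<le> cosh_dist (f z) p + cosh_dist (f z) (f p)"
    using cosh_dist_add_ge[OF zh(2) pq(1) _ zh(3) _ lorentz_perp[OF pq]] side_perp_at(1)[OF pq] inv[OF pq(1)] by simp
  then have "tanh d * (2 * sqrt (1 + ?s\<^sup>2) * sqrt ((1 + cosh_dist p (f p)) / 2)) \<le> 2 * ?s"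
    using le t by (meson mult_le_cancel_left_pos order_trans)
  then have "(2 * sqrt (1 + ?s\<^sup>2)) * (tanh d * sqrt ((1 + cosh_dist p (f p)) / 2)) \<le> 2 * ?s" by (simp add: mult_ac)
  moreover have "(2 * sqrt (1 + ?s\<^sup>2)) * 1 \<le> (2 * sqrt (1 + ?s\<^sup>2)) * (tanh d * sqrt ((1 + cosh_dist p (f p)) / 2))"
    using far by (intro mult_left_mono) auto
  ultimately have "sqrt (1 + ?s\<^sup>2) \<le> ?s" by linarith
  moreover have "sqrt (1 + ?s\<^sup>2) > sqrt (?s\<^sup>2)" by (rule real_sqrt_less_mono) simp
  ultimately show False by simp
qed

lemma near_half_space_in_tube:
  assumes e: "lorentz e e = 1" and x: "x \<in> hyp" and y: "y \<in> hyp" "side e y \<le> 0"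
    and d: "d > 0" and near: "hdist x y < d"
  shows "side e x < sinh d"
proof (rule ccontr)
  let ?s = "side e x" and ?t = "side e y"
  assume "\<not> ?s < sinh d"
  then have s: "?s \<ge> sinh d" "sinh d > 0" using d by auto
  have "(cosh d)\<^sup>2 = 1 + (sinh d)\<^sup>2" by (simp add: cosh_square_eq)
  also have "\<dots> \<le> 1 + ?s\<^sup>2" using s by (simp add: power_mono)
  finally have "cosh d \<le> sqrt (1 + ?s\<^sup>2)" by (simp add: real_le_rsqrt)
  also have "\<dots> \<le> sqrt (1 + ?s\<^sup>2) * sqrt (1 + ?t\<^sup>2)"
    using mult_left_mono[of 1 "sqrt (1 + ?t\<^sup>2)" "sqrt (1 + ?s\<^sup>2)"] by simp
  also have "\<dots> \<le> sqrt (1 + ?s\<^sup>2) * sqrt (1 + ?t\<^sup>2) - ?s * ?t"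
    using mult_nonneg_nonpos[of ?s ?t] s y by linarith
  also have "\<dots> \<le> cosh_dist x y" by (rule cosh_dist_ge_sides[OF x y(1) e])
  finally show False using near d x y by (simp add: hdist_less_iff)
qed

text \<open>
  If \<open>d1 < t < D - d2\<close>, the hyperplane perpendicular to the geodesic from \<open>p\<close> to \<open>q\<close> at distance \<open>t\<close>
  from \<open>p\<close> lies in the interior of the slab between the two zone boundaries. In the Klein model the
  interior is cut out of the ball by two strict affine inequalities, and these make sense at
  infinity as well; so the affine hyperplane also supplies a point of the sphere, provided
  that \<open>n \<ge> 2\<close>.
\<close>

lemma slab:
  fixes p q :: "real^'n"
  assumes pq: "p \<in> hyp" "q \<in> hyp" "p \<noteq> q" and d: "d1 > 0" "d2 > 0" "d1 + d2 < hdist p q"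
  obtains T where "open T" "T \<inter> hyp \<subseteq> zone p q d1 \<inter> zone q p d2" "T \<inter> hyp \<noteq> {}"
    "CARD('n) \<ge> 2 \<Longrightarrow> T \<inter> sphere 0 1 \<noteq> {}"
proof -
  let ?D = "hdist p q"
  \<comment> \<open>\<open>cosh_dist\<close> without the normalisation of \<open>x\<close>, hence affine in \<open>x\<close> and defined beyond the ball.\<close>
  define g where "g y x = - lorentz (1, x) (lift y)" for x y :: "real^'n"
  have g_eq: "g y x = (1 - x \<bullet> y) / sqrt (1 - y \<bullet> y)" for x y :: "real^'n"
    by (simp add: g_def lorentz_def lift_def diff_divide_distrib)
  have g_cosh_dist: "cosh_dist x y = g y x / sqrt (1 - x \<bullet> x)" for x y :: "real^'n"
    by (simp add: cosh_dist_eq g_eq mult.commute)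
  have gcont: "continuous_on UNIV (g y)" for y unfolding g_eq[abs_def] divide_inverse by (intro continuous_intros)
  define T where "T = {x. cosh d1 * g q x < cosh (?D - d1) * g p x} \<inter> {x. cosh d2 * g p x < cosh (?D - d2) * g q x}"
  have oT: "open T" unfolding T_def
    by (intro open_Int open_Collect_less continuous_intros gcont)
  have sub: "T \<inter> hyp \<subseteq> zone p q d1 \<inter> zone q p d2"
  proof
    fix x assume x: "x \<in> T \<inter> hyp"
    then have w: "sqrt (1 - x \<bullet> x) > 0" "x \<in> hyp" by (auto simp: hyp_inner_less_1)
    have "cosh d1 * cosh_dist x q \<le> cosh (?D - d1) * cosh_dist x p" "cosh d2 * cosh_dist x p \<le> cosh (?D - d2) * cosh_dist x q"
      using x w by (auto simp: T_def g_cosh_dist divide_le_cancel)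
    then show "x \<in> zone p q d1 \<inter> zone q p d2"
      using zone_iff[OF pq w(2)] zone_iff[of q p x d2] pq w by (simp add: hdist_commute[of q p])
  qed
  define t where "t = (d1 + (?D - d2)) / 2"
  have t: "d1 < t" "t < ?D - d2" "0 < t" "t < ?D" using d by (auto simp: t_def field_simps)
  \<comment> \<open>A normal vector of the hyperplane perpendicular to the geodesic at distance \<open>t\<close> from \<open>p\<close>.\<close>
  define n where "n = cosh t *\<^sub>R lift q - cosh (?D - t) *\<^sub>R lift p"
  have D: "?D > 0" using d by linarith
  have inT: "x \<in> T" if x: "lorentz (1, x) n = 0" "g p x > 0" for x
  proof -
    have eq: "cosh t * g q x = cosh (?D - t) * g p x"
      using x(1) by (simp add: n_def g_def lorentz_linear)
    have "cosh (?D - d1) * cosh t - cosh (?D - t) * cosh d1 = sinh ?D * sinh (t - d1)"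
      by (simp add: cosh_diff sinh_diff algebra_simps)
    moreover have "sinh ?D * sinh (t - d1) > 0" using D t by simp
    ultimately have 1: "cosh (?D - t) * cosh d1 < cosh (?D - d1) * cosh t" by linarith
    have "cosh t * (cosh d1 * g q x) = (cosh (?D - t) * cosh d1) * g p x" using eq by (simp add: mult_ac)
    also have "\<dots> < (cosh (?D - d1) * cosh t) * g p x" using 1 x(2) by (rule mult_strict_right_mono)
    also have "\<dots> = cosh t * (cosh (?D - d1) * g p x)" by simp
    finally have A: "cosh d1 * g q x < cosh (?D - d1) * g p x" by simp
    have "cosh (?D - d2) * cosh (?D - t) - cosh t * cosh d2 = sinh ?D * sinh (?D - t - d2)"
    proof -
      have "cosh (u + v - w) * cosh u - cosh v * cosh w = sinh (u + v) * sinh (u - w)" for u v w :: real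
      proof -
        have "(cosh u)\<^sup>2 = 1 + (sinh u)\<^sup>2" by (simp add: cosh_square_eq)
        then show ?thesis
          unfolding cosh_diff sinh_diff cosh_add sinh_add power2_eq_square by algebra
      qed
      from this[of "?D - t" t d2] show ?thesis by simp
    qed
    moreover have "sinh ?D * sinh (?D - t - d2) > 0" using D t by simp
    ultimately have 2: "cosh t * cosh d2 < cosh (?D - d2) * cosh (?D - t)" by linarith
    have "cosh t * (cosh d2 * g p x) = (cosh t * cosh d2) * g p x" by simp
    also have "\<dots> < (cosh (?D - d2) * cosh (?D - t)) * g p x" using 2 x(2) by (rule mult_strict_right_mono)
    also have "\<dots> = cosh t * (cosh (?D - d2) * g q x)" using eq by (simp add: mult_ac)
    finally have B: "cosh d2 * g p x < cosh (?D - d2) * g q x" by simp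
    show ?thesis using A B by (simp add: T_def)
  qed
  have nn: "lorentz n n > 0"
  proof -
    have c: "lorentz (lift p) (lift q) = - cosh ?D" "lorentz (lift q) (lift p) = - cosh ?D"
      using pq by (simp_all add: cosh_hdist cosh_dist_def lorentz_commute[of "lift q" "lift p"])
    have "lorentz n n = 2 * cosh t * cosh (?D - t) * cosh ?D - (cosh t)\<^sup>2 - (cosh (?D - t))\<^sup>2"
      using pq by (simp add: n_def lorentz_linear lorentz_lift_self c power2_eq_square algebra_simps)
    also have "\<dots> = (sinh ?D)\<^sup>2"
    proof -
      have "2 * cosh u * cosh v * cosh (u + v) - (cosh u)\<^sup>2 - (cosh v)\<^sup>2 = (sinh (u + v))\<^sup>2" for u v :: real
      proof -
        have "(sinh u)\<^sup>2 = (cosh u)\<^sup>2 - 1" "(sinh v)\<^sup>2 = (cosh v)\<^sup>2 - 1" by (simp_all add: cosh_square_eq)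
        then show ?thesis
          unfolding cosh_add sinh_add power2_eq_square by algebra
      qed
      from this[of t "?D - t"] show ?thesis by simp
    qed
    finally show ?thesis using D by simp
  qed
  have normal: "(fst n)\<^sup>2 < snd n \<bullet> snd n" using nn by (simp add: lorentz_def power2_eq_square)
  have n0: "snd n \<bullet> snd n > 0" using normal by (smt (verit) zero_le_power2)
  have lorn: "lorentz (1, x) n = snd n \<bullet> x - fst n" for x by (simp add: lorentz_def inner_commute)
  \<comment> \<open>The point of the affine hyperplane nearest to the origin.\<close>
  define c where "c = (fst n / (snd n \<bullet> snd n)) *\<^sub>R snd n"
  have nc: "snd n \<bullet> c = fst n" using n0 by (simp add: c_def)
  have "c \<bullet> c = (fst n / (snd n \<bullet> snd n)) * fst n" using nc by (simp add: c_def)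
  then have cc: "c \<bullet> c = (fst n)\<^sup>2 / (snd n \<bullet> snd n)" by (simp add: power2_eq_square)
  then have "c \<bullet> c < 1" using normal n0 by simp
  then have c: "c \<in> hyp" by (simp add: hyp_inner_less_1)
  have gpos: "g y x > 0" if "y \<in> hyp" "norm x \<le> 1" for x y
    using hyp_inner_less_1'[OF that] that by (simp add: g_eq inner_commute hyp_inner_less_1)
  have "c \<in> T" by (rule inT) (use lorn nc gpos[OF pq(1), of c] c in \<open>auto simp: hyp_def\<close>)
  then have ne: "T \<inter> hyp \<noteq> {}" using c by blast
  have "T \<inter> sphere 0 1 \<noteq> {}" if "CARD('n) \<ge> 2"
  proof -
    have "2 \<le> DIM(real^'n)" using that by simp
    then obtain v :: "real^'n" where v: "v \<noteq> 0" "orthogonal (snd n) v" by (rule orthogonal_to_vector_exists)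
    then have nv: "snd n \<bullet> v = 0" by (simp add: orthogonal_def)
    define r where "r = sqrt (1 - c \<bullet> c) / norm v"
    define \<xi> where "\<xi> = c + r *\<^sub>R v"
    have "c \<bullet> v = 0" using nv by (simp add: c_def)
    then have "\<xi> \<bullet> \<xi> = c \<bullet> c + r * r * (v \<bullet> v)"
      by (simp add: \<xi>_def inner_add_left inner_add_right inner_commute)
    also have "r * r * (v \<bullet> v) = sqrt (1 - c \<bullet> c) * sqrt (1 - c \<bullet> c)"
      using v(1) by (simp add: r_def dot_square_norm power2_eq_square)
    also have "\<dots> = 1 - c \<bullet> c" using \<open>c \<bullet> c < 1\<close> by simp
    finally have x1: "norm \<xi> = 1" by (simp add: norm_eq_sqrt_inner)
    have "snd n \<bullet> \<xi> = fst n" using nc nv by (simp add: \<xi>_def inner_add_right)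
    then have "\<xi> \<in> T" by (intro inT) (use lorn gpos[OF pq(1), of \<xi>] x1 in auto)
    then show ?thesis using x1 by auto
  qed
  with oT sub ne that show ?thesis by blast
qed

section \<open>The injectivity radius\<close>

lemma r_fun_nonneg: "0 \<le> x \<Longrightarrow> r_fun x \<ge> 0"
proof -
  assume x: "0 \<le> x"
  show ?thesis
  proof (cases x)
    case (real t)
    show ?thesis
    proof (cases "t = 0")
      case False
      then have t: "t > 0" using x real by simp
      then have "sinh (t/2) > 0" "cosh (t/2) > sinh (t/2)" by (simp_all add: sinh_less_cosh_real)
      then have "cosh (t/2) / sinh (t/2) \<ge> 1" by simp
      then show ?thesis using real False by (simp add: r_fun_def zero_ereal_def Let_def)
    qed (simp add: real r_fun_def)
  qed (use x in \<open>auto simp: r_fun_def\<close>)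
qed

text \<open>
  The value \<open>1 / cosh t\<close> is the sine of the angle of parallelism at \<open>t\<close>. The formula turns a lower
  bound on \<open>d\<close> in terms of \<open>r\<close> into the separation that is required in \<open>zone_displaced\<close>.
\<close>

lemma tanh_ln_coth: 
  assumes "(t::real) > 0"
  shows "tanh (ln (cosh (t/2) / sinh (t/2))) = 1 / cosh t"
proof -
  let ?c = "cosh (t/2)" and ?s = "sinh (t/2)"
  have s: "?s > 0" "?c > 0" using assms by simp_all
  have "exp (- 2 * ln (?c / ?s)) = (?s / ?c)\<^sup>2"
    using s by (simp add: ln_div exp_diff exp_minus exp_double field_simps power2_eq_square)
  then have "tanh (ln (?c / ?s)) = (1 - (?s / ?c)\<^sup>2) / (1 + (?s / ?c)\<^sup>2)" by (simp add: tanh_real_altdef)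
  also have "\<dots> = (?c\<^sup>2 - ?s\<^sup>2) / (?c\<^sup>2 + ?s\<^sup>2)"
    using s by (simp add: power_divide divide_simps)
  also have "?c\<^sup>2 - ?s\<^sup>2 = 1" by (simp add: cosh_square_eq)
  also have "?c\<^sup>2 + ?s\<^sup>2 = cosh t" using cosh_double[of "t/2"] by simp
  finally show ?thesis .
qed

text \<open>
  Otherwise the midpoint of \<open>x\<close> and \<open>f x\<close>, which lies in \<open>X\<close>, would be a common point of the disc of
  radius \<open>\<rho>\<close> about \<open>x\<close> and its translate about \<open>f x\<close>.
\<close>

lemma displacement_ge_disjoint_radius:
  assumes F: "fuchsian F X" and x: "x \<in> X" and f: "f \<in> F" "f \<noteq> \<one>\<^bsub>hyp_isom\<^esub>"
    and \<rho>: "\<rho> \<ge> 0" "disjoint_family_on (\<lambda>f. f ` (X \<inter> hball x \<rho>)) F"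
  shows "cosh \<rho> \<le> sqrt ((1 + cosh_dist x (f x)) / 2)"
proof (rule ccontr)
  assume less: "\<not> cosh \<rho> \<le> sqrt ((1 + cosh_dist x (f x)) / 2)"
  have "hyperplane X" using F by (simp add: fuchsian_def)
  then obtain U where "half_space_of X U" by (rule hyperplane_half_spaceE)
  then obtain e where e: "lorentz e e = 1" "X = {x \<in> hyp. side e x = 0}" by (rule half_space_ofE)
  have sF: "subgroup F hyp_isom" and fX: "f ` X = X"
    using F f unfolding fuchsian_def discrete_subgroup_def by blast+
  have fc: "f \<in> carrier hyp_isom" by (rule subgroup.mem_carrier[OF sF f(1)])
  have xe: "x \<in> hyp" "side e x = 0" using x e by auto
  have fxe: "f x \<in> hyp" "side e (f x) = 0" using x fX e by blast+
  obtain m where m: "m \<in> hyp" "side e m = 0" "cosh_dist x m = sqrt ((1 + cosh_dist x (f x)) / 2)"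
    "cosh_dist (f x) m = sqrt ((1 + cosh_dist x (f x)) / 2)"
    using hyp_midpoint[OF xe fxe] .
  have mX: "m \<in> X" using m e by blast
  have 1: "m \<in> X \<inter> hball x \<rho>" using mX m xe less \<rho> by (simp add: hball_def hdist_less_iff)
  have "m \<in> f ` X" using fX mX by simp
  then obtain m' where m': "m' \<in> X" "m = f m'" by blast
  have "cosh_dist x m' = cosh_dist (f x) m" using hyp_isom_cosh_dist[OF fc xe(1)] m' e by auto
  then have "m' \<in> X \<inter> hball x \<rho>" using m' m xe less \<rho> e by (simp add: hball_def hdist_less_iff)
  then have 2: "m \<in> f ` (X \<inter> hball x \<rho>)" using m' by blast
  have "\<one>\<^bsub>hyp_isom\<^esub> m = m" using m by (simp add: hyp_isom_one)
  then have 3: "m \<in> \<one>\<^bsub>hyp_isom\<^esub> ` (X \<inter> hball x \<rho>)" using 1 by (intro image_eqI[OF _ 1]) simp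
  have "\<one>\<^bsub>hyp_isom\<^esub> \<in> F" using sF by (rule subgroup.one_closed)
  then have "f ` (X \<inter> hball x \<rho>) \<inter> \<one>\<^bsub>hyp_isom\<^esub> ` (X \<inter> hball x \<rho>) = {}"
    using \<rho>(2) f unfolding disjoint_family_on_def by blast
  with 2 3 show False by blast
qed

lemma inj_radius_nonneg:
  assumes "x \<in> hyp"
  shows "0 \<le> inj_radius F X x"
proof -
  let ?R = "{\<rho>. 0 \<le> \<rho> \<and> disjoint_family_on (\<lambda>f. f ` (X \<inter> hball x \<rho>)) F}"
  have "hball x 0 = {}" using assms hdist_nonneg by (force simp: hball_def)
  then have "0 \<in> ?R" by (simp add: disjoint_family_on_def)
  then have "ereal 0 \<le> inj_radius F X x" unfolding inj_radius_def by (intro Sup_upper imageI)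
  then show ?thesis by (simp add: zero_ereal_def)
qed

lemma far_displacement:
  assumes F: "fuchsian F X" and x: "x \<in> X" and f: "f \<in> F" "f \<noteq> \<one>\<^bsub>hyp_isom\<^esub>"
    and d: "r_fun (inj_radius F X x) < ereal d"
  shows "1 \<le> tanh d * sqrt ((1 + cosh_dist x (f x)) / 2)"
proof -
  let ?R = "{\<rho>. 0 \<le> \<rho> \<and> disjoint_family_on (\<lambda>f. f ` (X \<inter> hball x \<rho>)) F}"
  let ?i = "inj_radius F X x"
  have xh: "x \<in> hyp" using F x unfolding fuchsian_def hyperplane_def by auto
  then have i0: "0 \<le> ?i" by (rule inj_radius_nonneg)
  have "0 < ereal d" using r_fun_nonneg[OF i0] d by (rule order_le_less_trans)
  then have d0: "d > 0" by simp
  then have th: "0 < tanh d" "tanh d < 1" by (simp_all add: tanh_real_lt_1)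
  \<comment> \<open>The radius with \<open>tanh d * cosh \<tau> = 1\<close>; it is \<open>r d\<close>.\<close>
  define \<tau> where "\<tau> = arcosh (1 / tanh d)"
  have \<tau>: "cosh \<tau> = 1 / tanh d" "\<tau> \<ge> 0" using th by (simp_all add: \<tau>_def)
  have "ereal \<tau> < ?i"
  proof (cases ?i)
    case (real t)
    have "t \<noteq> 0"
    proof
      assume "t = 0"
      then have "r_fun ?i = \<infinity>" using real by (simp add: r_fun_def zero_ereal_def)
      then show False using d by simp
    qed
    then have t: "t > 0" using i0 real by simp
    then have "r_fun ?i = ereal (ln (cosh (t/2) / sinh (t/2)))"
      using real by (simp add: r_fun_def zero_ereal_def Let_def)
    then have "ln (cosh (t/2) / sinh (t/2)) < d" using d by simp
    then have "1 / cosh t < tanh d" 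
      using strict_monoD[OF tanh_real_strict_mono] tanh_ln_coth[OF t] by metis
    then have "cosh \<tau> < cosh t" using th by (simp add: \<tau>(1) field_simps)
    then have "\<tau> < t" using t \<tau>(2) by (simp add: cosh_real_nonneg_less_iff)
    then show ?thesis using real by simp
  qed (use i0 in auto)
  then obtain \<rho> where \<rho>: "\<rho> \<in> ?R" "ereal \<tau> < ereal \<rho>"
    unfolding inj_radius_def by (auto simp: less_Sup_iff)
  then have "cosh \<tau> \<le> cosh \<rho>" using \<tau>(2) by (simp add: cosh_real_nonneg_le_iff)
  also have "\<dots> \<le> sqrt ((1 + cosh_dist x (f x)) / 2)"
    using displacement_ge_disjoint_radius[OF F x f] \<rho>(1) by blast
  finally show ?thesis using th by (simp add: \<tau>(1) field_simps)
qed

section \<open>The group generated by two fuchsian subgroups\<close>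

lemma fuchsianD:
  assumes "fuchsian F X"
  shows "hyperplane X" "subgroup F hyp_isom" "\<And>f. f \<in> F \<Longrightarrow> f ` X = X"
    "\<And>f U. f \<in> F \<Longrightarrow> half_space_of X U \<Longrightarrow> f ` U = U"
  using assms unfolding fuchsian_def discrete_subgroup_def by blast+

lemma fuchsian_side_perp:
  assumes F: "fuchsian F X" and p: "p \<in> X" and q: "q \<in> hyp" "p \<noteq> q"
    and perp: "\<And>y. y \<in> X \<Longrightarrow> hinner p (q - p) (y - p) = 0"
  shows "X = {x \<in> hyp. side (perp p q) x = 0}"
    and "half_space_of X {x \<in> hyp. side (perp p q) x < 0}"
    and "\<And>f x. f \<in> F \<Longrightarrow> x \<in> hyp \<Longrightarrow> side (perp p q) (f x) = side (perp p q) x"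
proof -
  have ph: "p \<in> hyp" using p hyperplane_subset_hyp[OF fuchsianD(1)[OF F]] by blast
  have e: "lorentz (perp p q) (perp p q) = 1" using lorentz_perp[OF ph q] .
  show X: "X = {x \<in> hyp. side (perp p q) x = 0}"
    using hyperplane_eq_side_perp[OF fuchsianD(1)[OF F] p q perp] .
  show hs: "half_space_of X {x \<in> hyp. side (perp p q) x < 0}"
    unfolding X using half_space_ofI[of "perp p q"] e by simp
  fix f x assume f: "f \<in> F" and x: "x \<in> (hyp :: (real^'a) set)"
  show "side (perp p q) (f x) = side (perp p q) x"
    by (rule side_isometry_invariant[OF e subgroup.mem_carrier[OF fuchsianD(2)[OF F] f] _ _ x])
       (use fuchsianD(3)[OF F f] fuchsianD(4)[OF F f hs] X in auto)
qed

text \<open>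
  The last two assumptions are the form in which the injectivity radii enter; they follow from
  \<open>r_fun (inj_radius F1 X1 x1) < d1\<close> and its counterpart by \<open>far_displacement\<close>.
\<close>

locale fuchsian_pair =
  fixes F1 F2 :: "(real^'n \<Rightarrow> real^'n) set" and X1 X2 :: "(real^'n) set" and x1 x2 :: "real^'n"
    and d1 d2 :: real
  assumes fuchsian: "fuchsian F1 X1" "fuchsian F2 X2"
    and common_perp: "common_perpendicular X1 X2 x1 x2"
    and d: "d1 > 0" "d2 > 0" "d1 + d2 < hdist x1 x2"
    and far1: "f \<in> F1 \<Longrightarrow> f \<noteq> \<one>\<^bsub>hyp_isom\<^esub> \<Longrightarrow> 1 \<le> tanh d1 * sqrt ((1 + cosh_dist x1 (f x1)) / 2)"
    and far2: "f \<in> F2 \<Longrightarrow> f \<noteq> \<one>\<^bsub>hyp_isom\<^esub> \<Longrightarrow> 1 \<le> tanh d2 * sqrt ((1 + cosh_dist x2 (f x2)) / 2)"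
begin

abbreviation "G \<equiv> generate hyp_isom (F1 \<union> F2)"
text \<open>
  \<open>H1\<close> is the half-space of \<open>X1\<close> that does not contain \<open>x2\<close>, and \<open>A1\<close> is \<open>H1\<close> with a collar of width
  \<open>d1\<close>; likewise on the other side.
\<close>

abbreviation "A1 \<equiv> {x \<in> hyp. side (perp x1 x2) x < sinh d1}"
abbreviation "A2 \<equiv> {x \<in> hyp. side (perp x2 x1) x < sinh d2}"
abbreviation "H1 \<equiv> {x \<in> hyp. side (perp x1 x2) x < 0}"
abbreviation "H2 \<equiv> {x \<in> hyp. side (perp x2 x1) x < 0}"

lemma feet: "x1 \<in> X1" "x2 \<in> X2" "x1 \<in> hyp" "x2 \<in> hyp" "x1 \<noteq> x2" "x2 \<noteq> x1"
  using common_perp hyperplane_subset_hyp fuchsianD(1)[OF fuchsian(1)] fuchsianD(1)[OF fuchsian(2)]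
  unfolding common_perpendicular_def by blast+

lemma perp1: "y \<in> X1 \<Longrightarrow> hinner x1 (x2 - x1) (y - x1) = 0"
  and perp2: "y \<in> X2 \<Longrightarrow> hinner x2 (x1 - x2) (y - x2) = 0"
  using common_perp unfolding common_perpendicular_def by blast+

lemmas side1 = fuchsian_side_perp[OF fuchsian(1) feet(1) feet(4,5) perp1]
lemmas side2 = fuchsian_side_perp[OF fuchsian(2) feet(2) feet(3,6) perp2]

lemma sub: "subgroup F1 hyp_isom" "subgroup F2 hyp_isom"
  using fuchsianD(2) fuchsian by blast+

lemma carrier1: "f \<in> F1 \<Longrightarrow> f \<in> carrier hyp_isom" and carrier2: "f \<in> F2 \<Longrightarrow> f \<in> carrier hyp_isom"
  by (rule subgroup.mem_carrier[OF sub(1)], assumption) (rule subgroup.mem_carrier[OF sub(2)], assumption)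

sublocale PP: ping_pong hyp_isom F1 F2 hyp "\<lambda>f. f" "zone x1 x2 d1" "zone x2 x1 d2"
proof (intro ping_pong.intro two_subgroups.intro two_subgroups_axioms.intro ping_pong_axioms.intro)
  show "group (hyp_isom :: (real^'n \<Rightarrow> real^'n) monoid)" "subgroup F1 hyp_isom" "subgroup F2 hyp_isom"
    "group_action (hyp_isom :: (real^'n \<Rightarrow> real^'n) monoid) hyp (\<lambda>f. f)"
    by (fact group_hyp_isom sub hyp_isom_action)+
  show "zone x1 x2 d1 \<subseteq> hyp" "zone x2 x1 d2 \<subseteq> hyp" by (auto simp: zone_def)
  show "hyp \<subseteq> zone x1 x2 d1 \<union> zone x2 x1 d2" using zone_cover[OF feet(3-5) d] .
  show "f z \<notin> zone x1 x2 d1" if "f \<in> F1" "f \<noteq> \<one>\<^bsub>hyp_isom\<^esub>" "z \<in> zone x1 x2 d1" for f z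
    using zone_displaced[OF feet(3-5) d(1) carrier1[OF that(1)] side1(3)[OF _ that(1)] far1[OF that(1,2)] that(3)] by blast
  show "f z \<notin> zone x2 x1 d2" if "f \<in> F2" "f \<noteq> \<one>\<^bsub>hyp_isom\<^esub>" "z \<in> zone x2 x1 d2" for f z
    using zone_displaced[OF feet(4,3,6) d(2) carrier2[OF that(1)] side2(3)[OF _ that(1)] far2[OF that(1,2)] that(3)] by blast
  obtain T where "T \<inter> hyp \<subseteq> zone x1 x2 d1 \<inter> zone x2 x1 d2" "T \<inter> (hyp :: (real^'n) set) \<noteq> {}"
    using slab[OF feet(3-5) d] by metis
  then show "zone x1 x2 d1 \<inter> zone x2 x1 d2 \<noteq> {}" by blast
qed

lemma A_outside: "A1 \<subseteq> hyp - zone x1 x2 d1" "A2 \<subseteq> hyp - zone x2 x1 d2"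
  using tube_outside_zone[OF feet(3-5) d(1)] tube_outside_zone[OF feet(4,3,6) d(2)] by blast+

lemma A_invariant: "f \<in> F1 \<Longrightarrow> z \<in> A1 \<Longrightarrow> f z \<in> A1" "f \<in> F2 \<Longrightarrow> z \<in> A2 \<Longrightarrow> f z \<in> A2"
  using side1(3) side2(3) hyp_isom_closed[OF carrier1] hyp_isom_closed[OF carrier2] by auto

lemma F_sub_G: "F1 \<subseteq> G" "F2 \<subseteq> G"
  by (auto intro: generate.incl)

lemma G_subgroup: "subgroup G hyp_isom" by (rule PP.generate_subgroup)

lemma
  assumes g: "g \<in> G" and z: "z \<in> A1"
  shows precise1: "g z \<in> A1 \<Longrightarrow> g \<in> F1" and disjoint: "g z \<notin> A2"
proof -
  show "g \<in> F1" if "g z \<in> A1"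
    by (rule PP.precisely_invariant(2)[OF A_outside, of g z]) (use A_invariant g z that in blast)+
  show "g z \<notin> A2"
    by (rule PP.precisely_invariant(1)[OF A_outside, of g z]) (use A_invariant g z in blast)+
qed

lemma precise2:
  assumes g: "g \<in> G" and z: "z \<in> A2"
  shows "g z \<in> A2 \<Longrightarrow> g \<in> F2"
proof (rule ping_pong.precisely_invariant(2)[OF PP.swap A_outside(2,1), of g z])
  show "g \<in> generate hyp_isom (F2 \<union> F1)" using g by (simp add: Un_commute)
qed (use A_invariant z in blast)+

sublocale TT: two_tubes G F1 A1 X1 H1 d1 F2 A2 X2 H2 d2
proof (intro two_tubes.intro two_tubes_axioms.intro half_space_tube.intro half_space_tube_axioms.intro
    precisely_invariant.intro precisely_invariant_axioms.intro isom_group.intro)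
  show "subgroup G hyp_isom" "subgroup F1 hyp_isom" "subgroup F2 hyp_isom" "F1 \<subseteq> G" "F2 \<subseteq> G"
    by (fact G_subgroup sub F_sub_G)+
  show "open A1" "open A2" by (rule open_side_less)+
  show "A1 \<subseteq> hyp" "A2 \<subseteq> hyp" by auto
  show "f z \<in> A1" if "f \<in> F1" "z \<in> A1" for f z using A_invariant(1) that .
  show "f z \<in> A2" if "f \<in> F2" "z \<in> A2" for f z using A_invariant(2) that .
  show "g \<in> F1" if "g \<in> G" "z \<in> A1" "g z \<in> A1" for g z using precise1 that .
  show "g \<in> F2" if "g \<in> G" "z \<in> A2" "g z \<in> A2" for g z using precise2 that .
  show "half_space_of X1 H1" "half_space_of X2 H2" using side1(2) side2(2) by auto
  show "f x \<in> X1" if "f \<in> F1" "x \<in> X1" for f x using fuchsianD(3)[OF fuchsian(1)] that by blast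
  show "f x \<in> X2" if "f \<in> F2" "x \<in> X2" for f x using fuchsianD(3)[OF fuchsian(2)] that by blast
  show "f x \<in> H1" if "f \<in> F1" "x \<in> H1" for f x using fuchsianD(4)[OF fuchsian(1) that(1) side1(2)] that by blast
  show "f x \<in> H2" if "f \<in> F2" "x \<in> H2" for f x using fuchsianD(4)[OF fuchsian(2) that(1) side2(2)] that by blast
  show "0 < d1" "0 < d2" by (fact d)+
  show "x \<in> A1" if "x \<in> hyp" "y \<in> X1 \<union> H1" "hdist x y < d1" for x y
    using near_half_space_in_tube[OF lorentz_perp[OF feet(3-5)] that(1) _ _ d(1) that(3)] that side1(1) by force
  show "x \<in> A2" if "x \<in> hyp" "y \<in> X2 \<union> H2" "hdist x y < d2" for x y
    using near_half_space_in_tube[OF lorentz_perp[OF feet(4,3,6)] that(1) _ _ d(2) that(3)] that side2(1) by force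
  show "g x \<notin> A2" if "g \<in> G" "x \<in> A1" for g x using disjoint that .
  show "X1 \<noteq> {}" "X2 \<noteq> {}" using feet by auto
qed (fact G_subgroup)

lemma boundary: "boundary_hypersurfaces G F1 X1 F2 X2"
proof (rule TT.boundary_hypersurfaces)
  have "hdist x1 x2 > 0" "hdist x2 x1 > 0" using feet hdist_pos by auto
  then have "x2 \<notin> H1" "x1 \<notin> H2" using side_perp_at(2)[OF feet(3-5)] side_perp_at(2)[OF feet(4,3,6)] by auto
  then show "\<not> X2 \<subseteq> H1" "\<not> X1 \<subseteq> H2" using feet by blast+
qed

lemma overlap_unique:
  assumes g: "g \<in> G" "h \<in> G" and z: "z \<in> hyp" "g z \<in> zone x1 x2 d1 \<inter> zone x2 x1 d2" "h z \<in> zone x1 x2 d1 \<inter> zone x2 x1 d2"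
  shows "g = h"
proof -
  let ?k = "h \<otimes>\<^bsub>hyp_isom\<^esub> inv\<^bsub>hyp_isom\<^esub> g"
  have c: "g \<in> carrier hyp_isom" "h \<in> carrier hyp_isom" using g TT.T1.isom by auto
  have k: "?k \<in> G" using g G_subgroup by (simp add: subgroup.m_closed subgroup.m_inv_closed)
  have "?k (g z) = (?k \<otimes>\<^bsub>hyp_isom\<^esub> g) z"
    using c z k TT.T1.isom by (intro PP.composition_rule[symmetric]) auto
  also have "?k \<otimes>\<^bsub>hyp_isom\<^esub> g = h" using c by (simp add: PP.m_assoc)
  finally have "?k = \<one>\<^bsub>hyp_isom\<^esub>" using PP.overlap_trivial_stabilizer[OF k z(2)] z(3) by simp
  then show ?thesis using c by (metis PP.inv_closed PP.inv_equality PP.inv_inv)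
qed

text \<open>
  For a point \<open>p\<close> in the interior of the slab, the image of \<open>p\<close> under \<open>h\<close> lies in the translate of the
  slab by \<open>g\<close> only for \<open>h = g\<close>. This isolates \<open>g\<close> in the topology of pointwise convergence.
\<close>

lemma discrete: "discrete_subgroup G"
  unfolding discrete_subgroup_def
proof
  show "subgroup G hyp_isom" by (rule G_subgroup)
  obtain T where T: "open T" "T \<inter> hyp \<subseteq> zone x1 x2 d1 \<inter> zone x2 x1 d2" "T \<inter> (hyp :: (real^'n) set) \<noteq> {}"
    using slab[OF feet(3-5) d] by metis
  obtain p where p: "p \<in> T" "p \<in> hyp" using T by blast
  let ?PT = "product_topology (\<lambda>_. euclidean) (hyp :: (real^'n) set) :: (real^'n \<Rightarrow> real^'n) topology"
  have GE: "G \<subseteq> topspace ?PT"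
    using hyp_isomD(3)[OF TT.T1.isom] by (auto simp: PiE_def)
  have sing: "openin (subtopology ?PT G) {g}" if g: "g \<in> G" for g
  proof -
    let ?V = "g ` (T \<inter> hyp)"
    have "open ?V" using TT.T1.open_image[OF g] T(1) open_hyp by blast
    then have "openin ?PT {h \<in> topspace ?PT. h p \<in> ?V}"
      using openin_continuous_map_preimage[OF continuous_map_product_projection[OF p(2), of "\<lambda>_. euclidean"]] by simp
    moreover have "{g} = {h \<in> topspace ?PT. h p \<in> ?V} \<inter> G"
    proof (intro equalityI subsetI)
      fix h assume "h \<in> {g}"
      then show "h \<in> {h \<in> topspace ?PT. h p \<in> ?V} \<inter> G" using g GE p by blast
    next
      fix h assume "h \<in> {h \<in> topspace ?PT. h p \<in> ?V} \<inter> G"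
      then obtain q where h: "h \<in> G" "q \<in> T \<inter> hyp" "h p = g q" by blast
      obtain k where k: "k \<in> G" "\<And>x. x \<in> hyp \<Longrightarrow> k (g x) = x" "\<And>x. x \<in> hyp \<Longrightarrow> g (k x) = x"
        using TT.T1.inverse[OF g] by blast
      obtain l where l: "l \<in> G" "\<And>x. x \<in> hyp \<Longrightarrow> l x = k (h x)" using TT.T1.product[OF k(1) h(1)] by blast
      have "l p = q" using l(2)[OF p(2)] k(2)[of q] h by auto
      then have "l = \<one>\<^bsub>hyp_isom\<^esub>" using PP.overlap_trivial_stabilizer[OF l(1), of p] T(2) p h by blast
      then have khx: "k (h x) = x" if "x \<in> hyp" for x using l(2)[OF that] that by (simp add: hyp_isom_one)
      have "h x = g x" for x
      proof (cases "x \<in> hyp")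
        case True
        then have "h x = g (k (h x))" using k(3)[OF TT.T1.closed[OF h(1) True]] by simp
        then show ?thesis using khx[OF True] by simp
      next
        case False
        then show ?thesis using hyp_isomD(3)[OF TT.T1.isom[OF g]] hyp_isomD(3)[OF TT.T1.isom[OF h(1)]]
          by (simp add: extensional_def)
      qed
      then show "h \<in> {g}" by auto
    qed
    ultimately show ?thesis unfolding openin_subtopology by blast
  qed
  have "topspace (subtopology ?PT G) = G" using GE by auto
  then have "discrete_topology G = subtopology ?PT G" using sing discrete_topology_unique by blast
  then show "subtopology ?PT G = discrete_topology G" ..
qed

text \<open>
  In dimension 1 the hyperplanes are points, so that a nontrivial element of \<open>F1\<close> or \<open>F2\<close> would have
  displacement 0 at \<open>x1\<close> or \<open>x2\<close>.
\<close>

lemma trivial_in_dimension_1: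
  assumes "\<not> CARD('n) \<ge> 2" "f \<in> F1 \<union> F2"
  shows "f = \<one>\<^bsub>hyp_isom\<^esub>"
proof (rule ccontr)
  have "CARD('n) = 1" using assms(1) by (metis One_nat_def Suc_leI le_antisym not_less_eq_eq numeral_2_eq_2 zero_less_card_finite)
  then obtain i where i: "(UNIV :: 'n set) = {i}" by (meson card_1_singletonE)
  have all_i: "j = i" for j using i by blast
  have inner: "u \<bullet> v = u $ i * v $ i" for u v :: "real^'n" by (simp add: inner_vec_def i)
  have zero: "w = 0 \<longleftrightarrow> w $ i = 0" for w :: "real^'n" by (auto simp: vec_eq_iff) (metis all_i)
  have single: "x = y" if "hyperplane X" "x \<in> X" "y \<in> X" for X :: "(real^'n) set" and x y
  proof -
    obtain a b where ab: "\<bar>b\<bar> < norm a" "X = {x \<in> hyp. a \<bullet> x = b}" using \<open>hyperplane X\<close> unfolding hyperplane_def by blast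
    then have "a \<noteq> 0" by auto
    moreover have "a \<bullet> (x - y) = 0" using that ab by (simp add: inner_diff_right)
    ultimately have "x - y = 0" using inner zero by simp
    then show ?thesis by simp
  qed
  assume ne: "f \<noteq> \<one>\<^bsub>hyp_isom\<^esub>"
  have no: "\<not> 1 \<le> tanh d * sqrt ((1 + cosh_dist x x) / 2)" if "x \<in> hyp" for x :: "real^'n" and d
    using that tanh_real_lt_1[of d] by (simp add: cosh_dist_self)
  from assms(2) show False
  proof
    assume f: "f \<in> F1"
    then have "f x1 \<in> X1" using fuchsianD(3)[OF fuchsian(1)] feet by blast
    then have "f x1 = x1" using single fuchsianD(1)[OF fuchsian(1)] feet by blast
    then show False using far1[OF f ne] no feet by metis
  next
    assume f: "f \<in> F2"
    then have "f x2 \<in> X2" using fuchsianD(3)[OF fuchsian(2)] feet by blast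
    then have "f x2 = x2" using single fuchsianD(1)[OF fuchsian(2)] feet by blast
    then show False using far2[OF f ne] no feet by metis
  qed
qed

text \<open>
  For \<open>n \<ge> 2\<close> an orbit that accumulates at a point of the sphere in the interior of the slab would have
  two different points in the slab, which \<open>overlap_unique\<close> excludes. The sphere of dimension 0 has no
  point between the two hyperplanes, but then \<open>G\<close> is trivial.
\<close>

lemma second_kind: "second_kind G"
proof (cases "CARD('n) \<ge> 2")
  case True
  obtain T where T: "open T" "T \<inter> hyp \<subseteq> zone x1 x2 d1 \<inter> zone x2 x1 d2" "T \<inter> sphere (0 :: real^'n) 1 \<noteq> {}"
    using slab[OF feet(3-5) d] True by metis
  then obtain \<xi> where xi: "\<xi> \<in> T" "\<xi> \<in> sphere 0 1" by blast
  have "\<xi> \<notin> limit_set G"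
  proof
    assume "\<xi> \<in> limit_set G"
    then obtain x where x: "x \<in> hyp" "\<xi> islimpt {g x | g. g \<in> G}" unfolding limit_set_def by blast
    obtain y where "y \<in> {g x | g. g \<in> G}" "y \<in> T" "y \<noteq> \<xi>" using islimptE[OF x(2) xi(1) T(1)] .
    then obtain g where g: "g \<in> G" "g x \<in> T" "g x \<noteq> \<xi>" by blast
    have "\<xi> \<in> T - {g x}" "open (T - {g x})" using xi g T(1) by auto
    then obtain z where "z \<in> {g x | g. g \<in> G}" "z \<in> T - {g x}" "z \<noteq> \<xi>" by (rule islimptE[OF x(2)])
    then obtain h where h: "h \<in> G" "h x \<in> T - {g x}" by blast
    have "g x \<in> hyp" "h x \<in> hyp" using TT.T1.closed g h x by auto
    then have "g = h" using overlap_unique[OF g(1) h(1) x(1)] T(2) g h by blast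
    then show False using h by simp
  qed
  then show ?thesis using xi unfolding second_kind_def by blast
next
  case False
  then have "F1 \<union> F2 \<subseteq> {\<one>\<^bsub>hyp_isom\<^esub>}" using trivial_in_dimension_1 by blast
  then have "G \<subseteq> {\<one>\<^bsub>hyp_isom\<^esub>}"
    by (rule PP.generate_subgroup_incl[OF _ PP.triv_subgroup])
  then have "finite G" by (rule finite_subset) simp
  then have fin: "finite {g x | g. g \<in> G}" for x by simp
  have "limit_set G = {}" unfolding limit_set_def using islimpt_finite[OF fin] by blast
  moreover have "sphere (0 :: real^'n) 1 \<noteq> {}" by simp
  ultimately show ?thesis unfolding second_kind_def by blast
qed

lemma hdist_orbits: "a \<in> \<Union>(quot G X1) \<Longrightarrow> b \<in> \<Union>(quot G X2) \<Longrightarrow> d1 + d2 \<le> hdist a b"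
  unfolding TT.T1.Union_quot using TT.hdist_translates .

end

lemma dist_sets_eqI:
  assumes "a \<in> A" "b \<in> B" "d a b = m" "\<And>a b. a \<in> A \<Longrightarrow> b \<in> B \<Longrightarrow> m \<le> d a b"
  shows "dist_sets d A B = m"
  unfolding dist_sets_def by (rule cInf_eq_minimum) (use assms in blast)+

theorem theorem6:
  fixes F\<^sub>1 F\<^sub>2 G :: "(real^'n \<Rightarrow> real^'n) set" and X\<^sub>1 X\<^sub>2 :: "(real^'n) set" and x\<^sub>1 x\<^sub>2 :: "real^'n"
  assumes "fuchsian F\<^sub>1 X\<^sub>1" and "fuchsian F\<^sub>2 X\<^sub>2"
    and "closure X\<^sub>1 \<inter> closure X\<^sub>2 = {}"
    and "common_perpendicular X\<^sub>1 X\<^sub>2 x\<^sub>1 x\<^sub>2"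
    and "r_fun (inj_radius F\<^sub>1 X\<^sub>1 x\<^sub>1) + r_fun (inj_radius F\<^sub>2 X\<^sub>2 x\<^sub>2) < ereal (dist_sets hdist X\<^sub>1 X\<^sub>2)"
    and G_def: "G = generate hyp_isom (F\<^sub>1 \<union> F\<^sub>2)"
  shows "discrete_subgroup G \<and> second_kind G \<and>
     is_free_product_of (isom_subgroup G) F\<^sub>1 F\<^sub>2 \<and>
     boundary_hypersurfaces G F\<^sub>1 X\<^sub>1 F\<^sub>2 X\<^sub>2 \<and>
     dist_sets quot_dist (quot G X\<^sub>1) (quot G X\<^sub>2) = dist_sets hdist X\<^sub>1 X\<^sub>2 \<and>
     (torsion_free (isom_subgroup G) \<longleftrightarrow>
        torsion_free (isom_subgroup F\<^sub>1) \<and> torsion_free (isom_subgroup F\<^sub>2))"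
proof -
  let ?D = "hdist x\<^sub>1 x\<^sub>2"
  let ?i1 = "inj_radius F\<^sub>1 X\<^sub>1 x\<^sub>1" and ?i2 = "inj_radius F\<^sub>2 X\<^sub>2 x\<^sub>2"
  have X: "X\<^sub>1 \<subseteq> hyp" "X\<^sub>2 \<subseteq> hyp" using assms(1,2) fuchsianD(1) hyperplane_subset_hyp by blast+
  have x: "x\<^sub>1 \<in> X\<^sub>1" "x\<^sub>2 \<in> X\<^sub>2" "x\<^sub>1 \<noteq> x\<^sub>2" using assms(4) unfolding common_perpendicular_def by auto
  have D: "?D > 0" using hdist_pos x X by blast
  have "dist_sets hdist X\<^sub>1 X\<^sub>2 \<le> ?D"
    unfolding dist_sets_def
  proof (rule cInf_lower)
    show "bdd_below {hdist a b |a b. a \<in> X\<^sub>1 \<and> b \<in> X\<^sub>2}"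
      by (rule bdd_belowI[of _ 0]) (use hdist_nonneg X in blast)
  qed (use x in blast)
  then have less: "r_fun ?i1 + r_fun ?i2 < ereal ?D" using assms(5) by (meson ereal_less_eq(3) order_less_le_trans)
  have "r_fun ?i1 \<ge> 0" "r_fun ?i2 \<ge> 0"
    using r_fun_nonneg inj_radius_nonneg x X by blast+
  with less obtain r1 r2 where r: "r_fun ?i1 = ereal r1" "r_fun ?i2 = ereal r2" "r1 \<ge> 0" "r2 \<ge> 0" "r1 + r2 < ?D"
    by (cases "r_fun ?i1"; cases "r_fun ?i2") (auto simp: zero_ereal_def)
  have pair: "fuchsian_pair F\<^sub>1 F\<^sub>2 X\<^sub>1 X\<^sub>2 x\<^sub>1 x\<^sub>2 (r1 + (\<eta> - r1 - r2) / 2) (r2 + (\<eta> - r1 - r2) / 2)"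
    if \<eta>: "r1 + r2 < \<eta>" "\<eta> < ?D" for \<eta>
  proof (rule fuchsian_pair.intro)
    let ?d1 = "r1 + (\<eta> - r1 - r2) / 2" and ?d2 = "r2 + (\<eta> - r1 - r2) / 2"
    show "fuchsian F\<^sub>1 X\<^sub>1" "fuchsian F\<^sub>2 X\<^sub>2" "common_perpendicular X\<^sub>1 X\<^sub>2 x\<^sub>1 x\<^sub>2" by (fact assms)+
    show "?d1 > 0" "?d2 > 0" "?d1 + ?d2 < ?D" using r \<eta> by (auto simp: field_simps)
    have "r_fun ?i1 < ereal ?d1" "r_fun ?i2 < ereal ?d2" using r \<eta> by auto
    note r_less = this
    show "1 \<le> tanh ?d1 * sqrt ((1 + cosh_dist x\<^sub>1 (f x\<^sub>1)) / 2)" if "f \<in> F\<^sub>1" "f \<noteq> \<one>\<^bsub>hyp_isom\<^esub>" for f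
      by (rule far_displacement[OF assms(1) x(1) that r_less(1)])
    show "1 \<le> tanh ?d2 * sqrt ((1 + cosh_dist x\<^sub>2 (f x\<^sub>2)) / 2)" if "f \<in> F\<^sub>2" "f \<noteq> \<one>\<^bsub>hyp_isom\<^esub>" for f
      by (rule far_displacement[OF assms(2) x(2) that r_less(2)])
  qed
  have lower: "?D \<le> hdist a b" if ab: "a \<in> \<Union>(quot G X\<^sub>1)" "b \<in> \<Union>(quot G X\<^sub>2)" for a b
  proof (rule dense_le_bounded[OF r(5)])
    fix \<eta> assume \<eta>: "r1 + r2 < \<eta>" "\<eta> < ?D"
    show "\<eta> \<le> hdist a b"
      using fuchsian_pair.hdist_orbits[OF pair[OF \<eta>] ab[unfolded G_def]] by (simp add: field_simps)
  qed
  obtain \<eta> where \<eta>: "r1 + r2 < \<eta>" "\<eta> < ?D" using dense r(5) by blast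
  interpret P: fuchsian_pair F\<^sub>1 F\<^sub>2 X\<^sub>1 X\<^sub>2 x\<^sub>1 x\<^sub>2 "r1 + (\<eta> - r1 - r2) / 2" "r2 + (\<eta> - r1 - r2) / 2"
    by (rule pair[OF \<eta>])
  have sub: "X\<^sub>1 \<subseteq> \<Union>(quot G X\<^sub>1)" "X\<^sub>2 \<subseteq> \<Union>(quot G X\<^sub>2)"
    unfolding G_def P.TT.T1.Union_quot using P.TT.T1.subset_sat X by blast+
  have 1: "dist_sets hdist X\<^sub>1 X\<^sub>2 = ?D"
    by (rule dist_sets_eqI[OF x(1,2) HOL.refl]) (use lower sub in blast)
  have in_proj: "y \<in> proj G y" if "y \<in> hyp" for y
    unfolding G_def using P.TT.T1.in_proj_self[OF that] .
  have 2: "dist_sets quot_dist (quot G X\<^sub>1) (quot G X\<^sub>2) = ?D"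
  proof (rule dist_sets_eqI)
    show pq: "proj G x\<^sub>1 \<in> quot G X\<^sub>1" "proj G x\<^sub>2 \<in> quot G X\<^sub>2" using x by (auto simp: orbits_def)
    show "quot_dist (proj G x\<^sub>1) (proj G x\<^sub>2) = ?D"
      unfolding quot_dist_def
    proof (rule dist_sets_eqI[of x\<^sub>1 _ x\<^sub>2])
      show "x\<^sub>1 \<in> proj G x\<^sub>1" "x\<^sub>2 \<in> proj G x\<^sub>2" using in_proj X x by blast+
    qed (use lower pq in blast)+
    fix p q assume p: "p \<in> quot G X\<^sub>1" and q: "q \<in> quot G X\<^sub>2"
    then obtain y z where yz: "y \<in> X\<^sub>1" "p = proj G y" "z \<in> X\<^sub>2" "q = proj G z" unfolding orbits_def by blast
    show "?D \<le> quot_dist p q"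
      unfolding quot_dist_def dist_sets_def
    proof (rule cInf_greatest)
      have "y \<in> p" "z \<in> q" using yz in_proj X by blast+
      then show "{hdist a b |a b. a \<in> p \<and> b \<in> q} \<noteq> {}" by blast
    qed (use lower p q in blast)
  qed
  show ?thesis
    unfolding G_def using P.discrete P.second_kind P.PP.free_product P.boundary P.PP.torsion_free_iff 1 2[unfolded G_def]
    by auto
qed

end
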